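(* Let $\mathfrak h$ be a finite-dimensional abelian Lie algebra over $k=\mathbb C$ with a non-degenerate symmetric bilinear form $(-,-)$ and Casimir element $\Omega$. Let $\mathfrak l\subset\mathfrak h$ be a subgroup with $(x,y)\in\mathbb Z$ and $(x,x)\in2\mathbb Z$ for all $x,y\in\mathfrak l$, let $\alpha$ be a normalised 2-cocycle of $\mathfrak l$ with values in $k^\times$ such that $\alpha(x,y)\alpha(y,x)^{-1}=e^{\pi i(x,y)}$ for all $x,y\in\mathfrak l$, and let $A=k[\mathfrak l,\alpha]$. Let $\mathfrak l^{\#}=\{x\in\mathfrak h\mid(x,\mathfrak l)\subset\mathbb Z\}$ and let $c:\mathfrak l^{\#}\times\mathfrak l^{\#}\to k^\times$ be the bimultiplicative function $c(x,y)=e^{\pi i(x,y)}$. Then there is a braided monoidal functor $\mathcal G(\mathfrak l^{\#},c)\to{}_A\mathcal C(\mathfrak h,\Omega)^{loc}$ such that, for every $x\in\mathfrak l^{\#}$, the image of $[x]$ belongs to ${}_A\mathcal C(\mathfrak h,\Omega)^{loc}_X$, where $X\in\mathfrak l^{\#}/(\mathfrak l+\mathfrak l^\perp)$ is the coset of $x$.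
   Context: $\Omega=\sum_i u_i\otimes u_i$ for an orthonormal basis $(u_i)$ of $\mathfrak h$. An $\mathfrak h$-module $V$ is locally finite if for any $x\in\mathfrak h$, $v\in V$ there is a nonzero polynomial $f$ with $f(x)v=0$. $\mathcal C(\mathfrak h,\Omega)$ is the category of locally finite $\mathfrak h$-modules with ordinary tensor product and associativity and braiding $c_{M,N}(m\otimes n)=e^{\pi i\Omega}(n\otimes m)$. $k[\mathfrak l,\alpha]$ is the algebra in $\mathcal C(\mathfrak h,\Omega)$ with basis $e_x$, $x\in\mathfrak l$, multiplication $e_xe_y=\alpha(x,y)e_{x+y}$ and $\mathfrak h$-action $z(e_x)=(x,z)e_x$; it is commutative in $\mathcal C(\mathfrak h,\Omega)$. A left $A$-module $M$ in $\mathcal C(\mathfrak h,\Omega)$ with ($\mathfrak h$-linear) action $\nu:A\otimes M\to M$ is local if $\nu(e^{2\pi i\Omega}(a\otimes m))=am$ for all $a\in A,m\in M$. The tensor product $M\otimes_AN$ is the coequaliser of $(\nu_M\otimes1)(c_{M,A}\otimes 1)$ and $1\otimes\nu_N$ from $M\otimes A\otimes N$ to $M\otimes N$; with it and the braiding induced from $\mathcal C(\mathfrak h,\Omega)$, local modules form a braided monoidal category ${}_A\mathcal C(\mathfrak h,\Omega)^{loc}$. A local $A$-module $M$ decomposes as a direct sum of $M_\chi=\{m\in M\mid x(m)=\chi(x)m\ \forall x\in\mathfrak l\}$, $\chi\in Hom(\mathfrak l,\mathbb Z)$; its support is $\{\chi\mid M_\chi\neq0\}$. With $\mathfrak l^\perp=\{x\in\mathfrak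 h\mid(x,\mathfrak l)=0\}$, for $X\in\mathfrak l^{\#}/(\mathfrak l+\mathfrak l^\perp)$ the category ${}_A\mathcal C(\mathfrak h,\Omega)^{loc}_X$ is the full subcategory of local modules whose support is $\{(x+y,-)|_{\mathfrak l}: y\in\mathfrak l\}$ for $x$ a representative of $X$ (together with the zero module). For an abelian group $H$ and a bimultiplicative $c:H\times H\to k^\times$, $\mathcal G(H,c)$ is the category of finite dimensional $H$-graded vector spaces with the usual graded tensor product $(V\otimes U)_h=\bigoplus_{f+g=h}V_f\otimes U_g$, trivial associativity, and braiding $c_{V,U}(v\otimes u)=c(f,g)(u\otimes v)$ for $v\in V_f,u\in U_g$. $[x]$ is the one-dimensional space concentrated in degree $x$. *)

theory Defs
  imports
    Complex_Main
    "HOL-Library.FuncSet"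
    "HOL-Library.Function_Algebras"
    "HOL-Computational_Algebra.Polynomial"
begin

section \<open>Braided monoidal functors\<close>

text \<open>
  The data of a braided monoidal category; the definition of a braided monoidal functor refers
  to nothing else.  Morphisms carry their source and target, so that composition and tensor
  product need no object arguments.
\<close>

record ('o, 'f) arrow =
  src :: 'o
  tgt :: 'o
  fn :: 'f

record ('o, 'a) braided_cat =
  Obj :: "'o set"
  Hom :: "'o \<Rightarrow> 'o \<Rightarrow> 'a set"
  Id :: "'o \<Rightarrow> 'a"
  Comp :: "'a \<Rightarrow> 'a \<Rightarrow> 'a"
  TensO :: "'o \<Rightarrow> 'o \<Rightarrow> 'o"
  TensA :: "'a \<Rightarrow> 'a \<Rightarrow> 'a"
  UnitO :: 'o
  Assoc :: "'o \<Rightarrow> 'o \<Rightarrow> 'o \<Rightarrow> 'a"  \<comment> \<open>\<open>(X \<otimes> Y) \<otimes> Z \<rightarrow> X \<otimes> (Y \<otimes> Z)\<close>\<close>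
  Lunit :: "'o \<Rightarrow> 'a"  \<comment> \<open>\<open>1 \<otimes> X \<rightarrow> X\<close>\<close>
  Runit :: "'o \<Rightarrow> 'a"  \<comment> \<open>\<open>X \<otimes> 1 \<rightarrow> X\<close>\<close>
  Braid :: "'o \<Rightarrow> 'o \<Rightarrow> 'a"  \<comment> \<open>\<open>X \<otimes> Y \<rightarrow> Y \<otimes> X\<close>\<close>

definition is_iso :: "('o, 'a) braided_cat \<Rightarrow> 'o \<Rightarrow> 'o \<Rightarrow> 'a \<Rightarrow> bool" where
  "is_iso C X Y f \<longleftrightarrow> f \<in> Hom C X Y \<and>
     (\<exists>g \<in> Hom C Y X. Comp C g f = Id C X \<and> Comp C f g = Id C Y)"

text \<open>
  \<open>Fo\<close>, \<open>Fa\<close> are the object and morphism maps; \<open>\<phi> X Y : F X \<otimes> F Y \<rightarrow> F (X \<otimes> Y)\<close> and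
  \<open>\<phi>0 : 1 \<rightarrow> F 1\<close> are the (invertible) monoidal constraints.
\<close>

definition braided_monoidal_functor ::
  "('o, 'a) braided_cat \<Rightarrow> ('p, 'b) braided_cat \<Rightarrow> ('o \<Rightarrow> 'p) \<Rightarrow> ('a \<Rightarrow> 'b) \<Rightarrow>
   ('o \<Rightarrow> 'o \<Rightarrow> 'b) \<Rightarrow> 'b \<Rightarrow> bool" where
  "braided_monoidal_functor C D Fo Fa \<phi> \<phi>0 \<longleftrightarrow>
     (\<forall>X \<in> Obj C. Fo X \<in> Obj D) \<and>
     (\<forall>X \<in> Obj C. \<forall>Y \<in> Obj C. \<forall>f \<in> Hom C X Y. Fa f \<in> Hom D (Fo X) (Fo Y)) \<and>
     (\<forall>X \<in> Obj C. Fa (Id C X) = Id D (Fo X)) \<and>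
     (\<forall>X \<in> Obj C. \<forall>Y \<in> Obj C. \<forall>Z \<in> Obj C. \<forall>f \<in> Hom C X Y. \<forall>g \<in> Hom C Y Z.
        Fa (Comp C g f) = Comp D (Fa g) (Fa f)) \<and>
     (\<forall>X \<in> Obj C. \<forall>Y \<in> Obj C.
        is_iso D (TensO D (Fo X) (Fo Y)) (Fo (TensO C X Y)) (\<phi> X Y)) \<and>
     (\<forall>X \<in> Obj C. \<forall>X' \<in> Obj C. \<forall>Y \<in> Obj C. \<forall>Y' \<in> Obj C.
        \<forall>f \<in> Hom C X X'. \<forall>g \<in> Hom C Y Y'.
        Comp D (Fa (TensA C f g)) (\<phi> X Y) = Comp D (\<phi> X' Y') (TensA D (Fa f) (Fa g))) \<and>
     is_iso D (UnitO D) (Fo (UnitO C)) \<phi>0 \<and>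
     (\<forall>X \<in> Obj C. \<forall>Y \<in> Obj C. \<forall>Z \<in> Obj C.
        Comp D (Fa (Assoc C X Y Z))
          (Comp D (\<phi> (TensO C X Y) Z) (TensA D (\<phi> X Y) (Id D (Fo Z)))) =
        Comp D (\<phi> X (TensO C Y Z))
          (Comp D (TensA D (Id D (Fo X)) (\<phi> Y Z)) (Assoc D (Fo X) (Fo Y) (Fo Z)))) \<and>
     (\<forall>X \<in> Obj C.
        Comp D (Fa (Lunit C X)) (Comp D (\<phi> (UnitO C) X) (TensA D \<phi>0 (Id D (Fo X)))) =
        Lunit D (Fo X)) \<and>
     (\<forall>X \<in> Obj C.
        Comp D (Fa (Runit C X)) (Comp D (\<phi> X (UnitO C)) (TensA D (Id D (Fo X)) \<phi>0)) =
        Runit D (Fo X)) \<and>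
     (\<forall>X \<in> Obj C. \<forall>Y \<in> Obj C.
        Comp D (Fa (Braid C X Y)) (\<phi> X Y) = Comp D (\<phi> Y X) (Braid D (Fo X) (Fo Y)))"


section \<open>Vector spaces and tensor products\<close>

text \<open>
  HOL has no type of all complex vector spaces.  Vector spaces are therefore taken inside a
  universe: they are the linear subspaces of the space of all functions from an index type to
  the complex numbers, so every vector space whose dimension is at most the cardinality of the
  index type occurs up to isomorphism.  The index type is closed under pairing (constructor
  \<open>Node\<close>), so that the universe is closed under tensor products; it contains the points of
  \<open>\<hh>\<close> (constructor \<open>Pt\<close>), needed for the group algebra; and \<open>'b\<close> is an arbitrary type by
  which the universe can be enlarged at will.
\<close>

datatype ('h, 'b) idx = Pt 'h | Ex 'b | Node "('h, 'b) idx" "('h, 'b) idx"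

type_synonym ('h, 'b) vec = "('h, 'b) idx \<Rightarrow> complex"

definition fscale :: "complex \<Rightarrow> ('i \<Rightarrow> complex) \<Rightarrow> 'i \<Rightarrow> complex" where
  "fscale c u = (\<lambda>i. c * u i)"

global_interpretation fs: vector_space "fscale :: complex \<Rightarrow> ('i \<Rightarrow> complex) \<Rightarrow> 'i \<Rightarrow> complex"
  by unfold_locales (auto simp: fscale_def fun_eq_iff algebra_simps)

definition linear_on :: "('h, 'b) vec set \<Rightarrow> (('h, 'b) vec \<Rightarrow> ('h, 'b) vec) \<Rightarrow> bool" where
  "linear_on V f \<longleftrightarrow>
     (\<forall>u \<in> V. \<forall>v \<in> V. f (u + v) = f u + f v) \<and> (\<forall>c. \<forall>v \<in> V. f (fscale c v) = fscale c (f v))"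

text \<open>
  The linear map on \<open>V\<close> determined by the condition \<open>P\<close>.  Maps are \<open>extensional\<close> so that
  equality of maps is equality on \<open>V\<close>.
\<close>

definition the_linear ::
  "('h, 'b) vec set \<Rightarrow> ((('h, 'b) vec \<Rightarrow> ('h, 'b) vec) \<Rightarrow> bool) \<Rightarrow> ('h, 'b) vec \<Rightarrow> ('h, 'b) vec"
  where "the_linear V P = (THE f. f \<in> extensional V \<and> linear_on V f \<and> P f)"

definition otimes :: "('h, 'b) vec \<Rightarrow> ('h, 'b) vec \<Rightarrow> ('h, 'b) vec" (infix \<open>\<otimes>\<close> 75) where
  "v \<otimes> w = (\<lambda>i. case i of Node p q \<Rightarrow> v p * w q | _ \<Rightarrow> 0)"

text \<open>
  For subspaces \<open>V\<close>, \<open>W\<close> of function spaces, the map from the abstract tensor product to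
  functions on pairs of indices is injective; its image is a model of the tensor product.
\<close>

definition tensor :: "('h, 'b) vec set \<Rightarrow> ('h, 'b) vec set \<Rightarrow> ('h, 'b) vec set" where
  "tensor V W = fs.span {v \<otimes> w | v w. v \<in> V \<and> w \<in> W}"

definition tlift ::
  "('h, 'b) vec set \<Rightarrow> ('h, 'b) vec set \<Rightarrow> (('h, 'b) vec \<Rightarrow> ('h, 'b) vec \<Rightarrow> ('h, 'b) vec) \<Rightarrow>
   ('h, 'b) vec \<Rightarrow> ('h, 'b) vec" where
  "tlift V W b = the_linear (tensor V W) (\<lambda>f. \<forall>v \<in> V. \<forall>w \<in> W. f (v \<otimes> w) = b v w)"

definition tmap ::
  "('h, 'b) vec set \<Rightarrow> ('h, 'b) vec set \<Rightarrow> (('h, 'b) vec \<Rightarrow> ('h, 'b) vec) \<Rightarrow>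
   (('h, 'b) vec \<Rightarrow> ('h, 'b) vec) \<Rightarrow> ('h, 'b) vec \<Rightarrow> ('h, 'b) vec" where
  "tmap V W f g = tlift V W (\<lambda>v w. f v \<otimes> g w)"

definition flip :: "('h, 'b) vec \<Rightarrow> ('h, 'b) vec" where
  "flip t = (\<lambda>i. case i of Node p q \<Rightarrow> t (Node q p) | _ \<Rightarrow> 0)"

definition reassoc :: "('h, 'b) vec \<Rightarrow> ('h, 'b) vec" where
  "reassoc t = (\<lambda>i. case i of Node p (Node q r) \<Rightarrow> t (Node (Node p q) r) | _ \<Rightarrow> 0)"

lemma flip_otimes: "flip (v \<otimes> w) = w \<otimes> v"
  by (auto simp: flip_def otimes_def fun_eq_iff split: idx.splits)

lemma reassoc_otimes: "reassoc ((u \<otimes> v) \<otimes> w) = u \<otimes> (v \<otimes> w)"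
  by (auto simp: reassoc_def otimes_def fun_eq_iff split: idx.splits)

text \<open>
  A quotient map of \<open>V\<close> by the subspace \<open>R\<close>; the quotient space is modelled by its image.
  (Such a map exists inside the universe: take a projection of \<open>V\<close> along \<open>R\<close>.)
\<close>

definition quot_map :: "('h, 'b) vec set \<Rightarrow> ('h, 'b) vec set \<Rightarrow> ('h, 'b) vec \<Rightarrow> ('h, 'b) vec" where
  "quot_map V R = (SOME q. linear_on V q \<and> {v \<in> V. q v = 0} = R)"

text \<open>
  The exponential of a locally finite endomorphism \<open>T\<close>, applied to \<open>v\<close>.  The vectors \<open>T\<^sup>n v\<close>
  span a finite-dimensional space of functions, on which pointwise convergence is convergence in
  the unique Hausdorff vector space topology.
\<close>

definition lf_exp :: "(('h, 'b) vec \<Rightarrow> ('h, 'b) vec) \<Rightarrow> ('h, 'b) vec \<Rightarrow> ('h, 'b) vec" where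
  "lf_exp T v = (\<lambda>i. \<Sum>n. (T ^^ n) v i / fact n)"


section \<open>Graded vector spaces\<close>

text \<open>
  A graded vector space is the family of its homogeneous components; components of degree
  outside the grading group \<open>H\<close> are zero.
\<close>

type_synonym ('h, 'b) graded = "'h \<Rightarrow> ('h, 'b) vec set"

definition tot :: "('h, 'b) graded \<Rightarrow> ('h, 'b) vec set" where
  "tot V = fs.span (\<Union>h. V h)"

definition graded_obj :: "'h set \<Rightarrow> ('h, 'b) graded set" where
  "graded_obj H = {V.
     (\<forall>h. fs.subspace (V h)) \<and> (\<forall>h. h \<notin> H \<longrightarrow> V h = {0}) \<and>
     (\<forall>S f. finite S \<and> (\<forall>h \<in> S. f h \<in> V h) \<and> (\<Sum>h \<in> S. f h) = 0 \<longrightarrow> (\<forall>h \<in> S. f h = 0)) \<and>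
     (\<exists>S. finite S \<and> fs.span S = tot V)}"

definition graded_hom :: "('h, 'b) graded \<Rightarrow> ('h, 'b) graded \<Rightarrow>
    (('h, 'b) graded, ('h, 'b) vec \<Rightarrow> ('h, 'b) vec) arrow set" where
  "graded_hom V W = {f. src f = V \<and> tgt f = W \<and> fn f \<in> extensional (tot V) \<and>
     linear_on (tot V) (fn f) \<and> (\<forall>h. fn f ` V h \<subseteq> W h)}"

definition graded_tensor ::
  "('h::ab_group_add, 'b) graded \<Rightarrow> ('h, 'b) graded \<Rightarrow> ('h, 'b) graded" where
  "graded_tensor V U = (\<lambda>h. fs.span (\<Union>{tensor (V f) (U g) | f g. f + g = h}))"

definition graded_line :: "'h \<Rightarrow> ('h, 'b) graded" where
  "graded_line x = (\<lambda>h. if h = x then {u. \<forall>i. i \<noteq> Pt x \<longrightarrow> u i = 0} else {0})"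

text \<open>
  The unit object is \<open>graded_line 0\<close>, whose elements are identified with scalars by evaluation at
  \<open>Pt 0\<close>.
\<close>

definition graded_cat :: "'h::ab_group_add set \<Rightarrow> ('h \<Rightarrow> 'h \<Rightarrow> complex) \<Rightarrow>
    (('h, 'b) graded, (('h, 'b) graded, ('h, 'b) vec \<Rightarrow> ('h, 'b) vec) arrow) braided_cat" where
  "graded_cat H c = \<lparr>
     Obj = graded_obj H,
     Hom = graded_hom,
     Id = (\<lambda>V. \<lparr>src = V, tgt = V, fn = restrict id (tot V)\<rparr>),
     Comp = (\<lambda>g f. \<lparr>src = src f, tgt = tgt g, fn = compose (tot (src f)) (fn g) (fn f)\<rparr>),
     TensO = graded_tensor,
     TensA = (\<lambda>f g. \<lparr>src = graded_tensor (src f) (src g), tgt = graded_tensor (tgt f) (tgt g),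
                      fn = tmap (tot (src f)) (tot (src g)) (fn f) (fn g)\<rparr>),
     UnitO = graded_line 0,
     Assoc = (\<lambda>V U W. \<lparr>src = graded_tensor (graded_tensor V U) W,
                        tgt = graded_tensor V (graded_tensor U W),
                        fn = restrict reassoc (tot (graded_tensor (graded_tensor V U) W))\<rparr>),
     Lunit = (\<lambda>V. \<lparr>src = graded_tensor (graded_line 0) V, tgt = V,
                    fn = tlift (tot (graded_line 0)) (tot V) (\<lambda>k v. fscale (k (Pt 0)) v)\<rparr>),
     Runit = (\<lambda>V. \<lparr>src = graded_tensor V (graded_line 0), tgt = V,
                    fn = tlift (tot V) (tot (graded_line 0)) (\<lambda>v k. fscale (k (Pt 0)) v)\<rparr>),
     Braid = (\<lambda>V U. \<lparr>src = graded_tensor V U, tgt = graded_tensor U V,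
                      fn = the_linear (tot (graded_tensor V U))
                        (\<lambda>t. \<forall>f g. \<forall>v \<in> V f. \<forall>u \<in> U g. t (v \<otimes> u) = fscale (c f g) (u \<otimes> v))\<rparr>)\<rparr>"


section \<open>Local modules over a lattice algebra\<close>

record ('h, 'b) hmod =
  carr :: "('h, 'b) vec set"
  act :: "'h \<Rightarrow> ('h, 'b) vec \<Rightarrow> ('h, 'b) vec"

text \<open>\<open>nu\<close> is the action, a linear map from \<open>tensor A M\<close> to \<open>M\<close>.\<close>

record ('h, 'b) amod = "('h, 'b) hmod" +
  nu :: "('h, 'b) vec \<Rightarrow> ('h, 'b) vec"

definition orthonormal_basis ::
  "(complex \<Rightarrow> 'h::ab_group_add \<Rightarrow> 'h) \<Rightarrow> ('h \<Rightarrow> 'h \<Rightarrow> complex) \<Rightarrow> 'h set \<Rightarrow> bool" where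
  "orthonormal_basis sc form B \<longleftrightarrow>
     finite B \<and> \<not> module.dependent sc B \<and> module.span sc B = UNIV \<and>
     (\<forall>u \<in> B. \<forall>v \<in> B. form u v = (if u = v then 1 else 0))"

definition symmetric_bilinear ::
  "(complex \<Rightarrow> 'h::ab_group_add \<Rightarrow> 'h) \<Rightarrow> ('h \<Rightarrow> 'h \<Rightarrow> complex) \<Rightarrow> bool" where
  "symmetric_bilinear sc form \<longleftrightarrow>
     (\<forall>x y z. form (x + y) z = form x z + form y z) \<and>
     (\<forall>c x y. form (sc c x) y = c * form x y) \<and> (\<forall>x y. form x y = form y x)"

definition nondegenerate :: "('h::zero \<Rightarrow> 'h \<Rightarrow> complex) \<Rightarrow> bool" where
  "nondegenerate form \<longleftrightarrow> (\<forall>x. (\<forall>y. form x y = 0) \<longrightarrow> x = 0)"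

definition subgroup_of :: "'h::ab_group_add set \<Rightarrow> bool" where
  "subgroup_of l \<longleftrightarrow> 0 \<in> l \<and> (\<forall>x \<in> l. \<forall>y \<in> l. x - y \<in> l)"

definition normalised_cocycle :: "'h::ab_group_add set \<Rightarrow> ('h \<Rightarrow> 'h \<Rightarrow> complex) \<Rightarrow> bool" where
  "normalised_cocycle l \<alpha> \<longleftrightarrow>
     (\<forall>x \<in> l. \<forall>y \<in> l. \<alpha> x y \<noteq> 0) \<and>
     (\<forall>x \<in> l. \<forall>y \<in> l. \<forall>z \<in> l. \<alpha> x y * \<alpha> (x + y) z = \<alpha> y z * \<alpha> x (y + z)) \<and>
     (\<forall>x \<in> l. \<alpha> x 0 = 1 \<and> \<alpha> 0 x = 1)"

context
  fixes sc :: "complex \<Rightarrow> 'h::ab_group_add \<Rightarrow> 'h"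
    and form :: "'h \<Rightarrow> 'h \<Rightarrow> complex"
    and l :: "'h set"
    and \<alpha> :: "'h \<Rightarrow> 'h \<Rightarrow> complex"
begin

definition dual_lattice :: "'h set" where
  "dual_lattice = {x. \<forall>y \<in> l. form x y \<in> \<int>}"

definition perp :: "'h set" where
  "perp = {x. \<forall>y \<in> l. form x y = 0}"

definition lattice_coset :: "'h \<Rightarrow> 'h set" where
  "lattice_coset x = {x + y + z | y z. y \<in> l \<and> z \<in> perp}"

text \<open>The category of locally finite modules.\<close>

definition lf_module :: "('h, 'b, 'm) hmod_scheme \<Rightarrow> bool" where
  "lf_module M \<longleftrightarrow> fs.subspace (carr M) \<and>
     (\<forall>x. linear_on (carr M) (act M x) \<and> act M x ` carr M \<subseteq> carr M) \<and>
     (\<forall>x y. \<forall>m \<in> carr M. act M (x + y) m = act M x m + act M y m) \<and>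
     (\<forall>c x. \<forall>m \<in> carr M. act M (sc c x) m = fscale c (act M x m)) \<and>
     (\<forall>x y. \<forall>m \<in> carr M. act M x (act M y m) = act M y (act M x m)) \<and>
     (\<forall>x. \<forall>m \<in> carr M. \<exists>f :: complex poly. f \<noteq> 0 \<and>
        (\<Sum>n \<le> degree f. fscale (coeff f n) ((act M x ^^ n) m)) = 0)"

definition tensor_act ::
  "('h, 'b, 'm) hmod_scheme \<Rightarrow> ('h, 'b, 'n) hmod_scheme \<Rightarrow> 'h \<Rightarrow> ('h, 'b) vec \<Rightarrow> ('h, 'b) vec" where
  "tensor_act M N x = tlift (carr M) (carr N) (\<lambda>m n. act M x m \<otimes> n + m \<otimes> act N x n)"

text \<open>The Casimir element does not depend on the orthonormal basis.\<close>

definition Omega ::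
  "('h, 'b, 'm) hmod_scheme \<Rightarrow> ('h, 'b, 'n) hmod_scheme \<Rightarrow> ('h, 'b) vec \<Rightarrow> ('h, 'b) vec" where
  "Omega M N t = (\<Sum>u \<in> (SOME B. orthonormal_basis sc form B).
      tmap (carr M) (carr N) (act M u) (act N u) t)"

definition exp_Omega ::
  "complex \<Rightarrow> ('h, 'b, 'm) hmod_scheme \<Rightarrow> ('h, 'b, 'n) hmod_scheme \<Rightarrow> ('h, 'b) vec \<Rightarrow> ('h, 'b) vec"
  where "exp_Omega c M N = lf_exp (\<lambda>t. fscale c (Omega M N t))"

definition braiding ::
  "('h, 'b, 'm) hmod_scheme \<Rightarrow> ('h, 'b, 'n) hmod_scheme \<Rightarrow> ('h, 'b) vec \<Rightarrow> ('h, 'b) vec" where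
  "braiding M N t = exp_Omega (pi * \<i>) N M (flip t)"

text \<open>The algebra \<open>k[\<ll>, \<alpha>]\<close>, as a module over itself.\<close>

definition ee :: "'h \<Rightarrow> ('h, 'b) vec" where
  "ee x = (\<lambda>i. if i = Pt x then 1 else 0)"

definition lattice_algebra :: "('h, 'b) amod" where
  "lattice_algebra = (let A = fs.span (ee ` l) in
     \<lparr>carr = A,
      act = (\<lambda>z. the_linear A (\<lambda>f. \<forall>x \<in> l. f (ee x) = fscale (form x z) (ee x))),
      nu = the_linear (tensor A A)
             (\<lambda>f. \<forall>x \<in> l. \<forall>y \<in> l. f (ee x \<otimes> ee y) = fscale (\<alpha> x y) (ee (x + y)))\<rparr>)"

text \<open>Left modules \<open>M\<close> over the algebra \<open>A\<close>, with unit \<open>ee 0\<close>, and local modules.\<close>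

definition alg_module :: "('h, 'b) amod \<Rightarrow> bool" where
  "alg_module M \<longleftrightarrow> (let A = lattice_algebra :: ('h, 'b) amod in
     lf_module M \<and>
     linear_on (tensor (carr A) (carr M)) (nu M) \<and>
     nu M ` tensor (carr A) (carr M) \<subseteq> carr M \<and>
     (\<forall>x. \<forall>t \<in> tensor (carr A) (carr M). nu M (tensor_act A M x t) = act M x (nu M t)) \<and>
     (\<forall>a \<in> carr A. \<forall>b \<in> carr A. \<forall>m \<in> carr M.
        nu M (nu A (a \<otimes> b) \<otimes> m) = nu M (a \<otimes> nu M (b \<otimes> m))) \<and>
     (\<forall>m \<in> carr M. nu M (ee 0 \<otimes> m) = m))"

definition local_obj :: "('h, 'b) amod set" where
  "local_obj = {M. alg_module M \<and> (\<forall>a \<in> carr lattice_algebra. \<forall>m \<in> carr M.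
     nu M (exp_Omega (2 * pi * \<i>) lattice_algebra M (a \<otimes> m)) = nu M (a \<otimes> m))}"

definition local_hom ::
  "('h, 'b) amod \<Rightarrow> ('h, 'b) amod \<Rightarrow>
   (('h, 'b) amod, ('h, 'b) vec \<Rightarrow> ('h, 'b) vec) arrow set" where
  "local_hom M N = {f. src f = M \<and> tgt f = N \<and> fn f \<in> extensional (carr M) \<and>
     linear_on (carr M) (fn f) \<and> fn f ` carr M \<subseteq> carr N \<and>
     (\<forall>x. \<forall>m \<in> carr M. fn f (act M x m) = act N x (fn f m)) \<and>
     (\<forall>a \<in> carr lattice_algebra. \<forall>m \<in> carr M. fn f (nu M (a \<otimes> m)) = nu N (a \<otimes> fn f m))}"

text \<open>
  The coequaliser of \<open>(\<nu>\<^sub>M \<otimes> 1)(c\<^sub>M\<^sub>,\<^sub>A \<otimes> 1)\<close> and \<open>1 \<otimes> \<nu>\<^sub>N\<close> is the quotient of the tensor product by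
  the image of their difference; \<open>right_act\<close> is \<open>\<nu>\<^sub>M c\<^sub>M\<^sub>,\<^sub>A\<close>.
\<close>

definition right_act :: "('h, 'b) amod \<Rightarrow> ('h, 'b) vec \<Rightarrow> ('h, 'b) vec" where
  "right_act M t = nu M (braiding M (lattice_algebra :: ('h, 'b) amod) t)"

definition relations :: "('h, 'b) amod \<Rightarrow> ('h, 'b) amod \<Rightarrow> ('h, 'b) vec set" where
  "relations M N = (let A = carr (lattice_algebra :: ('h, 'b) amod) in
     {tmap (tensor (carr M) A) (carr N) (right_act M) id t
        - tmap (carr M) (tensor A (carr N)) id (nu N) (reassoc t)
      | t. t \<in> tensor (tensor (carr M) A) (carr N)})"

definition projA :: "('h, 'b) amod \<Rightarrow> ('h, 'b) amod \<Rightarrow> ('h, 'b) vec \<Rightarrow> ('h, 'b) vec" where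
  "projA M N = quot_map (tensor (carr M) (carr N)) (relations M N)"

definition tensorA_space :: "('h, 'b) amod \<Rightarrow> ('h, 'b) amod \<Rightarrow> ('h, 'b) vec set" where
  "tensorA_space M N = projA M N ` tensor (carr M) (carr N)"

definition tensorA :: "('h, 'b) amod \<Rightarrow> ('h, 'b) amod \<Rightarrow> ('h, 'b) amod" where
  "tensorA M N = (let A = carr (lattice_algebra :: ('h, 'b) amod) in
     \<lparr>carr = tensorA_space M N,
      act = (\<lambda>x. the_linear (tensorA_space M N)
        (\<lambda>f. \<forall>t \<in> tensor (carr M) (carr N). f (projA M N t) = projA M N (tensor_act M N x t))),
      nu = the_linear (tensor A (tensorA_space M N))
        (\<lambda>f. \<forall>a \<in> A. \<forall>m \<in> carr M. \<forall>n \<in> carr N.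
           f (a \<otimes> projA M N (m \<otimes> n)) = projA M N (nu M (a \<otimes> m) \<otimes> n))\<rparr>)"

definition local_cat ::
  "(('h, 'b) amod, (('h, 'b) amod, ('h, 'b) vec \<Rightarrow> ('h, 'b) vec) arrow) braided_cat" where
  "local_cat = \<lparr>
     Obj = local_obj,
     Hom = local_hom,
     Id = (\<lambda>M. \<lparr>src = M, tgt = M, fn = restrict id (carr M)\<rparr>),
     Comp = (\<lambda>g f. \<lparr>src = src f, tgt = tgt g, fn = compose (carr (src f)) (fn g) (fn f)\<rparr>),
     TensO = tensorA,
     TensA = (\<lambda>f g. \<lparr>src = tensorA (src f) (src g), tgt = tensorA (tgt f) (tgt g),
        fn = the_linear (tensorA_space (src f) (src g))
          (\<lambda>h. \<forall>m \<in> carr (src f). \<forall>n \<in> carr (src g).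
             h (projA (src f) (src g) (m \<otimes> n)) = projA (tgt f) (tgt g) (fn f m \<otimes> fn g n))\<rparr>),
     UnitO = lattice_algebra,
     Assoc = (\<lambda>M N P. \<lparr>src = tensorA (tensorA M N) P, tgt = tensorA M (tensorA N P),
        fn = the_linear (tensorA_space (tensorA M N) P)
          (\<lambda>h. \<forall>m \<in> carr M. \<forall>n \<in> carr N. \<forall>p \<in> carr P.
             h (projA (tensorA M N) P (projA M N (m \<otimes> n) \<otimes> p))
               = projA M (tensorA N P) (m \<otimes> projA N P (n \<otimes> p)))\<rparr>),
     Lunit = (\<lambda>M. \<lparr>src = tensorA lattice_algebra M, tgt = M,
        fn = the_linear (tensorA_space lattice_algebra M)
          (\<lambda>h. \<forall>t \<in> tensor (carr lattice_algebra) (carr M).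
             h (projA lattice_algebra M t) = nu M t)\<rparr>),
     Runit = (\<lambda>M. \<lparr>src = tensorA M lattice_algebra, tgt = M,
        fn = the_linear (tensorA_space M lattice_algebra)
          (\<lambda>h. \<forall>t \<in> tensor (carr M) (carr lattice_algebra).
             h (projA M lattice_algebra t) = right_act M t)\<rparr>),
     Braid = (\<lambda>M N. \<lparr>src = tensorA M N, tgt = tensorA N M,
        fn = the_linear (tensorA_space M N)
          (\<lambda>h. \<forall>t \<in> tensor (carr M) (carr N).
             h (projA M N t) = projA N M (braiding M N t))\<rparr>)\<rparr>"

text \<open>
  Characters in \<open>Hom(\<ll>, \<int>)\<close> are complex-valued functions on \<open>\<ll>\<close> (extended by \<open>undefined\<close>)
  taking values in the set \<open>\<int>\<close> of complex integers.
\<close>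

definition characters :: "('h \<Rightarrow> complex) set" where
  "characters = {\<chi> \<in> l \<rightarrow>\<^sub>E \<int>. \<forall>x \<in> l. \<forall>y \<in> l. \<chi> (x + y) = \<chi> x + \<chi> y}"

definition weight_space :: "('h, 'b) amod \<Rightarrow> ('h \<Rightarrow> complex) \<Rightarrow> ('h, 'b) vec set" where
  "weight_space M \<chi> = {m \<in> carr M. \<forall>x \<in> l. act M x m = fscale (\<chi> x) m}"

definition weight_support :: "('h, 'b) amod \<Rightarrow> ('h \<Rightarrow> complex) set" where
  "weight_support M = {\<chi> \<in> characters. weight_space M \<chi> \<noteq> {0}}"

text \<open>
  The component of local modules attached to a coset \<open>X\<close> in \<open>\<ll>\<^sup># / (\<ll> + \<ll>\<^sup>\<bottom>)\<close>; the set of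
  characters does not depend on the representative \<open>x\<close>.
\<close>

definition local_component :: "'h set \<Rightarrow> ('h, 'b) amod set" where
  "local_component X = {M \<in> local_obj. carr M = {0} \<or>
     (\<exists>x \<in> X. weight_support M = (\<lambda>y. restrict (form (x + y)) l) ` l)}"

end

end

theory Submission
  imports Defs
begin

text \<open>
  A graded space \<open>V\<close> is sent to the free module \<open>A \<otimes> V\<close>, in which \<open>e\<^sub>x \<otimes> v\<close> with \<open>v\<close> of degree \<open>h\<close>
  has weight \<open>x + h\<close>; it is local because \<open>(x, h)\<close> is an integer.  Let \<open>q(x, y) = exp (\<pi>i(x, y))\<close>.
  The right action obtained from the braiding is
  \<open>(e\<^sub>x \<otimes> v) \<cdot> e\<^sub>y = q(h, y) \<alpha>(x, y) e\<^sub>x\<^sub>+\<^sub>y \<otimes> v\<close>, and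
  \<open>(e\<^sub>x \<otimes> v) \<otimes> (e\<^sub>y \<otimes> u) \<mapsto> ((e\<^sub>x \<otimes> v) \<cdot> e\<^sub>y) \<otimes> u\<close> identifies
  \<open>(A \<otimes> V) \<otimes>\<^sub>A (A \<otimes> U)\<close> with \<open>A \<otimes> V \<otimes> U\<close>.  Its compatibility with associativity is
  the cocycle identity; its compatibility with the braiding is the commutator identity
  \<open>\<alpha>(x, y) = q(x, y) \<alpha>(y, x)\<close> together with \<open>q(x, g)\<^sup>2 = 1\<close> for \<open>x\<close> in the lattice and \<open>g\<close> in its dual.
  All modules that occur are spanned by weight vectors, on which \<open>exp (c\<Omega>)\<close> is multiplication by
  \<open>exp (c(\<mu>, \<nu>))\<close>, so exponentials of general locally finite operators never enter.
\<close>

text \<open>Why free modules: giving degree \<open>h\<close> the weight \<open>h\<close> turns a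
  graded space into an h-module on which exp(pi i Omega) is the scalar braiding of the source
  category. On objects whose double braiding with the algebra is trivial, the free module functor is
  braided monoidal, and triviality here is the integrality of (x, h) for x in the lattice and h in
  its dual. Two dual elements need not have an integral pairing, so q(h, g) is in general not a sign
  and has to be carried along unchanged.

  The obstacle: a tensor product over the algebra is the image of a quotient map picked by choice,
  and the action, unitors, associator and braiding on it are definite descriptions. Nothing is known
  of such a map until a solution is exhibited, which means that a candidate on the plain tensor
  product respects the relations, and until its values on generators are seen to be forced. The
  relations carry a scalar that depends on the weight of the left factor, so in that form they are
  not linear; rewriting them with the right action, which is linear, allows checks on
  generators.\<close>

section \<open>Linear maps between spaces of functions\<close>

text \<open>
  Vectors are functions, and resolution eta-expands terms of function type; with these simp rules
  active, \<open>0\<close> and \<open>u + v\<close> would then be rewritten to lambda abstractions.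
\<close>

declare plus_fun_apply [simp del] zero_fun_apply [simp del] minus_apply [simp del]

lemma fscale_apply: "fscale c u i = c * u i"
  by (simp add: fscale_def)

lemma sum_fun_apply: "(\<Sum>a\<in>S. f a) i = (\<Sum>a\<in>S. f a i)"
  for f :: "'a \<Rightarrow> 'i \<Rightarrow> complex"
  by (induction S rule: infinite_finite_induct) (auto simp: zero_fun_apply plus_fun_apply)

lemmas pointwise = fscale_apply sum_fun_apply plus_fun_apply zero_fun_apply minus_apply

lemma linear_onI:
  assumes "\<And>u v. u \<in> V \<Longrightarrow> v \<in> V \<Longrightarrow> f (u + v) = f u + f v"
    and "\<And>c v. v \<in> V \<Longrightarrow> f (fscale c v) = fscale c (f v)"
  shows "linear_on V f"
  using assms by (auto simp: linear_on_def)

lemma lin_add: "linear_on V f \<Longrightarrow> u \<in> V \<Longrightarrow> v \<in> V \<Longrightarrow> f (u + v) = f u + f v"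
  and lin_scale: "linear_on V f \<Longrightarrow> v \<in> V \<Longrightarrow> f (fscale c v) = fscale c (f v)"
  by (auto simp: linear_on_def)

lemma lin_zero:
  assumes "linear_on V f" "fs.subspace V" shows "f 0 = 0"
  using lin_scale[OF assms(1) fs.subspace_0[OF assms(2)], of 0] by simp

lemma lin_diff:
  assumes "linear_on V f" "fs.subspace V" "u \<in> V" "v \<in> V" shows "f (u - v) = f u - f v"
  using lin_add[OF assms(1), of "u - v" v] assms(2-4) by (simp add: fs.subspace_diff)

lemma lin_sum:
  assumes f: "linear_on V f" and V: "fs.subspace V" and g: "\<And>i. i \<in> I \<Longrightarrow> g i \<in> V"
  shows "f (\<Sum>i\<in>I. g i) = (\<Sum>i\<in>I. f (g i))"
  using g
  by (induction I rule: infinite_finite_induct)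
    (simp_all add: lin_zero[OF f V] lin_add[OF f] fs.subspace_sum[OF V])

lemma linear_imp_linear_on: "Vector_Spaces.linear fscale fscale f \<Longrightarrow> linear_on V f"
  by (simp add: linear_on_def Vector_Spaces.linear_iff)

lemma lin_cong: "linear_on V f \<Longrightarrow> fs.subspace V \<Longrightarrow> (\<And>v. v \<in> V \<Longrightarrow> f v = g v) \<Longrightarrow> linear_on V g"
  by (auto simp: linear_on_def fs.subspace_add fs.subspace_scale)

lemma lin_restrict: "linear_on V f \<Longrightarrow> fs.subspace V \<Longrightarrow> linear_on V (restrict f V)"
  by (erule lin_cong) auto

lemma lin_id [simp]: "linear_on V id" "linear_on V (\<lambda>v. v)"
  by (auto simp: linear_on_def)

lemma lin_const0 [simp]: "linear_on V (\<lambda>v. 0)"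
  by (auto simp: linear_on_def)

lemma lin_compose:
  "linear_on V f \<Longrightarrow> linear_on W g \<Longrightarrow> (\<And>v. v \<in> V \<Longrightarrow> f v \<in> W) \<Longrightarrow> linear_on V (\<lambda>v. g (f v))"
  by (auto simp: linear_on_def)

lemma lin_plus: "linear_on V f \<Longrightarrow> linear_on V g \<Longrightarrow> linear_on V (\<lambda>v. f v + g v)"
  by (auto simp: linear_on_def fs.scale_right_distrib)

lemma lin_minus: "linear_on V f \<Longrightarrow> linear_on V g \<Longrightarrow> linear_on V (\<lambda>v. f v - g v)"
  by (auto simp: linear_on_def fs.scale_right_diff_distrib)

lemma lin_fscale: "linear_on V f \<Longrightarrow> linear_on V (\<lambda>v. fscale c (f v))"
  by (auto simp: linear_on_def fs.scale_right_distrib fs.scale_left_commute)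

lemma lin_setsum: "(\<And>i. i \<in> I \<Longrightarrow> linear_on V (f i)) \<Longrightarrow> linear_on V (\<lambda>v. \<Sum>i\<in>I. f i v)"
  by (auto simp: linear_on_def sum.distrib fs.scale_sum_right)

lemma lin_memI:
  assumes sp: "V = fs.span G" and f: "linear_on V f" and W: "fs.subspace W"
    and "\<And>x. x \<in> G \<Longrightarrow> f x \<in> W" "v \<in> V"
  shows "f v \<in> W"
proof -
  have "fs.span G \<subseteq> {v \<in> V. f v \<in> W}"
  proof (rule fs.span_minimal)
    show "fs.subspace {v \<in> V. f v \<in> W}"
      by (intro fs.subspaceI) (use W in \<open>auto simp: lin_zero[OF f] lin_add[OF f] lin_scale[OF f]
        fs.subspace_0 fs.subspace_add fs.subspace_scale fs.span_zero fs.span_add fs.span_scale sp\<close>)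
  qed (use assms(4) fs.span_base sp in auto)
  with assms(5) sp show ?thesis by blast
qed

text \<open>The difference of the maps sends generators into the zero subspace. Nearly every
  identity of maps below is reduced to generators in this way.\<close>

lemma lin_eqI:
  assumes "V = fs.span G" "linear_on V f" "linear_on V g" "\<And>x. x \<in> G \<Longrightarrow> f x = g x" "v \<in> V"
  shows "f v = g v"
  using lin_memI[OF assms(1) lin_minus[OF assms(2,3)] fs.subspace_single_0 _ assms(5)] assms(4) by simp

lemma subspace_linear_image:
  assumes f: "linear_on V f" and V: "fs.subspace V" shows "fs.subspace (f ` V)"
proof (rule fs.subspaceI)
  have "f 0 \<in> f ` V" using fs.subspace_0[OF V] by (rule imageI)
  then show "0 \<in> f ` V" unfolding lin_zero[OF f V] .
next
  fix x y assume "x \<in> f ` V" "y \<in> f ` V"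
  then obtain u v where *: "u \<in> V" "v \<in> V" "x = f u" "y = f v" by blast
  have "f (u + v) \<in> f ` V" using fs.subspace_add[OF V *(1,2)] by (rule imageI)
  then show "x + y \<in> f ` V" unfolding lin_add[OF f *(1,2)] *(3,4) .
next
  fix c x assume "x \<in> f ` V"
  then obtain u where *: "u \<in> V" "x = f u" by blast
  have "f (fscale c u) \<in> f ` V" using fs.subspace_scale[OF V *(1)] by (rule imageI)
  then show "fscale c x \<in> f ` V" unfolding lin_scale[OF f *(1)] *(2) .
qed

lemma lin_image_span:
  assumes f: "linear_on (fs.span G) f" shows "f ` fs.span G = fs.span (f ` G)"
proof
  show "f ` fs.span G \<subseteq> fs.span (f ` G)"
    by (rule image_subsetI, rule lin_memI[OF refl f]) (auto intro: fs.span_base)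
  have "f ` G \<subseteq> f ` fs.span G" using fs.span_superset by (rule image_mono)
  then show "fs.span (f ` G) \<subseteq> f ` fs.span G"
    by (rule fs.span_minimal) (intro subspace_linear_image[OF f] fs.subspace_span)
qed

text \<open>A definite description is usable only if a solution exists and \<open>P\<close> fixes it
  on \<open>V\<close>. Passing to \<open>restrict f V\<close> supplies the extensionality that turns
  agreement on \<open>V\<close> into equality.\<close>

lemma the_linear_props:
  assumes f: "linear_on V f" "P (restrict f V)" and V: "fs.subspace V"
    and uniq: "\<And>f g v. linear_on V f \<Longrightarrow> linear_on V g \<Longrightarrow> P f \<Longrightarrow> P g \<Longrightarrow> v \<in> V \<Longrightarrow> f v = g v"
  shows "the_linear V P = restrict f V"
  unfolding the_linear_def
proof (rule the_equality)
  show *: "restrict f V \<in> extensional V \<and> linear_on V (restrict f V) \<and> P (restrict f V)"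
    using f lin_restrict[OF f(1) V] by simp
  fix h assume h: "h \<in> extensional V \<and> linear_on V h \<and> P h"
  have "h v = restrict f V v" if "v \<in> V" for v
    using uniq[of h "restrict f V" v] h * that by blast
  with h show "h = restrict f V"
    by (intro extensionalityI[where A = V and f = h and g = "restrict f V"]) simp_all
qed

text \<open>Uniqueness for the common case that \<open>P\<close> prescribes the values on a spanning
  set.\<close>

lemma the_linear_eq:
  assumes f: "linear_on V f" "P (restrict f V)" and G: "V = fs.span G"
    and P: "\<And>h x. P h \<Longrightarrow> x \<in> G \<Longrightarrow> h x = f x"
  shows "the_linear V P = restrict f V"
proof (rule the_linear_props[where P = P, OF f])
  show "h v = h' v" if h: "linear_on V h" "linear_on V h'" "P h" "P h'" and v: "v \<in> V" for h h' v
    by (rule lin_eqI[OF G h(1,2) _ v])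
      (simp add: P[OF h(3)] P[OF h(4)])
qed (simp add: G)

section \<open>Tensor products of spaces of functions\<close>

lemma otimes_Node [simp]: "(v \<otimes> w) (Node p q) = v p * w q" "(v \<otimes> w) (Pt x) = 0" "(v \<otimes> w) (Ex b) = 0"
  by (simp_all add: otimes_def)

lemma vec_eqI:
  fixes u v :: "('h, 'b) vec"
  assumes "\<And>x. u (Pt x) = v (Pt x)" "\<And>b. u (Ex b) = v (Ex b)" "\<And>p q. u (Node p q) = v (Node p q)"
  shows "u = v"
proof
  fix i show "u i = v i" by (cases i) (use assms in auto)
qed

abbreviation pure_tensors :: "('h, 'b) vec set \<Rightarrow> ('h, 'b) vec set \<Rightarrow> ('h, 'b) vec set" where
  "pure_tensors S T \<equiv> {s \<otimes> t |s t. s \<in> S \<and> t \<in> T}"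

lemma otimes_add_left: "(u + v) \<otimes> w = u \<otimes> w + v \<otimes> w"
  and otimes_add_right: "u \<otimes> (v + w) = u \<otimes> v + u \<otimes> w"
  and otimes_scale_left: "fscale c u \<otimes> w = fscale c (u \<otimes> w)"
  and otimes_scale_right: "u \<otimes> fscale c w = fscale c (u \<otimes> w)"
  by (auto intro!: vec_eqI simp: pointwise algebra_simps)

lemmas otimes_simps = otimes_add_left otimes_add_right otimes_scale_left otimes_scale_right

lemma lin_otimes_left: "linear_on V f \<Longrightarrow> linear_on V (\<lambda>v. f v \<otimes> w)"
  and lin_otimes_right: "linear_on V f \<Longrightarrow> linear_on V (\<lambda>v. w \<otimes> f v)"
  by (auto simp: linear_on_def otimes_simps)

lemma lin_left: "linear_on V (\<lambda>v. v \<otimes> w)"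
  and lin_right: "linear_on V (\<lambda>v. w \<otimes> v)"
  by (rule lin_otimes_left lin_otimes_right, simp)+

definition bilin where
  "bilin V W b \<longleftrightarrow> (\<forall>w\<in>W. linear_on V (\<lambda>v. b v w)) \<and> (\<forall>v\<in>V. linear_on W (b v))"

lemma bilinI: "(\<And>w. w \<in> W \<Longrightarrow> linear_on V (\<lambda>v. b v w)) \<Longrightarrow> (\<And>v. v \<in> V \<Longrightarrow> linear_on W (b v)) \<Longrightarrow> bilin V W b"
  and bilin_left: "bilin V W b \<Longrightarrow> w \<in> W \<Longrightarrow> linear_on V (\<lambda>v. b v w)"
  and bilin_right: "bilin V W b \<Longrightarrow> v \<in> V \<Longrightarrow> linear_on W (b v)"
  by (auto simp: bilin_def)

lemma bilin_otimes [simp]: "bilin V W (\<otimes>)"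
  by (auto intro!: bilinI lin_otimes_left lin_otimes_right)

lemma bilin_eqI:
  assumes S: "V = fs.span S" and T: "W = fs.span T" and b: "bilin V W b" "bilin V W b'"
    and eq: "\<And>s t. s \<in> S \<Longrightarrow> t \<in> T \<Longrightarrow> b s t = b' s t" and v: "v \<in> V" and w: "w \<in> W"
  shows "b v w = b' v w"
proof (rule lin_eqI[OF S bilin_left[OF b(1) w] bilin_left[OF b(2) w] _ v])
  fix s assume s: "s \<in> S"
  then have "s \<in> V" unfolding S by (rule fs.span_base)
  then show "b s w = b' s w"
    using lin_eqI[OF T bilin_right[OF b(1)] bilin_right[OF b(2)] eq[OF s] w] by blast
qed

lemma subspace_tensor [simp]: "fs.subspace (tensor V W)"
  by (simp add: tensor_def)

lemma tensorI: "v \<in> V \<Longrightarrow> w \<in> W \<Longrightarrow> v \<otimes> w \<in> tensor V W"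
  unfolding tensor_def by (rule fs.span_base) blast

lemma bilin_span_mem:
  assumes "bilin (fs.span S) (fs.span T) b" "fs.subspace U" "\<And>s t. s \<in> S \<Longrightarrow> t \<in> T \<Longrightarrow> b s t \<in> U"
    "v \<in> fs.span S" "w \<in> fs.span T"
  shows "b v w \<in> U"
proof -
  have "b s w \<in> U" if "s \<in> S" for s
    by (rule lin_memI[OF refl bilin_right[OF assms(1) fs.span_base[OF that]] assms(2) assms(3)[OF that] assms(5)])
  then show ?thesis
    by (rule lin_memI[OF refl bilin_left[OF assms(1,5)] assms(2) _ assms(4)])
qed

lemma tensor_span: "tensor (fs.span S) (fs.span T) = fs.span (pure_tensors S T)"
proof
  show "tensor (fs.span S) (fs.span T) \<subseteq> fs.span (pure_tensors S T)"
    unfolding tensor_def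
  proof (rule fs.span_minimal)
    show "pure_tensors (fs.span S) (fs.span T) \<subseteq> fs.span (pure_tensors S T)"
      by clarify (rule bilin_span_mem[of S T "(\<otimes>)"], auto intro: fs.span_base)
  qed simp
  show "fs.span (pure_tensors S T) \<subseteq> tensor (fs.span S) (fs.span T)"
    by (rule fs.span_minimal) (auto intro: tensorI fs.span_base)
qed

lemma independent_zeroD:
  fixes B :: "('i \<Rightarrow> complex) set"
  assumes "fs.independent B" "finite B0" "B0 \<subseteq> B" "(\<Sum>b\<in>B0. fscale (u b) b) = 0" "b \<in> B0"
  shows "u b = 0"
  using fs.independentD assms by blast

text \<open>Evaluate the relation at \<open>Node p q\<close>. For fixed \<open>q\<close> and varying
  \<open>p\<close> it is a relation among the elements of \<open>B\<close>, so its coefficients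
  vanish; these, for varying \<open>q\<close>, form a relation among the elements of
  \<open>C\<close>. This is why functions on pairs of indices model the tensor product
  faithfully.\<close>

lemma otimes_sum_zeroD:
  assumes B: "fs.independent B" and C: "fs.independent C"
    and "finite B0" "B0 \<subseteq> B" "finite C0" "C0 \<subseteq> C"
    and 0: "(\<Sum>(b, c)\<in>B0 \<times> C0. fscale (a (b, c)) (b \<otimes> c)) = 0" and "b \<in> B0" "c \<in> C0"
  shows "a (b, c) = 0"
proof -
  have "(\<Sum>c\<in>C0. fscale (a (b, c)) c) = 0"
  proof
    fix q
    have "(\<Sum>b\<in>B0. fscale (\<Sum>c\<in>C0. a (b, c) * c q) b) = 0"
    proof
      fix p
      have "(\<Sum>b\<in>B0. fscale (\<Sum>c\<in>C0. a (b, c) * c q) b) p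
          = (\<Sum>(b, c)\<in>B0 \<times> C0. fscale (a (b, c)) (b \<otimes> c)) (Node p q)"
        by (simp add: pointwise sum_distrib_right sum_distrib_left sum.cartesian_product case_prod_unfold mult_ac)
      with 0 show "(\<Sum>b\<in>B0. fscale (\<Sum>c\<in>C0. a (b, c) * c q) b) p = 0 p" by (simp add: zero_fun_apply)
    qed
    from independent_zeroD[OF B assms(3,4) this \<open>b \<in> B0\<close>]
    show "(\<Sum>c\<in>C0. fscale (a (b, c)) c) q = 0 q" by (simp add: pointwise)
  qed
  from independent_zeroD[OF C assms(5,6) this \<open>c \<in> C0\<close>] show ?thesis .
qed

lemma inj_on_otimes:
  assumes B: "fs.independent B" and C: "fs.independent C"
  shows "inj_on (\<lambda>(b, c). b \<otimes> c) (B \<times> C)"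
proof (rule inj_onI, clarify)
  fix b c b' c' assume m: "b \<in> B" "c \<in> C" "b' \<in> B" "c' \<in> C" and eq: "b \<otimes> c = b' \<otimes> c'"
  \<comment> \<open>Two indicator functions are subtracted instead of splitting cases: for equal
    pairs they cancel, so \<open>a (b, c) = 0\<close> is exactly what equality of the pairs amounts
    to.\<close>
  define a :: "_ \<Rightarrow> complex" where "a = (\<lambda>z. (if z = (b, c) then 1 else 0) - (if z = (b', c') then 1 else 0))"
  have "(\<Sum>z\<in>{b, b'} \<times> {c, c'}. fscale (a z) (case z of (b, c) \<Rightarrow> b \<otimes> c))
    = (\<Sum>z\<in>{b, b'} \<times> {c, c'}. if z = (b, c) then b \<otimes> c else 0)
      - (\<Sum>z\<in>{b, b'} \<times> {c, c'}. if z = (b', c') then b' \<otimes> c' else 0)"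
    unfolding sum_subtractf[symmetric] by (rule sum.cong) (auto simp: a_def)
  also have "\<dots> = 0" using eq by simp
  finally have "(\<Sum>(b, c)\<in>{b, b'} \<times> {c, c'}. fscale (a (b, c)) (b \<otimes> c)) = 0"
    by (simp add: case_prod_unfold)
  from otimes_sum_zeroD[OF B C _ _ _ _ this, of b c] m have "a (b, c) = 0" by simp
  then show "b = b' \<and> c = c'" by (auto simp: a_def split: if_splits)
qed

lemma independent_otimes:
  assumes B: "fs.independent B" and C: "fs.independent C"
  shows "fs.independent ((\<lambda>(b, c). b \<otimes> c) ` (B \<times> C))"
  unfolding fs.independent_explicit_module
proof (intro allI impI)
  fix t u v
  assume t: "finite t" "t \<subseteq> (\<lambda>(b, c). b \<otimes> c) ` (B \<times> C)"
    and 0: "(\<Sum>v\<in>t. fscale (u v) v) = 0" and v: "v \<in> t"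
  from t obtain S where S: "finite S" "S \<subseteq> B \<times> C" "t = (\<lambda>(b, c). b \<otimes> c) ` S"
    by (meson finite_subset_image)
  define a where "a z = (if z \<in> S then u (case z of (b, c) \<Rightarrow> b \<otimes> c) else 0)" for z
  have inj: "inj_on (\<lambda>(b, c). b \<otimes> c) S"
    using inj_on_otimes[OF B C] S(2) by (rule inj_on_subset)
  have "(\<Sum>z\<in>fst ` S \<times> snd ` S. fscale (a z) (case z of (b, c) \<Rightarrow> b \<otimes> c))
      = (\<Sum>z\<in>S. fscale (u (case z of (b, c) \<Rightarrow> b \<otimes> c)) (case z of (b, c) \<Rightarrow> b \<otimes> c))"
    by (rule sum.mono_neutral_cong_right) (use S in \<open>force simp: a_def\<close>)+
  also have "\<dots> = 0"
    using 0 unfolding S(3) by (subst (asm) sum.reindex[OF inj]) simp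
  finally have 0: "(\<Sum>(b, c)\<in>fst ` S \<times> snd ` S. fscale (a (b, c)) (b \<otimes> c)) = 0"
    by (simp add: case_prod_unfold)
  from v S(3) obtain b c where bc: "(b, c) \<in> S" "v = b \<otimes> c" by auto
  have "a (b, c) = 0"
    by (rule otimes_sum_zeroD[OF B C _ _ _ _ 0]) (use S bc in force)+
  with bc show "u v = 0" by (simp add: a_def)
qed

lemma linear_extend_basis:
  fixes f :: "('i \<Rightarrow> complex) \<Rightarrow> ('j \<Rightarrow> complex)"
  assumes "fs.independent B"
  shows "\<exists>g. Vector_Spaces.linear fscale fscale g \<and> (\<forall>x\<in>B. g x = f x)"
proof -
  interpret vector_space_pair "fscale :: complex \<Rightarrow> ('i \<Rightarrow> complex) \<Rightarrow> 'i \<Rightarrow> complex"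
    "fscale :: complex \<Rightarrow> ('j \<Rightarrow> complex) \<Rightarrow> 'j \<Rightarrow> complex" ..
  show ?thesis using linear_independent_extend[OF assms] by blast
qed

lemma subspace_basis:
  fixes V :: "('i \<Rightarrow> complex) set"
  assumes "fs.subspace V" obtains B where "fs.independent B" "fs.span B = V"
proof -
  obtain B where "B \<subseteq> V" "fs.independent B" "V \<subseteq> fs.span B" by (rule fs.maximal_independent_subset)
  then show thesis using that fs.span_subspace[OF _ _ assms] by blast
qed

text \<open>Products of basis vectors are independent, so their images can be prescribed freely, and
  injectivity recovers the pair from its product.\<close>

lemma tensor_basis_ex:
  assumes B: "fs.independent B" and C: "fs.independent C"
  shows "\<exists>f. Vector_Spaces.linear fscale fscale f \<and> (\<forall>v\<in>B. \<forall>w\<in>C. f (v \<otimes> w) = b v w)"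
proof -
  let ?i = "\<lambda>(b, c). b \<otimes> c"
  define h where "h x = (case the_inv_into (B \<times> C) ?i x of (v, w) \<Rightarrow> b v w)" for x
  have h: "h (v \<otimes> w) = b v w" if "v \<in> B" "w \<in> C" for v w
    using the_inv_into_f_f[OF inj_on_otimes[OF B C], of "(v, w)"] that by (simp add: h_def)
  obtain f where f: "Vector_Spaces.linear fscale fscale f" "\<forall>x\<in>?i ` (B \<times> C). f x = h x"
    using linear_extend_basis[OF independent_otimes[OF B C], of h] by blast
  have "f (v \<otimes> w) = b v w" if "v \<in> B" "w \<in> C" for v w
  proof -
    have "v \<otimes> w \<in> ?i ` (B \<times> C)" using that by (intro image_eqI[of _ _ "(v, w)"]) simp_all
    with f(2) h[OF that] show ?thesis by metis
  qed
  with f(1) show ?thesis by blast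
qed

text \<open>The existence half of the universal property: a map with the right values on products of
  basis vectors agrees with \<open>b\<close> on all pairs, since both sides are bilinear.\<close>

lemma tensor_lift_ex:
  assumes V: "fs.subspace V" and W: "fs.subspace W" and b: "bilin V W b"
  shows "\<exists>f. linear_on (tensor V W) f \<and> (\<forall>v\<in>V. \<forall>w\<in>W. f (v \<otimes> w) = b v w)"
proof -
  obtain B where B: "fs.independent B" "fs.span B = V" using V by (rule subspace_basis)
  obtain C where C: "fs.independent C" "fs.span C = W" using W by (rule subspace_basis)
  obtain f where f: "Vector_Spaces.linear fscale fscale f" "\<forall>v\<in>B. \<forall>w\<in>C. f (v \<otimes> w) = b v w"
    using tensor_basis_ex[OF B(1) C(1), of b] by blast
  have "bilin V W (\<lambda>v w. f (v \<otimes> w))"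
    by (intro bilinI) (use f(1) in \<open>auto intro!: linear_onI simp: otimes_simps Vector_Spaces.linear_iff\<close>)
  then have "f (v \<otimes> w) = b v w" if "v \<in> V" "w \<in> W" for v w
    using bilin_eqI[OF B(2)[symmetric] C(2)[symmetric] _ b, of "\<lambda>v w. f (v \<otimes> w)" v w] f(2) that by blast
  then show ?thesis using f(1) linear_imp_linear_on by blast
qed

lemma lin_tensor_eq:
  assumes "linear_on (tensor V W) f" "linear_on (tensor V W) g"
    and "\<And>v w. v \<in> V \<Longrightarrow> w \<in> W \<Longrightarrow> f (v \<otimes> w) = g (v \<otimes> w)" "t \<in> tensor V W"
  shows "f t = g t"
  by (rule lin_eqI[OF tensor_def assms(1,2) _ assms(4)])
    (use assms(3) in blast)

lemma lin_tensor_mem: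
  assumes "linear_on (tensor V W) f" "fs.subspace U"
    and "\<And>v w. v \<in> V \<Longrightarrow> w \<in> W \<Longrightarrow> f (v \<otimes> w) \<in> U" "t \<in> tensor V W"
  shows "f t \<in> U"
  by (rule lin_memI[OF tensor_def assms(1,2) _ assms(4)])
    (use assms(3) in blast)

lemma
  assumes V: "fs.subspace V" and W: "fs.subspace W" and b: "bilin V W b"
  shows lin_tlift: "linear_on (tensor V W) (tlift V W b)"
    and extensional_tlift: "tlift V W b \<in> extensional (tensor V W)"
    and tlift_otimes: "v \<in> V \<Longrightarrow> w \<in> W \<Longrightarrow> tlift V W b (v \<otimes> w) = b v w"
proof -
  obtain f where f: "linear_on (tensor V W) f" "\<And>v w. v \<in> V \<Longrightarrow> w \<in> W \<Longrightarrow> f (v \<otimes> w) = b v w"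
    using tensor_lift_ex[OF assms] by blast
  have eq: "tlift V W b = restrict f (tensor V W)"
    unfolding tlift_def
  proof (rule the_linear_props[OF f(1)])
    show "\<forall>v\<in>V. \<forall>w\<in>W. restrict f (tensor V W) (v \<otimes> w) = b v w"
      using f(2) by (simp add: tensorI)
    show "f t = g t" if "linear_on (tensor V W) f" "linear_on (tensor V W) g"
      "\<forall>v\<in>V. \<forall>w\<in>W. f (v \<otimes> w) = b v w" "\<forall>v\<in>V. \<forall>w\<in>W. g (v \<otimes> w) = b v w" "t \<in> tensor V W" for f g t
      by (rule lin_tensor_eq[OF that(1,2) _ that(5)]) (use that in simp)
  qed simp
  show "linear_on (tensor V W) (tlift V W b)"
    unfolding eq by (rule lin_restrict[OF f(1) subspace_tensor])
  show "tlift V W b \<in> extensional (tensor V W)"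
    unfolding eq by (rule restrict_extensional)
  show "tlift V W b (v \<otimes> w) = b v w" if "v \<in> V" "w \<in> W"
    unfolding eq using f(2)[OF that] by (simp add: tensorI that)
qed

lemma bilin_otimes_map: "linear_on V f \<Longrightarrow> linear_on W g \<Longrightarrow> bilin V W (\<lambda>v w. f v \<otimes> g w)"
  by (auto intro!: bilinI lin_otimes_left lin_otimes_right)

lemma
  assumes V: "fs.subspace V" and W: "fs.subspace W" and fg: "linear_on V f" "linear_on W g"
  shows lin_tmap: "linear_on (tensor V W) (tmap V W f g)"
    and extensional_tmap: "tmap V W f g \<in> extensional (tensor V W)"
    and tmap_otimes: "v \<in> V \<Longrightarrow> w \<in> W \<Longrightarrow> tmap V W f g (v \<otimes> w) = f v \<otimes> g w"
  unfolding tmap_def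
  using lin_tlift[OF V W bilin_otimes_map[OF fg]] extensional_tlift[OF V W bilin_otimes_map[OF fg]]
    tlift_otimes[OF V W bilin_otimes_map[OF fg], of v w] by blast+

section \<open>Quotient spaces and their universal property\<close>

text \<open>A basis of \<open>R\<close> is extended inside \<open>V\<close>; the map killing the old
  basis vectors and fixing the new ones is a projection along \<open>R\<close>. Hence the choice in
  \<open>quot_map\<close> is not void.\<close>

lemma quot_map_ex:
  assumes V: "fs.subspace V" and R: "fs.subspace R" "R \<subseteq> V"
  shows "\<exists>q. linear_on V q \<and> {v \<in> V. q v = 0} = R"
proof -
  obtain B where B: "fs.independent B" "fs.span B = R" using R(1) by (rule subspace_basis)
  then have "B \<subseteq> V" using R(2) fs.span_superset by blast
  then obtain C where C: "B \<subseteq> C" "C \<subseteq> V" "fs.independent C" "V \<subseteq> fs.span C"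
    using B(1) by (rule fs.maximal_independent_subset_extend)
  obtain q where q: "Vector_Spaces.linear fscale fscale q" "\<forall>x\<in>C. q x = (if x \<in> B then 0 else x)"
    using linear_extend_basis[OF C(3), of "\<lambda>x. if x \<in> B then 0 else x"] by blast
  note q_lin = linear_imp_linear_on[OF q(1)]
  have qB: "q x = 0" if "x \<in> R" for x
    by (rule lin_eqI[of R B q "\<lambda>_. 0" x]) (use q_lin q(2) C(1) B(2) that in auto)
  have qC: "q x = x" if "x \<in> fs.span (C - B)" for x
    by (rule lin_eqI[of "fs.span (C - B)" "C - B" q "\<lambda>x. x" x]) (use q_lin q(2) that in auto)
  have "v \<in> R" if "v \<in> V" "q v = 0" for v
  proof -
    have "v \<in> fs.span (B \<union> (C - B))" using that C by (metis Un_Diff_cancel Un_absorb1 subsetD)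
    then obtain x y where "v = x + y" "x \<in> R" "y \<in> fs.span (C - B)"
      unfolding fs.span_Un using B(2) by blast
    moreover from this have "q v = q x + q y" using q(1) by (simp add: Vector_Spaces.linear_iff)
    ultimately show ?thesis using that(2) qB[of x] qC[of y] by simp
  qed
  with qB R(2) have "{v \<in> V. q v = 0} = R" by auto
  then show ?thesis using q_lin by blast
qed

lemma
  assumes "fs.subspace V" "fs.subspace R" "R \<subseteq> V"
  shows lin_quot_map: "linear_on V (quot_map V R)"
    and quot_map_eq_0_iff: "v \<in> V \<Longrightarrow> quot_map V R v = 0 \<longleftrightarrow> v \<in> R"
  using someI_ex[OF quot_map_ex[OF assms]] unfolding quot_map_def[symmetric] by auto

lemma quot_map_lift_ex:
  assumes V: "fs.subspace V" and R: "fs.subspace R" "R \<subseteq> V"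
    and g: "linear_on V g" "\<And>r. r \<in> R \<Longrightarrow> g r = 0"
  shows "\<exists>h. linear_on (quot_map V R ` V) h \<and> (\<forall>v\<in>V. h (quot_map V R v) = g v)"
proof -
  let ?q = "quot_map V R"
  note q = lin_quot_map[OF V R]
  \<comment> \<open>An arbitrary preimage is good enough: two preimages differ by an element of
    \<open>R\<close>, on which \<open>g\<close> vanishes.\<close>
  define h where "h = g \<circ> inv_into V ?q"
  have h: "h (?q v) = g v" if v: "v \<in> V" for v
  proof -
    let ?w = "inv_into V ?q (?q v)"
    have w: "?w \<in> V" "?q ?w = ?q v" by (rule inv_into_into[OF imageI[OF v]], rule f_inv_into_f[OF imageI[OF v]])
    then have "?w - v \<in> R"
      using quot_map_eq_0_iff[OF V R fs.subspace_diff[OF V w(1) v]] lin_diff[OF q V w(1) v] by simp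
    then show ?thesis using g(2) lin_diff[OF g(1) V w(1) v] by (simp add: h_def)
  qed
  have "linear_on (?q ` V) h"
  proof (rule linear_onI)
    fix a b assume "a \<in> ?q ` V" "b \<in> ?q ` V"
    then obtain u v where *: "u \<in> V" "v \<in> V" "a = ?q u" "b = ?q v" by blast
    show "h (a + b) = h a + h b"
      using h[OF fs.subspace_add[OF V *(1,2)]]
      by (simp only: lin_add[OF q *(1,2)] lin_add[OF g(1) *(1,2)] h[OF *(1)] h[OF *(2)] *(3,4))
  next
    fix c a assume "a \<in> ?q ` V"
    then obtain u where *: "u \<in> V" "a = ?q u" by blast
    show "h (fscale c a) = fscale c (h a)"
      using h[OF fs.subspace_scale[OF V *(1)]]
      by (simp only: lin_scale[OF q *(1)] lin_scale[OF g(1) *(1)] h[OF *(1)] *(2))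
  qed
  with h show ?thesis by blast
qed

section \<open>Orthonormal bases and exponentials\<close>

lemma orthonormal_finite_independent:
  fixes sc :: "complex \<Rightarrow> 'h::ab_group_add \<Rightarrow> 'h"
  assumes "vector_space sc" "symmetric_bilinear sc form"
    and on: "\<forall>u\<in>B. \<forall>v\<in>B. form u v = (if u = v then 1 else 0)"
  shows "\<not> module.dependent sc B"
proof -
  interpret vector_space sc by fact
  have lin: "form (x + y) z = form x z + form y z" "form (sc c x) z = c * form x z" for x y z c
    using assms(2) by (auto simp: symmetric_bilinear_def)
  have zero: "form 0 z = 0" for z using lin(2)[of 0 0 z] by simp
  show ?thesis
    unfolding independent_explicit_module
  proof (intro allI impI)
    fix t u v assume t: "finite t" "t \<subseteq> B" "(\<Sum>v\<in>t. sc (u v) v) = 0" "v \<in> t"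
    have sum: "form (\<Sum>x\<in>S. f x) z = (\<Sum>x\<in>S. form (f x) z)" for S z and f :: "'h \<Rightarrow> 'h"
      by (induction S rule: infinite_finite_induct) (auto simp: zero lin(1))
    have "0 = (\<Sum>x\<in>t. u x * form x v)"
      using sum[of "\<lambda>v. sc (u v) v" t v] t(3) by (simp add: zero lin)
    also have "\<dots> = (\<Sum>x\<in>t. if x = v then u v else 0)"
    proof (rule sum.cong)
      fix x assume "x \<in> t"
      with t(2,4) have "x \<in> B" "v \<in> B" by auto
      with on have "form x v = (if x = v then 1 else 0)" by blast
      then show "u x * form x v = (if x = v then u v else 0)" by simp
    qed simp
    finally show "u v = 0" using t(1,4) by simp
  qed
qed

text \<open>Take an orthonormal family of maximal size. A vector orthogonal to it with nonzero
  square could be normalised and added, so the form vanishes on the diagonal of the orthogonal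
  complement, hence on all of it, and nondegeneracy makes the complement zero. Without this the
  basis chosen in \<open>Omega\<close> would be meaningless.\<close>

lemma orthonormal_basis_exists:
  fixes sc :: "complex \<Rightarrow> 'h::ab_group_add \<Rightarrow> 'h"
  assumes vs: "vector_space sc" and fd: "\<exists>S. finite S \<and> module.span sc S = UNIV"
    and sb: "symmetric_bilinear sc form" and nd: "nondegenerate form"
  shows "\<exists>B. orthonormal_basis sc form B"
proof -
  interpret vector_space sc by fact
  have lin: "form (x + y) z = form x z + form y z" "form (sc c x) z = c * form x z" "form x z = form z x"
    for x y z c using sb by (auto simp: symmetric_bilinear_def)
  have lin': "form z (x + y) = form z x + form z y" "form z (sc c x) = c * form z x" for x y z c
    using lin(1)[of x y z] lin(2)[of c x z] lin(3)[of "x + y" z] lin(3)[of x z] lin(3)[of y z]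
      lin(3)[of "sc c x" z] by simp_all
  have zero: "form 0 z = 0" for z using lin(2)[of 0 0 z] by simp
  have sum: "form (\<Sum>x\<in>S. f x) z = (\<Sum>x\<in>S. form (f x) z)" for S z and f :: "'h \<Rightarrow> 'h"
    by (induction S rule: infinite_finite_induct) (auto simp: zero lin(1))
  have diff: "form (x - y) z = form x z - form y z" for x y z
    using lin(1)[of "x - y" y z] by simp
  define on where "on B \<longleftrightarrow> (\<forall>u\<in>B. \<forall>v\<in>B. form u v = (if u = v then 1 else 0))" for B
  obtain S where S: "finite S" "span S = UNIV" using fd by blast
  have bound: "finite B \<and> card B \<le> card S" if "on B" for B
    using independent_span_bound[OF S(1), of B] S(2) orthonormal_finite_independent[OF vs sb, of B] that
    by (simp add: on_def)
  have "\<exists>B. on B \<and> (\<forall>B'. on B' \<longrightarrow> card B' \<le> card B)"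
  proof (rule ex_has_greatest_nat[where k = "{}" and b = "Suc (card S)"])
    show "on {}" by (simp add: on_def)
    show "\<forall>B. on B \<longrightarrow> card B < Suc (card S)" using bound by (simp add: less_Suc_eq_le)
  qed
  then obtain B where B: "on B" "\<And>B'. on B' \<Longrightarrow> card B' \<le> card B" by blast
  note fin = conjunct1[OF bound[OF B(1)]]
  define pr where "pr y = y - (\<Sum>b\<in>B. sc (form y b) b)" for y
  have pr: "form (pr y) b = 0" if "b \<in> B" for y b
  proof -
    have "form (\<Sum>b\<in>B. sc (form y b) b) b = (\<Sum>x\<in>B. if x = b then form y b else 0)"
      unfolding sum by (rule sum.cong) (use B(1) that in \<open>auto simp: lin(2) on_def\<close>)
    then show ?thesis using fin that by (simp add: pr_def diff)
  qed
  define W where "W = {w. \<forall>b\<in>B. form w b = 0}"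
  have iso: "form w w = 0" if w: "w \<in> W" for w
  proof (rule ccontr)
    assume nz: "form w w \<noteq> 0"
    \<comment> \<open>The form is bilinear and not Hermitian, so dividing by a complex square root
      gives square 1 whatever the nonzero value of \<open>form w w\<close> is.\<close>
    define e where "e = sc (1 / csqrt (form w w)) w"
    have ee: "form e e = 1" using nz by (simp add: e_def lin(2) lin'(2) flip: power2_eq_square)
    have eb: "form e b = 0" if "b \<in> B" for b using w that by (simp add: e_def W_def lin(2))
    have be: "form b e = 0" if "b \<in> B" for b using eb[OF that] lin(3)[of b e] by simp
    have "e \<notin> B" using ee eb by force
    have "on (insert e B)" using B(1) ee eb be \<open>e \<notin> B\<close> unfolding on_def by auto
    from B(2)[OF this] show False using fin \<open>e \<notin> B\<close> by simp
  qed
  have "pr y = 0" for y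
  proof -
    have W: "pr x \<in> W" for x using pr by (simp add: W_def)
    \<comment> \<open>Polarisation with \<open>pr y + pr z\<close> shows that the two projections
      are orthogonal; \<open>z\<close> differs from \<open>pr z\<close> by a combination of
      \<open>B\<close>, to which \<open>pr y\<close> is orthogonal as well.\<close>
    have "form (pr y) z = 0" for z
    proof -
      have "pr y + pr z \<in> W" using W[of y] W[of z] by (simp add: W_def lin(1))
      then have "form (pr y) (pr z) = 0"
        using iso[of "pr y + pr z"] iso[OF W[of y]] iso[OF W[of z]] lin(3)[of "pr z" "pr y"]
        by (simp add: lin(1) lin')
      moreover have "form (\<Sum>b\<in>B. sc (form z b) b) (pr y) = 0"
        unfolding sum
      proof (rule sum.neutral, rule ballI)
        fix b assume "b \<in> B"
        then show "form (sc (form z b) b) (pr y) = 0"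
          unfolding lin(2) lin(3)[of b "pr y"] using pr[of b y] by simp
      qed
      moreover have "form z (pr y) = form (pr z) (pr y) + form (\<Sum>b\<in>B. sc (form z b) b) (pr y)"
        unfolding lin(1)[symmetric] by (simp add: pr_def)
      ultimately show ?thesis using lin(3)[of "pr y" z] lin(3)[of "pr y" "pr z"] by simp
    qed
    then show ?thesis using nd by (simp add: nondegenerate_def)
  qed
  then have "y \<in> span B" for y
    by (metis (no_types, lifting) eq_iff_diff_eq_0 pr_def span_base span_scale span_sum)
  then show ?thesis
    using B(1) fin orthonormal_finite_independent[OF vs sb, of B]
    by (auto simp: orthonormal_basis_def on_def intro!: exI[of _ B])
qed

text \<open>Both sides are linear in \<open>x\<close>, and for a basis vector \<open>x\<close> a
  single summand survives. Through this, \<open>Omega\<close> acts on a pair of weight vectors by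
  the pairing of their weights, whichever basis was chosen.\<close>

lemma orthonormal_basis_parseval:
  fixes sc :: "complex \<Rightarrow> 'h::ab_group_add \<Rightarrow> 'h"
  assumes vs: "vector_space sc" and sb: "symmetric_bilinear sc form" and B: "orthonormal_basis sc form B"
  shows "(\<Sum>b\<in>B. form x b * form y b) = form x y"
proof -
  interpret vector_space sc by fact
  have lin: "form (x + y) z = form x z + form y z" "form (sc c x) z = c * form x z" "form x z = form z x"
    for x y z c using sb by (auto simp: symmetric_bilinear_def)
  have zero: "form 0 z = 0" for z using lin(2)[of 0 0 z] by simp
  have on: "finite B" "\<And>u v. u \<in> B \<Longrightarrow> v \<in> B \<Longrightarrow> form u v = (if u = v then 1 else 0)" "x \<in> span B"
    using B by (auto simp: orthonormal_basis_def)
  from on(3) show ?thesis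
  proof (induction rule: span_induct_alt)
    case base
    then show ?case by (simp add: zero)
  next
    case (step c a x)
    have "(\<Sum>b\<in>B. form a b * form y b) = (\<Sum>b\<in>B. if b = a then form a y else 0)"
      by (rule sum.cong) (use on step(1) lin(3) in auto)
    then have "(\<Sum>b\<in>B. form a b * form y b) = form a y"
      using on(1) step(1) by simp
    then show ?case
      using step(2) by (simp add: lin(1,2) distrib_right sum.distrib mult.assoc flip: sum_distrib_left)
  qed
qed

section \<open>Exponentials and local finiteness of diagonalisable operators\<close>

lemma lin_funpow:
  assumes T: "linear_on V T" "\<And>v. v \<in> V \<Longrightarrow> T v \<in> V"
  shows "linear_on V (T ^^ n) \<and> (\<forall>v\<in>V. (T ^^ n) v \<in> V)"
proof (induction n)
  case (Suc n)
  have "linear_on V (\<lambda>v. T ((T ^^ n) v))"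
    by (rule lin_compose[of V "T ^^ n" V T]) (use Suc T(1) in auto)
  with Suc T(2) show ?case by (simp add: comp_def)
qed (simp add: id_def)

lemma funpow_eigen:
  assumes T: "linear_on V T" and g: "g \<in> V" "T g = fscale c g"
  shows "(T ^^ n) g = fscale (c ^ n) g"
proof (induction n)
  case (Suc n)
  have "T (fscale (c ^ n) g) = fscale (c ^ n) (T g)" by (rule lin_scale[OF T g(1)])
  with Suc g(2) show ?case by (simp add: mult.commute)
qed simp

lemma lf_exp_sums_eigen:
  assumes T: "linear_on V T" and g: "g \<in> V" "T g = fscale c g"
  shows "(\<lambda>n. (T ^^ n) g i / fact n) sums (exp c * g i)"
  using sums_mult2[OF exp_converges[of c], of "g i"]
  by (simp add: funpow_eigen[OF T g] fscale_apply scaleR_conv_of_real field_simps)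

lemma lf_exp_eigen:
  assumes T: "linear_on V T" and g: "g \<in> V" "T g = fscale c g"
  shows "lf_exp T g = fscale (exp c) g"
  using lf_exp_sums_eigen[OF T g] by (auto simp: lf_exp_def fscale_def sums_iff)

lemma eigen_span_mem:
  assumes T: "linear_on (fs.span G) T" and eig: "\<And>g. g \<in> G \<Longrightarrow> \<exists>c. T g = fscale c g"
    and v: "v \<in> fs.span G"
  shows "T v \<in> fs.span G"
proof (rule lin_memI[OF refl T fs.subspace_span _ v])
  fix g assume g: "g \<in> G"
  then obtain c where "T g = fscale c g" using eig by blast
  then show "T g \<in> fs.span G" using fs.span_scale[OF fs.span_base[OF g]] by simp
qed

text \<open>Infinite sums are additive only where they converge. The vectors with convergent series
  in every coordinate form a subspace that contains the eigenvectors, hence the whole span.\<close>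

lemma lin_lf_exp:
  assumes T: "linear_on (fs.span G) T" and eig: "\<And>g. g \<in> G \<Longrightarrow> \<exists>c. T g = fscale c g"
  shows "linear_on (fs.span G) (lf_exp T)"
proof -
  note pow = lin_funpow[OF T eigen_span_mem[OF T eig]]
  have summable: "summable (\<lambda>n. (T ^^ n) v i / fact n)" if "v \<in> fs.span G" for v i
  proof -
    have "fs.span G \<subseteq> {v \<in> fs.span G. summable (\<lambda>n. (T ^^ n) v i / fact n)}" (is "_ \<subseteq> ?S")
    proof (rule fs.span_minimal)
      show "G \<subseteq> ?S"
      proof
        fix g assume g: "g \<in> G"
        then obtain c where c: "T g = fscale c g" using eig by blast
        show "g \<in> ?S"
          using sums_summable[OF lf_exp_sums_eigen[OF T fs.span_base[OF g] c]] fs.span_base[OF g] by simp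
      qed
      show "fs.subspace ?S"
      proof (rule fs.subspaceI)
        show "0 \<in> ?S"
          using lin_zero[OF conjunct1[OF pow] fs.subspace_span] by (simp add: fs.span_zero zero_fun_apply)
      next
        fix x y assume "x \<in> ?S" "y \<in> ?S"
        then show "x + y \<in> ?S"
          using lin_add[OF conjunct1[OF pow], of x y]
          by (simp add: fs.span_add plus_fun_apply add_divide_distrib summable_add)
      next
        fix c x assume "x \<in> ?S"
        then show "fscale c x \<in> ?S"
          using lin_scale[OF conjunct1[OF pow], of x _ c] summable_mult[where f = "\<lambda>n. (T ^^ n) x i / fact n" and c = c]
          by (simp add: fs.span_scale fscale_apply)
      qed
    qed
    with that show ?thesis by blast
  qed
  show "linear_on (fs.span G) (lf_exp T)"
  proof (rule linear_onI)
    fix u v assume uv: "u \<in> fs.span G" "v \<in> fs.span G"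
    have "lf_exp T (u + v) i = lf_exp T u i + lf_exp T v i" for i
      using suminf_add[OF summable[OF uv(1), of i] summable[OF uv(2), of i]]
      by (simp add: lf_exp_def lin_add[OF conjunct1[OF pow] uv] plus_fun_apply add_divide_distrib)
    then show "lf_exp T (u + v) = lf_exp T u + lf_exp T v"
      by (simp add: fun_eq_iff plus_fun_apply)
  next
    fix c v assume v: "v \<in> fs.span G"
    have "lf_exp T (fscale c v) i = c * lf_exp T v i" for i
      using suminf_mult[OF summable[OF v, of i], of c]
      by (simp add: lf_exp_def lin_scale[OF conjunct1[OF pow] v] fscale_apply)
    then show "lf_exp T (fscale c v) = fscale c (lf_exp T v)"
      by (simp add: fun_eq_iff fscale_apply)
  qed
qed

text \<open>A vector of the span involves finitely many eigenvectors; the product of the linear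
  factors at their eigenvalues annihilates each of them. Repeated eigenvalues only raise
  multiplicities.\<close>

lemma locally_finite_eigen:
  assumes T: "linear_on (fs.span G) T" and eig: "\<And>g. g \<in> G \<Longrightarrow> \<exists>c. T g = fscale c g"
    and m: "m \<in> fs.span G"
  shows "\<exists>f :: complex poly. f \<noteq> 0 \<and> (\<Sum>n\<le>degree f. fscale (coeff f n) ((T ^^ n) m)) = 0"
proof -
  note pow = lin_funpow[OF T eigen_span_mem[OF T eig]]
  define ev where "ev g = (SOME c. T g = fscale c g)" for g
  have ev: "T g = fscale (ev g) g" if "g \<in> G" for g
    unfolding ev_def by (rule someI_ex[OF eig[OF that]])
  from m obtain F r where F: "finite F" "F \<subseteq> G" "m = (\<Sum>a\<in>F. fscale (r a) a)"
    unfolding fs.span_explicit by blast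
  define f where "f = (\<Prod>a\<in>F. [:- ev a, 1:])"
  have root: "poly f (ev a) = 0" if "a \<in> F" for a
    using F(1) that by (auto simp: f_def poly_prod prod_zero_iff)
  have "(T ^^ n) m = (\<Sum>a\<in>F. fscale (r a * ev a ^ n) a)" for n
  proof -
    have a: "fscale (r a) a \<in> fs.span G" if "a \<in> F" for a
      using F(2) that by (intro fs.span_scale fs.span_base) blast
    have "(T ^^ n) (fscale (r a) a) = fscale (r a * ev a ^ n) a" if "a \<in> F" for a
    proof -
      have aG: "a \<in> G" using F(2) that by blast
      show ?thesis
        using lin_scale[OF conjunct1[OF pow] fs.span_base[OF aG], of n "r a"]
          funpow_eigen[OF T fs.span_base[OF aG] ev[OF aG], of n] by simp
    qed
    moreover have "(T ^^ n) (\<Sum>a\<in>F. fscale (r a) a) = (\<Sum>a\<in>F. (T ^^ n) (fscale (r a) a))"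
      by (rule lin_sum[OF conjunct1[OF pow] fs.subspace_span a])
    ultimately show ?thesis using F(3) by simp
  qed
  then have "(\<Sum>n\<le>degree f. fscale (coeff f n) ((T ^^ n) m))
      = (\<Sum>n\<le>degree f. \<Sum>a\<in>F. fscale (coeff f n * (r a * ev a ^ n)) a)"
    by (simp add: fs.scale_sum_right)
  also have "\<dots> = (\<Sum>a\<in>F. fscale (r a * poly f (ev a)) a)"
    by (subst sum.swap) (simp add: poly_altdef fs.scale_sum_left sum_distrib_left mult_ac)
  also have "\<dots> = 0" using root by simp
  finally show ?thesis by (intro exI[of _ f]) (simp add: f_def F(1) prod_zero_iff)
qed

section \<open>The lattice algebra\<close>

lemma ee_apply [simp]: "ee x (Pt y) = (if y = x then 1 else 0)" "ee x (Node p q) = 0" "ee x (Ex b) = 0"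
  by (simp_all add: ee_def)

lemma inj_ee: "inj (ee :: 'h::ab_group_add \<Rightarrow> ('h, 'b) vec)"
  by (rule injI) (metis ee_apply(1) zero_neq_one)

lemma independent_ee: "fs.independent (ee ` l :: ('h::ab_group_add, 'b) vec set)"
  unfolding fs.independent_explicit_module
proof (intro allI impI)
  fix t u and v :: "('h, 'b) vec"
  assume t: "finite t" "t \<subseteq> ee ` l" and 0: "(\<Sum>v\<in>t. fscale (u v) v) = 0" and v: "v \<in> t"
  from v t obtain x where x: "v = ee x" by blast
  have "0 = (\<Sum>w\<in>t. u w * w (Pt x))" using fun_cong[OF 0, of "Pt x"] by (simp add: pointwise)
  also have "\<dots> = (\<Sum>w\<in>t. if w = v then u v else 0)"
  proof (rule sum.cong)
    fix w assume "w \<in> t"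
    with t(2) obtain y where "w = ee y" by blast
    with x show "u w * w (Pt x) = (if w = v then u v else 0)" by (auto dest: injD[OF inj_ee])
  qed simp
  finally show "u v = 0" using t(1) v by simp
qed

locale lattice_setting =
  fixes sc :: "complex \<Rightarrow> 'h::ab_group_add \<Rightarrow> 'h"
    and form :: "'h \<Rightarrow> 'h \<Rightarrow> complex"
    and l :: "'h set"
    and \<alpha> :: "'h \<Rightarrow> 'h \<Rightarrow> complex"
  assumes vs: "vector_space sc"
    and fin_dim: "\<exists>S. finite S \<and> module.span sc S = UNIV"
    and sym_bilin: "symmetric_bilinear sc form"
    and nondeg: "nondegenerate form"
    and l_subgroup: "subgroup_of l"
    and l_int: "\<And>x y. x \<in> l \<Longrightarrow> y \<in> l \<Longrightarrow> form x y \<in> \<int>"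
    and cocycle: "normalised_cocycle l \<alpha>"
    and commutator: "\<And>x y. x \<in> l \<Longrightarrow> y \<in> l \<Longrightarrow> \<alpha> x y * inverse (\<alpha> y x) = exp (pi * \<i> * form x y)"
begin

abbreviation AA :: "('h, 'b) amod" where "AA \<equiv> lattice_algebra form l \<alpha>"
abbreviation "L \<equiv> dual_lattice form l"

lemma form_add_left: "form (x + y) z = form x z + form y z"
  and form_scale_left: "form (sc c x) z = c * form x z"
  and form_sym: "form x y = form y x"
  using sym_bilin by (auto simp: symmetric_bilinear_def)

lemma form_add_right: "form z (x + y) = form z x + form z y"
  and form_scale_right: "form z (sc c x) = c * form z x"
  using form_add_left[of x y z] form_scale_left[of c x z] form_sym[of "x + y" z] form_sym[of x z]
    form_sym[of y z] form_sym[of "sc c x" z] by simp_all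

lemma form_zero [simp]: "form 0 z = 0" "form z 0 = 0"
  using form_add_left[of 0 0 z] form_add_right[of z 0 0] by simp_all

definition q :: "'h \<Rightarrow> 'h \<Rightarrow> complex" where "q x y = exp (pi * \<i> * form x y)"

lemma q_add_left: "q (x + y) z = q x z * q y z"
  and q_add_right: "q z (x + y) = q z x * q z y"
  and q_sym: "q x y = q y x"
  and q_zero [simp]: "q 0 z = 1" "q z 0 = 1"
  by (simp_all add: q_def form_add_left form_add_right distrib_left exp_add)
    (simp add: form_sym)

lemma exp_2pi_int: "n \<in> \<int> \<Longrightarrow> exp (2 * pi * \<i> * n) = 1"
proof (elim Ints_cases)
  fix k :: int assume n: "n = of_int k"
  have "exp (2 * pi * \<i> * n) = cis (2 * pi * of_int k)" by (simp add: n cis_conv_exp mult_ac)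
  then show ?thesis by simp
qed

text \<open>\<open>q x y * q x y\<close> is the scalar of the double braiding of weights
  \<open>x\<close> and \<open>y\<close>.\<close>

lemma q_sq: "form x y \<in> \<int> \<Longrightarrow> q x y * q x y = 1"
  using exp_2pi_int[of "form x y"] by (simp add: q_def mult_ac flip: exp_add)

lemma l_zero [simp]: "0 \<in> l" and l_diff: "x \<in> l \<Longrightarrow> y \<in> l \<Longrightarrow> x - y \<in> l"
  using l_subgroup by (auto simp: subgroup_of_def)

lemma l_add: "x \<in> l \<Longrightarrow> y \<in> l \<Longrightarrow> x + y \<in> l"
  using l_diff[of x "0 - y"] l_diff[of 0 y] by simp

lemma l_in_L: "x \<in> l \<Longrightarrow> x \<in> L"
  using l_int by (simp add: dual_lattice_def)

lemma L_add: "x \<in> L \<Longrightarrow> y \<in> L \<Longrightarrow> x + y \<in> L"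
  by (simp add: dual_lattice_def form_add_left)

lemma L_int: assumes "x \<in> L" "y \<in> l" shows "form x y \<in> \<int>" "form y x \<in> \<int>"
proof -
  show "form x y \<in> \<int>" using assms by (simp add: dual_lattice_def)
  then show "form y x \<in> \<int>" by (simp only: form_sym[of x y])
qed

lemma alpha_nonzero: "x \<in> l \<Longrightarrow> y \<in> l \<Longrightarrow> \<alpha> x y \<noteq> 0"
  and alpha_cocycle: "x \<in> l \<Longrightarrow> y \<in> l \<Longrightarrow> z \<in> l \<Longrightarrow> \<alpha> x y * \<alpha> (x + y) z = \<alpha> y z * \<alpha> x (y + z)"
  and alpha_zero: "x \<in> l \<Longrightarrow> \<alpha> x 0 = 1" "x \<in> l \<Longrightarrow> \<alpha> 0 x = 1"
  using cocycle by (auto simp: normalised_cocycle_def)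

text \<open>This is the commutativity of the algebra in the braided category, in the form in which
  it cancels scalars.\<close>

lemma alpha_swap: "x \<in> l \<Longrightarrow> y \<in> l \<Longrightarrow> \<alpha> x y = q x y * \<alpha> y x"
  using commutator[of x y] alpha_nonzero[of y x] by (simp add: q_def field_simps)

text \<open>Literally the choice term inside \<open>Omega\<close>, named so that sums over it can be
  rewritten.\<close>

definition casimir_basis :: "'h set" where "casimir_basis = (SOME B. orthonormal_basis sc form B)"

lemma casimir_basis_sum: "(\<Sum>u\<in>casimir_basis. form x u * form y u) = form x y"
  unfolding casimir_basis_def
  by (rule orthonormal_basis_parseval[OF vs sym_bilin someI_ex[OF orthonormal_basis_exists[OF vs fin_dim sym_bilin nondeg]]])

lemma carr_AA: "carr AA = fs.span (ee ` l)"
  by (simp add: lattice_algebra_def Let_def)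

lemma subspace_AA [simp]: "fs.subspace (carr AA)"
  by (simp add: carr_AA)

lemma ee_in_AA: "x \<in> l \<Longrightarrow> ee x \<in> carr AA"
  by (simp add: carr_AA fs.span_base)

lemma
  shows lin_act_AA: "linear_on (carr (AA :: ('h, 'b) amod)) (act AA z)"
    and act_AA: "x \<in> l \<Longrightarrow> act (AA :: ('h, 'b) amod) z (ee x) = fscale (form x z) (ee x)"
proof -
  \<comment> \<open>An explicit solution of the description defining \<open>act\<close>: a
    coordinatewise multiplication, which is linear on all functions.\<close>
  define f :: "('h, 'b) vec \<Rightarrow> ('h, 'b) vec" where "f a = (\<lambda>i. case i of Pt x \<Rightarrow> form x z * a (Pt x) | _ \<Rightarrow> 0)" for a
  have f: "linear_on (carr (AA :: ('h, 'b) amod)) f"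
    by (intro linear_onI) (auto simp: f_def fun_eq_iff pointwise algebra_simps split: idx.split)
  have fe: "f (ee x) = fscale (form x z) (ee x)" for x
    by (rule vec_eqI) (simp_all add: f_def fscale_apply)
  have "act AA z = the_linear (carr AA) (\<lambda>f. \<forall>x\<in>l. f (ee x) = fscale (form x z) (ee x))"
    by (simp add: lattice_algebra_def Let_def)
  also have "\<dots> = restrict f (carr AA)"
    by (rule the_linear_eq[OF f _ carr_AA]) (auto simp: fe ee_in_AA)
  finally have "act AA z = restrict f (carr AA)" .
  then show "linear_on (carr AA) (act (AA :: ('h, 'b) amod) z)"
    "x \<in> l \<Longrightarrow> act (AA :: ('h, 'b) amod) z (ee x) = fscale (form x z) (ee x)"
    using lin_restrict[OF f subspace_AA] by (simp_all add: fe ee_in_AA)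
qed

lemma
  shows lin_nu_AA: "linear_on (tensor (carr (AA :: ('h, 'b) amod)) (carr AA)) (nu AA)"
    and nu_AA: "x \<in> l \<Longrightarrow> y \<in> l \<Longrightarrow> nu (AA :: ('h, 'b) amod) (ee x \<otimes> ee y) = fscale (\<alpha> x y) (ee (x + y))"
proof -
  let ?A = "carr AA :: ('h, 'b) vec set"
  let ?i = "inv (ee :: 'h \<Rightarrow> ('h, 'b) vec)"
  \<comment> \<open>The products \<open>ee x \<otimes> ee y\<close> are independent, so a map with
    these values exists; \<open>?i\<close> reads the lattice point off a basis vector.\<close>
  obtain f :: "('h, 'b) vec \<Rightarrow> ('h, 'b) vec" where f: "Vector_Spaces.linear fscale fscale f"
    "\<forall>v\<in>ee ` l. \<forall>w\<in>ee ` l. f (v \<otimes> w) = fscale (\<alpha> (?i v) (?i w)) (ee (?i v + ?i w))"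
    using tensor_basis_ex[OF independent_ee[of l] independent_ee[of l],
        of "\<lambda>v w. fscale (\<alpha> (?i v) (?i w)) (ee (?i v + ?i w))"] by blast
  have fe: "f (ee x \<otimes> ee y) = fscale (\<alpha> x y) (ee (x + y))" if "x \<in> l" "y \<in> l" for x y
    using f(2) that by (simp add: inv_f_f[OF inj_ee])
  note f_lin = linear_imp_linear_on[OF f(1), of "tensor ?A ?A"]
  have T: "tensor ?A ?A = fs.span (pure_tensors (ee ` l) (ee ` l))"
    unfolding carr_AA by (rule tensor_span)
  have "nu AA = the_linear (tensor ?A ?A) (\<lambda>f. \<forall>x\<in>l. \<forall>y\<in>l. f (ee x \<otimes> ee y) = fscale (\<alpha> x y) (ee (x + y)))"
    by (simp add: lattice_algebra_def Let_def)
  also have "\<dots> = restrict f (tensor ?A ?A)"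
    by (rule the_linear_eq[OF f_lin _ T]) (auto simp: fe ee_in_AA tensorI)
  finally have "nu AA = restrict f (tensor ?A ?A)" .
  then show "linear_on (tensor ?A ?A) (nu (AA :: ('h, 'b) amod))"
    "x \<in> l \<Longrightarrow> y \<in> l \<Longrightarrow> nu (AA :: ('h, 'b) amod) (ee x \<otimes> ee y) = fscale (\<alpha> x y) (ee (x + y))"
    using lin_restrict[OF f_lin subspace_tensor] by (simp_all add: fe ee_in_AA tensorI)
qed

end

section \<open>Exchanging and regrouping tensor factors\<close>

lemma lin_flip: "linear_on V flip"
  by (intro linear_onI) (auto simp: flip_def fun_eq_iff pointwise split: idx.split)

lemma lin_reassoc: "linear_on V reassoc"
  by (intro linear_onI) (auto simp: reassoc_def fun_eq_iff pointwise split: idx.split)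

definition unreassoc :: "('h, 'b) vec \<Rightarrow> ('h, 'b) vec" where
  "unreassoc t = (\<lambda>i. case i of Node (Node p q) r \<Rightarrow> t (Node p (Node q r)) | _ \<Rightarrow> 0)"

lemma unreassoc_otimes: "unreassoc (u \<otimes> (v \<otimes> w)) = (u \<otimes> v) \<otimes> w"
  by (auto simp: unreassoc_def otimes_def fun_eq_iff split: idx.splits)

lemma lin_unreassoc: "linear_on V unreassoc"
  by (intro linear_onI) (auto simp: unreassoc_def fun_eq_iff pointwise split: idx.split)

lemma unreassoc_mem:
  assumes t: "t \<in> tensor U (tensor V W)" shows "unreassoc t \<in> tensor (tensor U V) W"
proof (rule lin_tensor_mem[OF lin_unreassoc subspace_tensor _ t])
  fix u s assume u: "u \<in> U" and s: "s \<in> tensor V W"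
  show "unreassoc (u \<otimes> s) \<in> tensor (tensor U V) W"
    by (rule lin_tensor_mem[OF lin_compose[OF lin_right lin_unreassoc UNIV_I]
          subspace_tensor _ s])
      (simp add: unreassoc_otimes tensorI u)
qed

lemma reassoc_mem:
  assumes t: "t \<in> tensor (tensor U V) W" shows "reassoc t \<in> tensor U (tensor V W)"
proof (rule lin_tensor_mem[OF lin_reassoc subspace_tensor _ t])
  fix s w assume w: "w \<in> W" and s: "s \<in> tensor U V"
  show "reassoc (s \<otimes> w) \<in> tensor U (tensor V W)"
    by (rule lin_tensor_mem[OF lin_compose[OF lin_left lin_reassoc UNIV_I]
          subspace_tensor _ s])
      (simp add: reassoc_otimes tensorI w)
qed

lemma flip_mem: "t \<in> tensor V W \<Longrightarrow> flip t \<in> tensor W V"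
  by (rule lin_tensor_mem[OF lin_flip subspace_tensor]) (simp_all add: flip_otimes tensorI)

context lattice_setting
begin

subsection \<open>Weight modules\<close>

text \<open>Weights for the whole of h, given by pairing with \<open>\<mu>\<close>;
  \<open>weight_space\<close> sees only their restrictions to the lattice.\<close>

definition wspace :: "('h, 'b) amod \<Rightarrow> 'h \<Rightarrow> ('h, 'b) vec set" where
  "wspace M \<mu> = {m \<in> carr M. \<forall>z. act M z m = fscale (form \<mu> z) m}"

text \<open>Weights are confined to \<open>L\<close> because an integral pairing with the lattice is
  what makes a module local.\<close>

definition wvecs :: "('h, 'b) amod \<Rightarrow> ('h, 'b) vec set" where
  "wvecs M = (\<Union>\<mu>\<in>L. wspace M \<mu>)"

definition weighted :: "('h, 'b) amod \<Rightarrow> bool" where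
  "weighted M \<longleftrightarrow> carr M = fs.span (wvecs M) \<and> (\<forall>z. linear_on (carr M) (act M z))"

lemma wspace_carr: "m \<in> wspace M \<mu> \<Longrightarrow> m \<in> carr M"
  and wspace_act: "m \<in> wspace M \<mu> \<Longrightarrow> act M z m = fscale (form \<mu> z) m"
  by (simp_all add: wspace_def)

lemma weighted_carr: "weighted M \<Longrightarrow> carr M = fs.span (wvecs M)"
  and weighted_act: "weighted M \<Longrightarrow> linear_on (carr M) (act M z)"
  unfolding weighted_def by blast+

lemma weighted_subspace: "weighted M \<Longrightarrow> fs.subspace (carr M)"
  by (metis fs.subspace_span weighted_carr)

lemma wspace_scale:
  assumes "weighted M" "m \<in> wspace M \<mu>" shows "fscale c m \<in> wspace M \<mu>"
  using assms(2) fs.subspace_scale[OF weighted_subspace[OF assms(1)]]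
  by (auto simp: wspace_def lin_scale[OF weighted_act[OF assms(1)]] mult.commute)

lemma weighted_eq:
  assumes M: "weighted M" and fg: "linear_on (carr M) f" "linear_on (carr M) g"
    and eq: "\<And>\<mu> m. \<mu> \<in> L \<Longrightarrow> m \<in> wspace M \<mu> \<Longrightarrow> f m = g m" and m: "m \<in> carr M"
  shows "f m = g m"
  by (rule lin_eqI[OF weighted_carr[OF M] fg _ m]) (auto simp: wvecs_def eq)

lemma weighted_mem:
  assumes M: "weighted M" and f: "linear_on (carr M) f" "fs.subspace U"
    and eq: "\<And>\<mu> m. \<mu> \<in> L \<Longrightarrow> m \<in> wspace M \<mu> \<Longrightarrow> f m \<in> U" and m: "m \<in> carr M"
  shows "f m \<in> U"
  by (rule lin_memI[OF weighted_carr[OF M] f _ m]) (auto simp: wvecs_def eq)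

lemma weighted_tensor_span:
  assumes "weighted M" "weighted N"
  shows "tensor (carr M) (carr N) = fs.span (pure_tensors (wvecs M) (wvecs N))"
  unfolding weighted_carr[OF assms(1)] weighted_carr[OF assms(2)] by (rule tensor_span)

lemma weighted_tensor_mem:
  assumes M: "weighted M" and N: "weighted N" and f: "linear_on (tensor (carr M) (carr N)) f" "fs.subspace U"
    and eq: "\<And>\<mu> m \<nu> n. \<mu> \<in> L \<Longrightarrow> m \<in> wspace M \<mu> \<Longrightarrow> \<nu> \<in> L \<Longrightarrow> n \<in> wspace N \<nu> \<Longrightarrow> f (m \<otimes> n) \<in> U"
    and t: "t \<in> tensor (carr M) (carr N)"
  shows "f t \<in> U"
  by (rule lin_memI[OF weighted_tensor_span[OF M N] f _ t]) (auto simp: wvecs_def eq)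

lemma weightedI:
  assumes span: "carr M = fs.span G" and act: "\<And>z. linear_on (carr M) (act M z)" and G: "G \<subseteq> wvecs M"
  shows "weighted M"
proof -
  have "fs.span (wvecs M) \<subseteq> carr M"
    by (rule fs.span_minimal) (auto simp: wvecs_def wspace_def span)
  then have "carr M = fs.span (wvecs M)" using fs.span_mono[OF G] span by blast
  with act show ?thesis unfolding weighted_def by blast
qed

lemma ee_wspace: "x \<in> l \<Longrightarrow> ee x \<in> wspace AA x"
  by (simp add: wspace_def ee_in_AA act_AA)

lemma weighted_AA: "weighted (AA :: ('h, 'b) amod)"
  by (rule weightedI[OF carr_AA lin_act_AA]) (use ee_wspace l_in_L in \<open>auto simp: wvecs_def\<close>)

lemma tensor_AA_span:
  fixes M :: "('h, 'b) amod"
  assumes M: "weighted M"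
  shows "tensor (carr AA) (carr M) = fs.span (pure_tensors (ee ` l) (wvecs M))"
  unfolding weighted_carr[OF M] carr_AA by (rule tensor_span)

lemma tensor_AA_eq:
  fixes M :: "('h, 'b) amod"
  assumes M: "weighted M"
    and fg: "linear_on (tensor (carr AA) (carr M)) f" "linear_on (tensor (carr AA) (carr M)) g"
    and eq: "\<And>x \<mu> m. x \<in> l \<Longrightarrow> \<mu> \<in> L \<Longrightarrow> m \<in> wspace M \<mu> \<Longrightarrow> f (ee x \<otimes> m) = g (ee x \<otimes> m)"
    and t: "t \<in> tensor (carr AA) (carr M)"
  shows "f t = g t"
  by (rule lin_eqI[OF tensor_AA_span[OF M] fg _ t]) (auto simp: wvecs_def eq)

lemma tensor_AA_mem:
  fixes M :: "('h, 'b) amod"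
  assumes M: "weighted M" and f: "linear_on (tensor (carr AA) (carr M)) f" "fs.subspace U"
    and eq: "\<And>x \<mu> m. x \<in> l \<Longrightarrow> \<mu> \<in> L \<Longrightarrow> m \<in> wspace M \<mu> \<Longrightarrow> f (ee x \<otimes> m) \<in> U"
    and t: "t \<in> tensor (carr AA) (carr M)"
  shows "f t \<in> U"
  by (rule lin_memI[OF tensor_AA_span[OF M] f _ t]) (auto simp: wvecs_def eq)

lemma AA_eq:
  assumes fg: "linear_on (carr AA) f" "linear_on (carr AA) g"
    and eq: "\<And>x. x \<in> l \<Longrightarrow> f (ee x) = g (ee x)" and a: "a \<in> carr AA"
  shows "f a = g a"
  by (rule lin_eqI[OF carr_AA fg _ a]) (auto simp: eq)

lemma
  assumes M: "weighted M" and N: "weighted N"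
  shows lin_tensor_act: "linear_on (tensor (carr M) (carr N)) (tensor_act M N z)"
    and tensor_act_otimes: "m \<in> carr M \<Longrightarrow> n \<in> carr N \<Longrightarrow>
      tensor_act M N z (m \<otimes> n) = act M z m \<otimes> n + m \<otimes> act N z n"
proof -
  have b: "bilin (carr M) (carr N) (\<lambda>m n. act M z m \<otimes> n + m \<otimes> act N z n)"
    by (intro bilinI lin_plus lin_otimes_left lin_otimes_right weighted_act M N lin_id)
  note * = weighted_subspace[OF M] weighted_subspace[OF N] b
  show "linear_on (tensor (carr M) (carr N)) (tensor_act M N z)"
    unfolding tensor_act_def by (rule lin_tlift[OF *])
  show "m \<in> carr M \<Longrightarrow> n \<in> carr N \<Longrightarrow> tensor_act M N z (m \<otimes> n) = act M z m \<otimes> n + m \<otimes> act N z n"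
    unfolding tensor_act_def by (rule tlift_otimes[OF *])
qed

lemma tensor_act_wspace:
  assumes M: "weighted M" and N: "weighted N" and m: "m \<in> wspace M \<mu>" and n: "n \<in> wspace N \<nu>"
  shows "tensor_act M N z (m \<otimes> n) = fscale (form (\<mu> + \<nu>) z) (m \<otimes> n)"
  using tensor_act_otimes[OF M N wspace_carr[OF m] wspace_carr[OF n]]
  by (simp add: wspace_act[OF m] wspace_act[OF n] otimes_simps form_add_left fs.scale_left_distrib)

lemma
  assumes M: "weighted M" and N: "weighted N"
  shows lin_Omega: "linear_on (tensor (carr M) (carr N)) (Omega sc form M N)"
    and Omega_wspace: "m \<in> wspace M \<mu> \<Longrightarrow> n \<in> wspace N \<nu> \<Longrightarrow>
      Omega sc form M N (m \<otimes> n) = fscale (form \<mu> \<nu>) (m \<otimes> n)"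
proof -
  note * = weighted_subspace[OF M] weighted_subspace[OF N] weighted_act[OF M] weighted_act[OF N]
  have O: "Omega sc form M N = (\<lambda>t. \<Sum>u\<in>casimir_basis. tmap (carr M) (carr N) (act M u) (act N u) t)"
    by (simp add: Omega_def casimir_basis_def fun_eq_iff)
  show "linear_on (tensor (carr M) (carr N)) (Omega sc form M N)"
    unfolding O by (rule lin_setsum, rule lin_tmap[OF *])
  show "Omega sc form M N (m \<otimes> n) = fscale (form \<mu> \<nu>) (m \<otimes> n)" if mn: "m \<in> wspace M \<mu>" "n \<in> wspace N \<nu>"
  proof -
    have "tmap (carr M) (carr N) (act M u) (act N u) (m \<otimes> n) = fscale (form \<mu> u * form \<nu> u) (m \<otimes> n)" for u
      using tmap_otimes[OF * wspace_carr[OF mn(1)] wspace_carr[OF mn(2)], of u u]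
      by (simp add: wspace_act[OF mn(1)] wspace_act[OF mn(2)] otimes_simps mult.commute)
    then show ?thesis
      by (simp add: O casimir_basis_sum flip: fs.scale_sum_left)
  qed
qed

lemma
  assumes M: "weighted M" and N: "weighted N"
  shows lin_exp_Omega: "linear_on (tensor (carr M) (carr N)) (exp_Omega sc form c M N)"
    and exp_Omega_wspace: "m \<in> wspace M \<mu> \<Longrightarrow> n \<in> wspace N \<nu> \<Longrightarrow>
      exp_Omega sc form c M N (m \<otimes> n) = fscale (exp (c * form \<mu> \<nu>)) (m \<otimes> n)"
proof -
  note T = lin_fscale[OF lin_Omega[OF M N], of c]
  have eig: "fscale c (Omega sc form M N (m \<otimes> n)) = fscale (c * form \<mu> \<nu>) (m \<otimes> n)"
    if "m \<in> wspace M \<mu>" "n \<in> wspace N \<nu>" for m n \<mu> \<nu>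
    by (simp add: Omega_wspace[OF M N that])
  show "linear_on (tensor (carr M) (carr N)) (exp_Omega sc form c M N)"
    unfolding exp_Omega_def weighted_tensor_span[OF M N]
  proof (rule lin_lf_exp[OF T[unfolded weighted_tensor_span[OF M N]]])
    fix g assume "g \<in> pure_tensors (wvecs M) (wvecs N)"
    then obtain m n \<mu> \<nu> where mn: "m \<in> wspace M \<mu>" "n \<in> wspace N \<nu>" "g = m \<otimes> n"
      unfolding wvecs_def by blast
    show "\<exists>d. fscale c (Omega sc form M N g) = fscale d g"
      unfolding mn(3) eig[OF mn(1,2)] by blast
  qed
  show "exp_Omega sc form c M N (m \<otimes> n) = fscale (exp (c * form \<mu> \<nu>)) (m \<otimes> n)"
    if "m \<in> wspace M \<mu>" "n \<in> wspace N \<nu>"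
    unfolding exp_Omega_def
    by (rule lf_exp_eigen[OF T tensorI[OF wspace_carr[OF that(1)] wspace_carr[OF that(2)]] eig[OF that]])
qed

lemma
  assumes M: "weighted M" and N: "weighted N"
  shows lin_braiding: "linear_on (tensor (carr M) (carr N)) (braiding sc form M N)"
    and braiding_wspace: "m \<in> wspace M \<mu> \<Longrightarrow> n \<in> wspace N \<nu> \<Longrightarrow>
      braiding sc form M N (m \<otimes> n) = fscale (q \<mu> \<nu>) (n \<otimes> m)"
    and braiding_mem: "t \<in> tensor (carr M) (carr N) \<Longrightarrow> braiding sc form M N t \<in> tensor (carr N) (carr M)"
proof -
  have B: "braiding sc form M N = (\<lambda>t. exp_Omega sc form (pi * \<i>) N M (flip t))"
    by (simp add: braiding_def fun_eq_iff)
  show lin: "linear_on (tensor (carr M) (carr N)) (braiding sc form M N)"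
    unfolding B by (rule lin_compose[OF lin_flip lin_exp_Omega[OF N M] flip_mem])
  show wt: "braiding sc form M N (m \<otimes> n) = fscale (q \<mu> \<nu>) (n \<otimes> m)"
    if "m \<in> wspace M \<mu>" "n \<in> wspace N \<nu>" for m n \<mu> \<nu>
    using exp_Omega_wspace[OF N M that(2,1), of "pi * \<i>"]
    by (simp add: B flip_otimes q_def form_sym[of \<nu> \<mu>])
  show "braiding sc form M N t \<in> tensor (carr N) (carr M)" if "t \<in> tensor (carr M) (carr N)"
    by (rule weighted_tensor_mem[OF M N lin subspace_tensor _ that])
      (simp add: wt fs.subspace_scale tensorI wspace_carr)
qed

section \<open>Weight modules with an action of the lattice algebra\<close>

abbreviation lact :: "('h, 'b) amod \<Rightarrow> 'h \<Rightarrow> ('h, 'b) vec \<Rightarrow> ('h, 'b) vec" where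
  "lact M x m \<equiv> nu M (ee x \<otimes> m)"

text \<open>
  This class of modules contains \<open>A\<close> and all free modules and is closed under \<open>\<otimes>\<^sub>A\<close>, so the structure
  maps have to be understood only here.
\<close>

definition wmod :: "('h, 'b) amod \<Rightarrow> bool" where
  "wmod M \<longleftrightarrow> weighted M \<and> linear_on (tensor (carr AA) (carr M)) (nu M) \<and>
     (\<forall>x\<in>l. \<forall>\<mu>\<in>L. \<forall>m\<in>wspace M \<mu>. lact M x m \<in> wspace M (x + \<mu>)) \<and>
     (\<forall>x\<in>l. \<forall>y\<in>l. \<forall>m\<in>carr M. lact M x (lact M y m) = fscale (\<alpha> x y) (lact M (x + y) m)) \<and>
     (\<forall>m\<in>carr M. lact M 0 m = m)"

lemma
  assumes "wmod M"
  shows wmod_wt: "weighted M"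
    and wmod_nu: "linear_on (tensor (carr AA) (carr M)) (nu M)"
    and lact_wspace: "x \<in> l \<Longrightarrow> \<mu> \<in> L \<Longrightarrow> m \<in> wspace M \<mu> \<Longrightarrow> lact M x m \<in> wspace M (x + \<mu>)"
    and lact_lact: "x \<in> l \<Longrightarrow> y \<in> l \<Longrightarrow> m \<in> carr M \<Longrightarrow> lact M x (lact M y m) = fscale (\<alpha> x y) (lact M (x + y) m)"
    and lact_zero: "m \<in> carr M \<Longrightarrow> lact M 0 m = m"
  using assms by (simp_all add: wmod_def)

lemma lin_nu_right:
  assumes "wmod M" "a \<in> carr AA" "linear_on V f" "\<And>v. v \<in> V \<Longrightarrow> f v \<in> carr M"
  shows "linear_on V (\<lambda>v. nu M (a \<otimes> f v))"
  by (rule lin_compose[OF lin_otimes_right[OF assms(3)] wmod_nu[OF assms(1)]])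
    (rule tensorI[OF assms(2,4)])

lemma lin_nu_left:
  assumes "wmod M" "m \<in> carr M" "linear_on V f" "\<And>v. v \<in> V \<Longrightarrow> f v \<in> carr AA"
  shows "linear_on V (\<lambda>v. nu M (f v \<otimes> m))"
  by (rule lin_compose[OF lin_otimes_left[OF assms(3)] wmod_nu[OF assms(1)]])
    (rule tensorI[OF assms(4,2)])

lemma nu_mem:
  assumes M: "wmod M" and t: "t \<in> tensor (carr AA) (carr M)" shows "nu M t \<in> carr M"
  by (rule tensor_AA_mem[OF wmod_wt[OF M] wmod_nu[OF M] weighted_subspace[OF wmod_wt[OF M]] _ t])
    (rule wspace_carr[OF lact_wspace[OF M]])

lemma lact_mem: "wmod M \<Longrightarrow> x \<in> l \<Longrightarrow> m \<in> carr M \<Longrightarrow> lact M x m \<in> carr M"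
  by (simp add: nu_mem tensorI ee_in_AA)

text \<open>A vector of weight \<open>\<mu>\<close> is not known to be a combination of generators
  of that same weight, so the weight shift does not extend from generators directly. The commutation
  rule \<open>equiv\<close> between \<open>act\<close> and \<open>lact\<close> is linear in the
  vector, does extend, and gives the shift back.\<close>

lemma wmodI:
  fixes M :: "('h, 'b) amod"
  assumes span: "carr M = fs.span G" and act: "\<And>z. linear_on (carr M) (act M z)"
    and nu: "linear_on (tensor (carr AA) (carr M)) (nu M)"
    and wt: "\<And>g. g \<in> G \<Longrightarrow> \<exists>\<mu>\<in>L. g \<in> wspace M \<mu> \<and> (\<forall>x\<in>l. lact M x g \<in> wspace M (x + \<mu>))"
    and assoc: "\<And>g x y. g \<in> G \<Longrightarrow> x \<in> l \<Longrightarrow> y \<in> l \<Longrightarrow> lact M x (lact M y g) = fscale (\<alpha> x y) (lact M (x + y) g)"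
    and unit: "\<And>g. g \<in> G \<Longrightarrow> lact M 0 g = g"
  shows "wmod M"
proof -
  have "G \<subseteq> wvecs M" using wt unfolding wvecs_def by blast
  then have M: "weighted M" by (rule weightedI[OF span act])
  have lin: "linear_on (carr M) (\<lambda>m. lact M x m)" if "x \<in> l" for x
    by (rule lin_compose[OF lin_right nu])
      (rule tensorI[OF ee_in_AA[OF that]])
  have mem: "lact M x m \<in> carr M" if x: "x \<in> l" and m: "m \<in> carr M" for x m
    by (rule lin_memI[OF span lin[OF x] weighted_subspace[OF M] _ m])
      (use wt x wspace_carr in blast)
  have actm: "act M z m \<in> carr M" if m: "m \<in> carr M" for z m
    by (rule weighted_mem[OF M act weighted_subspace[OF M] _ m])
      (simp add: wspace_act fs.subspace_scale weighted_subspace[OF M] wspace_carr)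
  have equiv: "act M z (lact M x m) = fscale (form x z) (lact M x m) + lact M x (act M z m)"
    if x: "x \<in> l" and m: "m \<in> carr M" for x z m
  proof (rule lin_eqI[OF span _ _ _ m])
    show "linear_on (carr M) (\<lambda>m. act M z (lact M x m))"
      by (rule lin_compose[OF lin[OF x] act mem[OF x]])
    show "linear_on (carr M) (\<lambda>m. fscale (form x z) (lact M x m) + lact M x (act M z m))"
      by (intro lin_plus lin_fscale lin x, rule lin_compose[OF act lin[OF x] actm])
    fix g assume "g \<in> G"
    then obtain \<mu> where g: "g \<in> wspace M \<mu>" "lact M x g \<in> wspace M (x + \<mu>)" using wt x by blast
    show "act M z (lact M x g) = fscale (form x z) (lact M x g) + lact M x (act M z g)"
      unfolding wspace_act[OF g(1)] wspace_act[OF g(2)] lin_scale[OF lin[OF x] wspace_carr[OF g(1)]]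
        form_add_left fs.scale_left_distrib ..
  qed
  have "lact M x m \<in> wspace M (x + \<mu>)" if x: "x \<in> l" and m: "m \<in> wspace M \<mu>" for x \<mu> m
    using equiv[OF x wspace_carr[OF m]] mem[OF x wspace_carr[OF m]]
    by (simp add: wspace_def wspace_act[OF m] lin_scale[OF lin[OF x] wspace_carr[OF m]] form_add_left
        fs.scale_left_distrib)
  moreover have "lact M x (lact M y m) = fscale (\<alpha> x y) (lact M (x + y) m)"
    if x: "x \<in> l" and y: "y \<in> l" and m: "m \<in> carr M" for x y m
    by (rule lin_eqI[OF span lin_compose[OF lin[OF y] lin[OF x] mem[OF y]]
          lin_fscale[OF lin[OF l_add[OF x y]]] assoc[OF _ x y] m])
  moreover have "lact M 0 m = m" if m: "m \<in> carr M" for m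
    by (rule lin_eqI[OF span lin[OF l_zero] lin_id(2) unit m])
  ultimately show ?thesis
    using M nu by (simp add: wmod_def)
qed

lemma wmod_AA: "wmod (AA :: ('h, 'b) amod)"
proof (rule wmodI[OF carr_AA lin_act_AA lin_nu_AA])
  fix g :: "('h, 'b) vec" assume "g \<in> ee ` l"
  then obtain z where z: "z \<in> l" "g = ee z" by blast
  have "lact AA x (ee z) \<in> wspace AA (x + z)" if "x \<in> l" for x
    unfolding nu_AA[OF that z(1)] by (rule wspace_scale[OF weighted_AA ee_wspace[OF l_add[OF that z(1)]]])
  then show "\<exists>\<mu>\<in>L. g \<in> wspace AA \<mu> \<and> (\<forall>x\<in>l. lact AA x g \<in> wspace AA (x + \<mu>))"
    using z l_in_L ee_wspace by blast
  have lin: "linear_on (carr AA) (\<lambda>m. lact (AA :: ('h, 'b) amod) x m)" if "x \<in> l" for x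
    by (rule lin_compose[OF lin_right lin_nu_AA])
      (rule tensorI[OF ee_in_AA[OF that]])
  show "lact AA x (lact AA y g) = fscale (\<alpha> x y) (lact AA (x + y) g)" if x: "x \<in> l" and y: "y \<in> l" for x y
    using alpha_cocycle[OF x y z(1)]
    by (simp add: nu_AA x y z l_add lin_scale[OF lin[OF x] ee_in_AA] add.assoc)
  show "lact AA 0 g = g" by (simp add: z nu_AA alpha_zero)
qed

lemma
  assumes M: "wmod M"
  shows lin_ract: "linear_on (tensor (carr M) (carr AA)) (right_act sc form l \<alpha> M)"
    and ract_wspace: "m \<in> wspace M \<mu> \<Longrightarrow> x \<in> l \<Longrightarrow>
      right_act sc form l \<alpha> M (m \<otimes> ee x) = fscale (q \<mu> x) (lact M x m)"
    and ract_mem: "t \<in> tensor (carr M) (carr AA) \<Longrightarrow> right_act sc form l \<alpha> M t \<in> carr M"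
proof -
  note B = lin_braiding[OF wmod_wt[OF M] weighted_AA] braiding_mem[OF wmod_wt[OF M] weighted_AA]
  have R: "right_act sc form l \<alpha> M = (\<lambda>t. nu M (braiding sc form M AA t))"
    by (simp add: right_act_def fun_eq_iff)
  show "linear_on (tensor (carr M) (carr AA)) (right_act sc form l \<alpha> M)"
    unfolding R by (rule lin_compose[OF B(1) wmod_nu[OF M] B(2)])
  show "right_act sc form l \<alpha> M (m \<otimes> ee x) = fscale (q \<mu> x) (lact M x m)"
    if m: "m \<in> wspace M \<mu>" and x: "x \<in> l"
    unfolding R braiding_wspace[OF wmod_wt[OF M] weighted_AA m ee_wspace[OF x]]
    by (rule lin_scale[OF wmod_nu[OF M] tensorI[OF ee_in_AA[OF x] wspace_carr[OF m]]])
  show "right_act sc form l \<alpha> M t \<in> carr M" if "t \<in> tensor (carr M) (carr AA)"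
    unfolding R by (rule nu_mem[OF M B(2)[OF that]])
qed


section \<open>Weight modules are local modules\<close>

lemma weighted_act_mem:
  assumes M: "weighted M" and m: "m \<in> carr M" shows "act M z m \<in> carr M"
  by (rule weighted_mem[OF M weighted_act[OF M] weighted_subspace[OF M] _ m])
    (simp add: wspace_act fs.subspace_scale weighted_subspace[OF M] wspace_carr)

text \<open>Each axiom is an identity of linear maps that holds on weight vectors, where the action
  is by scalars linear in the element of h; local finiteness comes from diagonalisability.\<close>

lemma weighted_lf_module:
  assumes M: "weighted M" shows "lf_module sc M"
  unfolding lf_module_def
proof (intro conjI allI ballI)
  show "fs.subspace (carr M)" by (rule weighted_subspace[OF M])
  show "linear_on (carr M) (act M x)" for x by (rule weighted_act[OF M])
  show "act M x ` carr M \<subseteq> carr M" for x using weighted_act_mem[OF M] by blast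
  fix m assume m: "m \<in> carr M"
  show "act M (x + y) m = act M x m + act M y m" for x y
    by (rule weighted_eq[OF M weighted_act[OF M] lin_plus[OF weighted_act[OF M] weighted_act[OF M]] _ m])
      (simp add: wspace_act form_add_right fs.scale_left_distrib)
  show "act M (sc c x) m = fscale c (act M x m)" for c x
    by (rule weighted_eq[OF M weighted_act[OF M] lin_fscale[OF weighted_act[OF M]] _ m])
      (simp add: wspace_act form_scale_right)
  show "act M x (act M y m) = act M y (act M x m)" for x y
  proof (rule weighted_eq[OF M _ _ _ m])
    show "linear_on (carr M) (\<lambda>m. act M x (act M y m))" for x y
      by (rule lin_compose[OF weighted_act[OF M] weighted_act[OF M] weighted_act_mem[OF M]])
    then show "linear_on (carr M) (\<lambda>m. act M y (act M x m))" .
    fix \<mu> m assume m: "m \<in> wspace M \<mu>"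
    note lin = lin_scale[OF weighted_act[OF M] wspace_carr[OF m]]
    show "act M x (act M y m) = act M y (act M x m)"
      by (simp add: wspace_act[OF m] lin mult.commute)
  qed
  show "\<exists>f :: complex poly. f \<noteq> 0 \<and> (\<Sum>n\<le>degree f. fscale (coeff f n) ((act M x ^^ n) m)) = 0" for x
  proof (rule locally_finite_eigen[OF weighted_act[OF M, unfolded weighted_carr[OF M]] _ m[unfolded weighted_carr[OF M]]])
    fix g assume "g \<in> wvecs M"
    then obtain \<mu> where "g \<in> wspace M \<mu>" by (auto simp: wvecs_def)
    then show "\<exists>c. act M x g = fscale c g" using wspace_act by blast
  qed
qed

text \<open>On \<open>ee x \<otimes> m\<close> with \<open>m\<close> of weight \<open>\<mu>\<close>
  the operator in the locality condition is exp(2 pi i (x, \<mu>)), which is 1 because weights lie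
  in \<open>L\<close>. The module axioms are likewise checked on basis vectors and extended
  linearly.\<close>

lemma wmod_local_obj:
  fixes M :: "('h, 'b) amod"
  assumes M: "wmod M" shows "M \<in> local_obj sc form l \<alpha>"
proof -
  note W = wmod_wt[OF M]
  have equiv: "nu M (tensor_act AA M z t) = act M z (nu M t)" if t: "t \<in> tensor (carr AA) (carr M)" for z t
  proof (rule tensor_AA_eq[OF W _ _ _ t])
    have mem: "tensor_act AA M z t \<in> tensor (carr AA) (carr M)" if "t \<in> tensor (carr AA) (carr M)" for t
      by (rule tensor_AA_mem[OF W lin_tensor_act[OF weighted_AA W] subspace_tensor _ that])
        (simp add: tensor_act_wspace[OF weighted_AA W ee_wspace] fs.subspace_scale tensorI ee_in_AA wspace_carr)
    show "linear_on (tensor (carr AA) (carr M)) (\<lambda>t. nu M (tensor_act AA M z t))"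
      by (rule lin_compose[OF lin_tensor_act[OF weighted_AA W] wmod_nu[OF M] mem])
    show "linear_on (tensor (carr AA) (carr M)) (\<lambda>t. act M z (nu M t))"
      by (rule lin_compose[OF wmod_nu[OF M] weighted_act[OF W] nu_mem[OF M]])
    fix x \<mu> m assume *: "x \<in> l" "\<mu> \<in> L" "m \<in> wspace M \<mu>"
    show "nu M (tensor_act AA M z (ee x \<otimes> m)) = act M z (nu M (ee x \<otimes> m))"
      unfolding tensor_act_wspace[OF weighted_AA W ee_wspace[OF *(1)] *(3)] wspace_act[OF lact_wspace[OF M *]]
      by (rule lin_scale[OF wmod_nu[OF M] tensorI[OF ee_in_AA[OF *(1)] wspace_carr[OF *(3)]]])
  qed
  have nuA: "nu AA (a \<otimes> b) \<in> carr AA" if "a \<in> carr AA" "b \<in> carr AA" for a b :: "('h, 'b) vec"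
    by (rule nu_mem[OF wmod_AA tensorI[OF that]])
  have nuM: "nu M (a \<otimes> m) \<in> carr M" if "a \<in> carr AA" "m \<in> carr M" for a m
    by (rule nu_mem[OF M tensorI[OF that]])
  have assoc: "nu M (nu AA (a \<otimes> b) \<otimes> m) = nu M (a \<otimes> nu M (b \<otimes> m))"
    if a: "a \<in> carr AA" and b: "b \<in> carr AA" and m: "m \<in> carr M" for a b m
  proof (rule AA_eq[OF _ _ _ a])
    show "linear_on (carr AA) (\<lambda>a. nu M (nu AA (a \<otimes> b) \<otimes> m))"
      by (rule lin_nu_left[OF M m lin_nu_left[OF wmod_AA b lin_id(2)]]) (simp_all add: nuA b)
    show "linear_on (carr AA) (\<lambda>a. nu M (a \<otimes> nu M (b \<otimes> m)))"
      by (rule lin_nu_left[OF M nuM[OF b m] lin_id(2)])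
    fix x assume x: "x \<in> l"
    show "nu M (nu AA (ee x \<otimes> b) \<otimes> m) = nu M (ee x \<otimes> nu M (b \<otimes> m))"
    proof (rule AA_eq[OF _ _ _ b])
      show "linear_on (carr AA) (\<lambda>b. nu M (nu AA (ee x \<otimes> b) \<otimes> m))"
        by (rule lin_nu_left[OF M m lin_nu_right[OF wmod_AA ee_in_AA[OF x] lin_id(2)]])
          (simp_all add: nuA ee_in_AA x)
      show "linear_on (carr AA) (\<lambda>b. nu M (ee x \<otimes> nu M (b \<otimes> m)))"
        by (rule lin_nu_right[OF M ee_in_AA[OF x] lin_nu_left[OF M m lin_id(2)]])
          (simp_all add: nuM m)
      fix y assume y: "y \<in> l"
      show "nu M (nu AA (ee x \<otimes> ee y) \<otimes> m) = nu M (ee x \<otimes> nu M (ee y \<otimes> m))"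
        unfolding lact_lact[OF M x y m] nu_AA[OF x y] otimes_scale_left
        by (rule lin_scale[OF wmod_nu[OF M] tensorI[OF ee_in_AA[OF l_add[OF x y]] m]])
    qed
  qed
  have local: "nu M (exp_Omega sc form (2 * pi * \<i>) AA M t) = nu M t" if t: "t \<in> tensor (carr AA) (carr M)" for t
  proof (rule tensor_AA_eq[OF W _ wmod_nu[OF M] _ t])
    have mem: "exp_Omega sc form (2 * pi * \<i>) AA M t \<in> tensor (carr AA) (carr M)"
      if "t \<in> tensor (carr AA) (carr M)" for t
      by (rule tensor_AA_mem[OF W lin_exp_Omega[OF weighted_AA W] subspace_tensor _ that])
        (simp add: exp_Omega_wspace[OF weighted_AA W ee_wspace] fs.subspace_scale tensorI ee_in_AA wspace_carr)
    show "linear_on (tensor (carr AA) (carr M)) (\<lambda>t. nu M (exp_Omega sc form (2 * pi * \<i>) AA M t))"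
      by (rule lin_compose[OF lin_exp_Omega[OF weighted_AA W] wmod_nu[OF M] mem])
    fix x \<mu> m assume *: "x \<in> l" "\<mu> \<in> L" "m \<in> wspace M \<mu>"
    show "nu M (exp_Omega sc form (2 * pi * \<i>) AA M (ee x \<otimes> m)) = nu M (ee x \<otimes> m)"
      using exp_Omega_wspace[OF weighted_AA W ee_wspace[OF *(1)] *(3), of "2 * pi * \<i>"]
        exp_2pi_int[OF L_int(2)[OF *(2,1)]] by simp
  qed
  have "nu M ` tensor (carr AA) (carr M) \<subseteq> carr M"
    using nu_mem[OF M] by blast
  then have "alg_module sc form l \<alpha> M"
    unfolding alg_module_def Let_def
    using weighted_lf_module[OF W] wmod_nu[OF M] equiv assoc lact_zero[OF M] by blast
  then show ?thesis
    unfolding local_obj_def using local tensorI by blast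
qed

abbreviation "ract \<equiv> right_act sc form l \<alpha>"
abbreviation "rel \<equiv> relations sc form l \<alpha>"
abbreviation "proj \<equiv> projA sc form l \<alpha>"
abbreviation "TS \<equiv> tensorA_space sc form l \<alpha>"
abbreviation "TM \<equiv> tensorA sc form l \<alpha>"

subsection \<open>Tensor products over the algebra\<close>

text \<open>Writing the relations as the image of one linear map is what shows them to be a
  subspace.\<close>

definition rel_map :: "('h, 'b) amod \<Rightarrow> ('h, 'b) amod \<Rightarrow> ('h, 'b) vec \<Rightarrow> ('h, 'b) vec" where
  "rel_map M N t = tmap (tensor (carr M) (carr AA)) (carr N) (ract M) id t
     - tmap (carr M) (tensor (carr AA) (carr N)) id (nu N) (reassoc t)"

lemma rel_image: "rel M N = rel_map M N ` tensor (tensor (carr M) (carr AA)) (carr N)"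
  by (auto simp: relations_def rel_map_def Let_def)

lemma
  assumes M: "wmod M" and N: "wmod N"
  shows lin_rel_map: "linear_on (tensor (tensor (carr M) (carr AA)) (carr N)) (rel_map M N)"
    and rel_map_otimes: "m \<in> carr M \<Longrightarrow> a \<in> carr AA \<Longrightarrow> n \<in> carr N \<Longrightarrow>
      rel_map M N ((m \<otimes> a) \<otimes> n) = ract M (m \<otimes> a) \<otimes> n - m \<otimes> nu N (a \<otimes> n)"
proof -
  note S = weighted_subspace[OF wmod_wt[OF M]] weighted_subspace[OF wmod_wt[OF N]]
  note 1 = subspace_tensor[of "carr M" "carr AA"] S(2) lin_ract[OF M] lin_id(1)[of "carr N"]
  note 2 = S(1) subspace_tensor[of "carr AA" "carr N"] lin_id(1)[of "carr M"] wmod_nu[OF N]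
  show "linear_on (tensor (tensor (carr M) (carr AA)) (carr N)) (rel_map M N)"
    unfolding rel_map_def
    by (rule lin_minus[OF lin_tmap[OF 1] lin_compose[OF lin_reassoc lin_tmap[OF 2] reassoc_mem]])
  show "rel_map M N ((m \<otimes> a) \<otimes> n) = ract M (m \<otimes> a) \<otimes> n - m \<otimes> nu N (a \<otimes> n)"
    if *: "m \<in> carr M" "a \<in> carr AA" "n \<in> carr N"
    unfolding rel_map_def reassoc_otimes
      tmap_otimes[OF 1 tensorI[OF *(1,2)] *(3)] tmap_otimes[OF 2 *(1) tensorI[OF *(2,3)]]
    by simp
qed

lemma
  assumes M: "wmod M" and N: "wmod N"
  shows subspace_rel: "fs.subspace (rel M N)"
    and rel_subset: "rel M N \<subseteq> tensor (carr M) (carr N)"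
    and rel_base: "m \<in> wspace M \<mu> \<Longrightarrow> x \<in> l \<Longrightarrow> n \<in> carr N \<Longrightarrow>
      fscale (q \<mu> x) (lact M x m \<otimes> n) - m \<otimes> lact N x n \<in> rel M N"
proof -
  show "fs.subspace (rel M N)"
    unfolding rel_image by (rule subspace_linear_image[OF lin_rel_map[OF M N] subspace_tensor])
  show "rel M N \<subseteq> tensor (carr M) (carr N)"
    unfolding rel_image
  proof (rule image_subsetI)
    fix t assume t: "t \<in> tensor (tensor (carr M) (carr AA)) (carr N)"
    show "rel_map M N t \<in> tensor (carr M) (carr N)"
    proof (rule lin_tensor_mem[OF lin_rel_map[OF M N] subspace_tensor _ t])
      fix u n assume u: "u \<in> tensor (carr M) (carr AA)" and n: "n \<in> carr N"
      have lin: "linear_on (tensor (carr M) (carr AA)) (\<lambda>u. rel_map M N (u \<otimes> n))"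
        by (rule lin_compose[OF lin_left lin_rel_map[OF M N]])
          (rule tensorI[OF _ n])
      show "rel_map M N (u \<otimes> n) \<in> tensor (carr M) (carr N)"
        by (rule lin_tensor_mem[OF lin subspace_tensor _ u])
          (simp add: rel_map_otimes[OF M N] n fs.subspace_diff tensorI ract_mem[OF M] nu_mem[OF N])
    qed
  qed
  show "fscale (q \<mu> x) (lact M x m \<otimes> n) - m \<otimes> lact N x n \<in> rel M N"
    if m: "m \<in> wspace M \<mu>" and x: "x \<in> l" and n: "n \<in> carr N"
    unfolding rel_image
    by (rule image_eqI[where x = "(m \<otimes> ee x) \<otimes> n"])
      (simp_all add: rel_map_otimes[OF M N wspace_carr[OF m] ee_in_AA[OF x] n] ract_wspace[OF M m x]
        otimes_scale_left tensorI wspace_carr[OF m] ee_in_AA[OF x] n)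
qed

text \<open>
  The condition that \<open>g\<close> factors through the tensor product over \<open>A\<close>: on vectors of weight \<open>\<mu>\<close> the
  right action of \<open>e\<^sub>x\<close> is \<open>q \<mu> x\<close> times the left action.
\<close>

definition balanced ::
  "('h, 'b) amod \<Rightarrow> ('h, 'b) amod \<Rightarrow> (('h, 'b) vec \<Rightarrow> ('h, 'b) vec) \<Rightarrow> bool" where
  "balanced M N g \<longleftrightarrow> (\<forall>\<mu>\<in>L. \<forall>m\<in>wspace M \<mu>. \<forall>x\<in>l. \<forall>\<nu>\<in>L. \<forall>n\<in>wspace N \<nu>.
     fscale (q \<mu> x) (g (lact M x m \<otimes> n)) = g (m \<otimes> lact N x n))"

lemma balancedI:
  assumes "\<And>\<mu> m x \<nu> n. \<mu> \<in> L \<Longrightarrow> m \<in> wspace M \<mu> \<Longrightarrow> x \<in> l \<Longrightarrow> \<nu> \<in> L \<Longrightarrow> n \<in> wspace N \<nu> \<Longrightarrow>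
      fscale (q \<mu> x) (g (lact M x m \<otimes> n)) = g (m \<otimes> lact N x n)"
  shows "balanced M N g"
  unfolding balanced_def using assms by blast

text \<open>The relations are spanned by those coming from
  \<open>(m \<otimes> ee x) \<otimes> n\<close> with weight vectors \<open>m\<close> and
  \<open>n\<close>; there the right action is a multiple of the left one, and the condition
  \<open>balanced\<close> is all that is needed.\<close>

lemma rel_zero:
  assumes M: "wmod M" and N: "wmod N" and g: "linear_on (tensor (carr M) (carr N)) g"
    and bal: "balanced M N g"
    and r: "r \<in> rel M N"
  shows "g r = 0"
proof -
  note R = lin_rel_map[OF M N]
  have mem: "rel_map M N t \<in> tensor (carr M) (carr N)" if "t \<in> tensor (tensor (carr M) (carr AA)) (carr N)" for t
    using rel_subset[OF M N] that unfolding rel_image by blast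
  have T: "tensor (tensor (carr M) (carr AA)) (carr N)
      = fs.span (pure_tensors (pure_tensors (wvecs M) (ee ` l)) (wvecs N))"
    unfolding weighted_carr[OF wmod_wt[OF M]] weighted_carr[OF wmod_wt[OF N]] carr_AA tensor_span ..
  have z: "g (rel_map M N t) = 0" if t: "t \<in> tensor (tensor (carr M) (carr AA)) (carr N)" for t
  proof (rule lin_eqI[OF T lin_compose[OF R g mem] lin_const0 _ t])
    fix s assume "s \<in> pure_tensors (pure_tensors (wvecs M) (ee ` l)) (wvecs N)"
    then obtain m x n \<mu> \<nu> where *: "\<mu> \<in> L" "m \<in> wspace M \<mu>" "x \<in> l" "\<nu> \<in> L" "n \<in> wspace N \<nu>" "s = (m \<otimes> ee x) \<otimes> n"
      unfolding wvecs_def by blast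
    have s: "rel_map M N s = fscale (q \<mu> x) (lact M x m \<otimes> n) - m \<otimes> lact N x n"
      unfolding *(6) rel_map_otimes[OF M N wspace_carr[OF *(2)] ee_in_AA[OF *(3)] wspace_carr[OF *(5)]]
        ract_wspace[OF M *(2,3)] otimes_scale_left ..
    have a: "lact M x m \<otimes> n \<in> tensor (carr M) (carr N)"
      by (rule tensorI[OF lact_mem[OF M *(3) wspace_carr[OF *(2)]] wspace_carr[OF *(5)]])
    have b: "m \<otimes> lact N x n \<in> tensor (carr M) (carr N)"
      by (rule tensorI[OF wspace_carr[OF *(2)] lact_mem[OF N *(3) wspace_carr[OF *(5)]]])
    show "g (rel_map M N s) = 0"
      unfolding s lin_diff[OF g subspace_tensor fs.subspace_scale[OF subspace_tensor a] b]
        lin_scale[OF g a] using bal *(1-5) unfolding balanced_def by simp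
  qed
  from r z show ?thesis unfolding rel_image by blast
qed

lemma
  assumes M: "wmod M" and N: "wmod N"
  shows lin_proj: "linear_on (tensor (carr M) (carr N)) (proj M N)"
    and proj_eq_0: "t \<in> tensor (carr M) (carr N) \<Longrightarrow> proj M N t = 0 \<longleftrightarrow> t \<in> rel M N"
    and subspace_TS: "fs.subspace (TS M N)"
  unfolding projA_def tensorA_space_def
  by (rule lin_quot_map[OF subspace_tensor subspace_rel[OF M N] rel_subset[OF M N]]
      quot_map_eq_0_iff[OF subspace_tensor subspace_rel[OF M N] rel_subset[OF M N]]
      subspace_linear_image[OF lin_quot_map[OF subspace_tensor subspace_rel[OF M N] rel_subset[OF M N]] subspace_tensor], assumption?)+

lemma proj_mem: "t \<in> tensor (carr M) (carr N) \<Longrightarrow> proj M N t \<in> TS M N"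
  unfolding tensorA_space_def by (rule imageI)

lemma proj_memI: "m \<in> carr M \<Longrightarrow> n \<in> carr N \<Longrightarrow> proj M N (m \<otimes> n) \<in> TS M N"
  by (rule proj_mem[OF tensorI])

text \<open>The rule for carrying \<open>ee x\<close> across the tensor product: it becomes a right
  action on \<open>m\<close>, and the braiding past \<open>m\<close> costs
  \<open>q \<mu> x\<close>.\<close>

lemma proj_balanced:
  assumes M: "wmod M" and N: "wmod N" and m: "m \<in> wspace M \<mu>" and x: "x \<in> l" and n: "n \<in> carr N"
  shows "proj M N (m \<otimes> lact N x n) = fscale (q \<mu> x) (proj M N (lact M x m \<otimes> n))"
proof -
  have a: "lact M x m \<otimes> n \<in> tensor (carr M) (carr N)"
    by (rule tensorI[OF lact_mem[OF M x wspace_carr[OF m]] n])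
  have b: "m \<otimes> lact N x n \<in> tensor (carr M) (carr N)"
    by (rule tensorI[OF wspace_carr[OF m] lact_mem[OF N x n]])
  note a' = fs.subspace_scale[OF subspace_tensor a]
  have "proj M N (fscale (q \<mu> x) (lact M x m \<otimes> n) - m \<otimes> lact N x n) = 0"
    using proj_eq_0[OF M N fs.subspace_diff[OF subspace_tensor a' b]] rel_base[OF M N m x n] by blast
  then show ?thesis
    unfolding lin_diff[OF lin_proj[OF M N] subspace_tensor a' b] lin_scale[OF lin_proj[OF M N] a]
    by simp
qed

lemma TS_span_gen:
  assumes M: "wmod M" and N: "wmod N" and G: "carr M = fs.span G" and K: "carr N = fs.span K"
  shows "TS M N = fs.span (proj M N ` pure_tensors G K)"
  unfolding tensorA_space_def G K tensor_span
  by (rule lin_image_span[OF lin_proj[OF M N, unfolded G K tensor_span]])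

lemma TS_span:
  assumes M: "wmod M" and N: "wmod N"
  shows "TS M N = fs.span (proj M N ` pure_tensors (wvecs M) (wvecs N))"
  by (rule TS_span_gen[OF M N weighted_carr[OF wmod_wt[OF M]] weighted_carr[OF wmod_wt[OF N]]])

lemma TS_eq:
  assumes M: "wmod M" and N: "wmod N" and fg: "linear_on (TS M N) f" "linear_on (TS M N) g"
    and eq: "\<And>\<mu> m \<nu> n. \<mu> \<in> L \<Longrightarrow> m \<in> wspace M \<mu> \<Longrightarrow> \<nu> \<in> L \<Longrightarrow> n \<in> wspace N \<nu> \<Longrightarrow>
      f (proj M N (m \<otimes> n)) = g (proj M N (m \<otimes> n))"
    and t: "t \<in> TS M N"
  shows "f t = g t"
  by (rule lin_eqI[OF TS_span[OF M N] fg _ t]) (auto simp: wvecs_def eq)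

lemma TS_mem:
  assumes M: "wmod M" and N: "wmod N" and f: "linear_on (TS M N) f" "fs.subspace U"
    and eq: "\<And>\<mu> m \<nu> n. \<mu> \<in> L \<Longrightarrow> m \<in> wspace M \<mu> \<Longrightarrow> \<nu> \<in> L \<Longrightarrow> n \<in> wspace N \<nu> \<Longrightarrow>
      f (proj M N (m \<otimes> n)) \<in> U"
    and t: "t \<in> TS M N"
  shows "f t \<in> U"
  by (rule lin_memI[OF TS_span[OF M N] f _ t]) (auto simp: wvecs_def eq)

lemma proj_lift:
  assumes M: "wmod M" and N: "wmod N" and g: "linear_on (tensor (carr M) (carr N)) g"
    and bal: "balanced M N g"
  shows "\<exists>h. linear_on (TS M N) h \<and> (\<forall>t\<in>tensor (carr M) (carr N). h (proj M N t) = g t)"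
  unfolding tensorA_space_def projA_def
  by (rule quot_map_lift_ex[OF subspace_tensor subspace_rel[OF M N] rel_subset[OF M N] g rel_zero[OF M N g bal]])

text \<open>The map induced by \<open>g\<close> on the tensor product over the algebra. Its shape
  copies the descriptions of the h-action, the unitors and the braiding, so that these unfold to
  instances of it.\<close>

definition desc :: "('h, 'b) amod \<Rightarrow> ('h, 'b) amod \<Rightarrow> (('h, 'b) vec \<Rightarrow> ('h, 'b) vec) \<Rightarrow> ('h, 'b) vec \<Rightarrow> ('h, 'b) vec" where
  "desc M N g = the_linear (TS M N) (\<lambda>h. \<forall>t\<in>tensor (carr M) (carr N). h (proj M N t) = g t)"

lemma
  assumes M: "wmod M" and N: "wmod N" and g: "linear_on (tensor (carr M) (carr N)) g" and bal: "balanced M N g"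
  shows lin_desc: "linear_on (TS M N) (desc M N g)"
    and desc_ext: "desc M N g \<in> extensional (TS M N)"
    and desc_proj: "t \<in> tensor (carr M) (carr N) \<Longrightarrow> desc M N g (proj M N t) = g t"
proof -
  let ?P = "\<lambda>h. \<forall>t\<in>tensor (carr M) (carr N). h (proj M N t) = g t"
  from proj_lift[OF M N g bal] obtain h where h: "linear_on (TS M N) h" "?P h" by blast
  have E: "desc M N g = restrict h (TS M N)"
    unfolding desc_def
  proof (rule the_linear_eq[where P = ?P, OF h(1) _ TS_span[OF M N]])
    show "?P (restrict h (TS M N))" by (simp add: h(2) proj_mem)
    fix k s assume k: "?P k" and "s \<in> proj M N ` pure_tensors (wvecs M) (wvecs N)"
    then obtain m n where *: "m \<in> carr M" "n \<in> carr N" "s = proj M N (m \<otimes> n)"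
      unfolding wvecs_def using wspace_carr by blast
    then show "k s = h s" using k h(2) tensorI[OF *(1,2)] by simp
  qed
  show "linear_on (TS M N) (desc M N g)"
    unfolding E by (rule lin_restrict[OF h(1) subspace_TS[OF M N]])
  show "desc M N g \<in> extensional (TS M N)" unfolding E by (rule restrict_extensional)
  show "desc M N g (proj M N t) = g t" if "t \<in> tensor (carr M) (carr N)"
    unfolding E using h(2) that by (simp add: proj_mem)
qed

text \<open>The scalar \<open>q \<mu> x\<close> depends on the weight of \<open>m\<close>, so the
  balancing condition is not an identity of bilinear maps. Expressed through \<open>ract\<close> it
  becomes one, and can then be checked on arbitrary spanning sets of weight vectors.\<close>

lemma balancedI_span:
  assumes M: "wmod M" and N: "wmod N" and g: "linear_on (tensor (carr M) (carr N)) g"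
    and G: "carr M = fs.span G" and K: "carr N = fs.span K"
    and eq: "\<And>x m n. x \<in> l \<Longrightarrow> m \<in> G \<Longrightarrow> n \<in> K \<Longrightarrow>
      \<exists>\<mu>. m \<in> wspace M \<mu> \<and> fscale (q \<mu> x) (g (lact M x m \<otimes> n)) = g (m \<otimes> lact N x n)"
  shows "balanced M N g"
proof (rule balancedI)
  fix \<mu> m x \<nu> n assume m: "m \<in> wspace M \<mu>" and x: "x \<in> l" and n: "n \<in> wspace N \<nu>"
  have step: "g (ract M (m \<otimes> ee x) \<otimes> n) = fscale (q \<mu> x) (g (lact M x m \<otimes> n))"
    if m: "m \<in> wspace M \<mu>" and n: "n \<in> carr N" for m n \<mu>
    unfolding ract_wspace[OF M m x] otimes_scale_left
    by (rule lin_scale[OF g tensorI[OF lact_mem[OF M x wspace_carr[OF m]] n]])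
  have lact_lin: "linear_on (carr N) (\<lambda>n. lact N x n)"
    by (rule lin_nu_right[OF N ee_in_AA[OF x] lin_id(2)])
  have ract_lin: "linear_on (carr M) (\<lambda>m. ract M (m \<otimes> ee x))"
    by (rule lin_compose[OF lin_left lin_ract[OF M]])
      (rule tensorI[OF _ ee_in_AA[OF x]])
  have ract_mem: "ract M (m \<otimes> ee x) \<in> carr M" if "m \<in> carr M" for m
    by (rule ract_mem[OF M tensorI[OF that ee_in_AA[OF x]]])
  have b1: "bilin (carr M) (carr N) (\<lambda>m n. g (ract M (m \<otimes> ee x) \<otimes> n))"
  proof (rule bilinI)
    show "linear_on (carr M) (\<lambda>m. g (ract M (m \<otimes> ee x) \<otimes> n))" if "n \<in> carr N" for n
      by (rule lin_compose[OF lin_otimes_left[OF ract_lin] g tensorI[OF ract_mem that]])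
    show "linear_on (carr N) (\<lambda>n. g (ract M (m \<otimes> ee x) \<otimes> n))" if "m \<in> carr M" for m
      by (rule lin_compose[OF lin_right g tensorI[OF ract_mem[OF that]]])
  qed
  have b2: "bilin (carr M) (carr N) (\<lambda>m n. g (m \<otimes> lact N x n))"
  proof (rule bilinI)
    show "linear_on (carr M) (\<lambda>m. g (m \<otimes> lact N x n))" if "n \<in> carr N" for n
      by (rule lin_compose[OF lin_left g tensorI[OF _ lact_mem[OF N x that]]])
    show "linear_on (carr N) (\<lambda>n. g (m \<otimes> lact N x n))" if "m \<in> carr M" for m
      by (rule lin_compose[OF lin_otimes_right[OF lact_lin] g tensorI[OF that lact_mem[OF N x]]])
  qed
  have "g (ract M (m \<otimes> ee x) \<otimes> n) = g (m \<otimes> lact N x n)"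
  proof (rule bilin_eqI[OF G K b1 b2 _ wspace_carr[OF m] wspace_carr[OF n]])
    fix m n assume *: "m \<in> G" "n \<in> K"
    then obtain \<mu> where "m \<in> wspace M \<mu>" "fscale (q \<mu> x) (g (lact M x m \<otimes> n)) = g (m \<otimes> lact N x n)"
      using eq[OF x *] by blast
    moreover have "n \<in> carr N" using * by (simp add: K fs.span_base)
    ultimately show "g (ract M (m \<otimes> ee x) \<otimes> n) = g (m \<otimes> lact N x n)" using step by simp
  qed
  with step[OF m wspace_carr[OF n]] show "fscale (q \<mu> x) (g (lact M x m \<otimes> n)) = g (m \<otimes> lact N x n)" by simp
qed

text \<open>Descends a family of bilinear maps depending linearly on a parameter. For each
  \<open>p\<close> the relations give a map on the quotient; linearity in \<open>p\<close> is not
  part of that choice but follows because the maps are determined on generators. The parameter is an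
  algebra element for the action on a tensor product, and the third factor for the
  associator.\<close>

lemma TS_bilift:
  assumes M: "wmod M" and N: "wmod N" and V: "fs.subspace V"
    and b: "\<And>p. p \<in> V \<Longrightarrow> bilin (carr M) (carr N) (b p)"
    and lin: "\<And>m n. m \<in> carr M \<Longrightarrow> n \<in> carr N \<Longrightarrow> linear_on V (\<lambda>p. b p m n)"
    and bal: "\<And>p \<mu> m x \<nu> n. p \<in> V \<Longrightarrow> \<mu> \<in> L \<Longrightarrow> m \<in> wspace M \<mu> \<Longrightarrow> x \<in> l \<Longrightarrow> \<nu> \<in> L \<Longrightarrow> n \<in> wspace N \<nu> \<Longrightarrow>
      fscale (q \<mu> x) (b p (lact M x m) n) = b p m (lact N x n)"
  shows "\<exists>h. bilin V (TS M N) h \<and> (\<forall>p\<in>V. \<forall>m\<in>carr M. \<forall>n\<in>carr N. h p (proj M N (m \<otimes> n)) = b p m n)"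
proof -
  note S = weighted_subspace[OF wmod_wt[OF M]] weighted_subspace[OF wmod_wt[OF N]]
  have "\<forall>p\<in>V. \<exists>h. linear_on (TS M N) h \<and> (\<forall>m\<in>carr M. \<forall>n\<in>carr N. h (proj M N (m \<otimes> n)) = b p m n)"
  proof
    fix p assume p: "p \<in> V"
    let ?g = "tlift (carr M) (carr N) (b p)"
    note g = lin_tlift[OF S b[OF p]] tlift_otimes[OF S b[OF p]]
    have "balanced M N ?g"
    proof (rule balancedI)
      fix \<mu> m x \<nu> n assume *: "\<mu> \<in> L" "m \<in> wspace M \<mu>" "x \<in> l" "\<nu> \<in> L" "n \<in> wspace N \<nu>"
      show "fscale (q \<mu> x) (?g (lact M x m \<otimes> n)) = ?g (m \<otimes> lact N x n)"
        unfolding g(2)[OF lact_mem[OF M *(3) wspace_carr[OF *(2)]] wspace_carr[OF *(5)]]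
          g(2)[OF wspace_carr[OF *(2)] lact_mem[OF N *(3) wspace_carr[OF *(5)]]]
        by (rule bal[OF p *])
    qed
    from proj_lift[OF M N g(1) this] obtain h where h: "linear_on (TS M N) h"
      "\<forall>t\<in>tensor (carr M) (carr N). h (proj M N t) = ?g t" by blast
    have "h (proj M N (m \<otimes> n)) = b p m n" if "m \<in> carr M" "n \<in> carr N" for m n
      using h(2) tensorI[OF that] g(2)[OF that] by simp
    with h(1) show "\<exists>h. linear_on (TS M N) h \<and> (\<forall>m\<in>carr M. \<forall>n\<in>carr N. h (proj M N (m \<otimes> n)) = b p m n)"
      by blast
  qed
  from bchoice[OF this] obtain h where h: "\<And>p. p \<in> V \<Longrightarrow> linear_on (TS M N) (h p)"
    "\<And>p m n. p \<in> V \<Longrightarrow> m \<in> carr M \<Longrightarrow> n \<in> carr N \<Longrightarrow> h p (proj M N (m \<otimes> n)) = b p m n" by blast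
  have "linear_on V (\<lambda>p. h p t)" if t: "t \<in> TS M N" for t
  proof (rule linear_onI)
    fix u v assume uv: "u \<in> V" "v \<in> V"
    show "h (u + v) t = h u t + h v t"
    proof (rule TS_eq[OF M N h(1)[OF fs.subspace_add[OF V uv]] lin_plus[OF h(1)[OF uv(1)] h(1)[OF uv(2)]] _ t])
      fix \<mu> m \<nu> n assume "m \<in> wspace M \<mu>" "n \<in> wspace N \<nu>"
      then have mn: "m \<in> carr M" "n \<in> carr N" by (simp_all add: wspace_carr)
      show "h (u + v) (proj M N (m \<otimes> n)) = h u (proj M N (m \<otimes> n)) + h v (proj M N (m \<otimes> n))"
        unfolding h(2)[OF uv(1) mn] h(2)[OF uv(2) mn] h(2)[OF fs.subspace_add[OF V uv] mn]
        by (rule lin_add[OF lin[OF mn] uv])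
    qed
  next
    fix c v assume v: "v \<in> V"
    show "h (fscale c v) t = fscale c (h v t)"
    proof (rule TS_eq[OF M N h(1)[OF fs.subspace_scale[OF V v]] lin_fscale[OF h(1)[OF v]] _ t])
      fix \<mu> m \<nu> n assume "m \<in> wspace M \<mu>" "n \<in> wspace N \<nu>"
      then have mn: "m \<in> carr M" "n \<in> carr N" by (simp_all add: wspace_carr)
      show "h (fscale c v) (proj M N (m \<otimes> n)) = fscale c (h v (proj M N (m \<otimes> n)))"
        unfolding h(2)[OF v mn] h(2)[OF fs.subspace_scale[OF V v] mn]
        by (rule lin_scale[OF lin[OF mn] v])
    qed
  qed
  with h have "bilin V (TS M N) h" by (intro bilinI) blast+
  with h(2) show ?thesis by blast
qed

section \<open>The module structure on a tensor product over the algebra\<close>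

lemma carr_TM [simp]: "carr (TM M N) = TS M N"
  by (simp add: tensorA_def Let_def)

lemma tensor_act_mem:
  assumes M: "weighted M" and N: "weighted N" and t: "t \<in> tensor (carr M) (carr N)"
  shows "tensor_act M N z t \<in> tensor (carr M) (carr N)"
  by (rule weighted_tensor_mem[OF M N lin_tensor_act[OF M N] subspace_tensor _ t])
    (simp add: tensor_act_wspace[OF M N] fs.subspace_scale tensorI wspace_carr)

lemma
  assumes M: "wmod M" and N: "wmod N"
  shows lin_act_TM: "linear_on (TS M N) (act (TM M N) z)"
    and act_TM: "t \<in> tensor (carr M) (carr N) \<Longrightarrow> act (TM M N) z (proj M N t) = proj M N (tensor_act M N z t)"
proof -
  note W = wmod_wt[OF M] wmod_wt[OF N]
  let ?g = "\<lambda>t. proj M N (tensor_act M N z t)"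
  have g: "linear_on (tensor (carr M) (carr N)) ?g"
    by (rule lin_compose[OF lin_tensor_act[OF W] lin_proj[OF M N] tensor_act_mem[OF W]])
  have bal: "balanced M N ?g"
  proof (rule balancedI)
    fix \<mu> m x \<nu> n assume *: "\<mu> \<in> L" "m \<in> wspace M \<mu>" "x \<in> l" "\<nu> \<in> L" "n \<in> wspace N \<nu>"
    note a = tensorI[OF lact_mem[OF M *(3) wspace_carr[OF *(2)]] wspace_carr[OF *(5)]]
    note b = tensorI[OF wspace_carr[OF *(2)] lact_mem[OF N *(3) wspace_carr[OF *(5)]]]
    \<comment> \<open>Both tensors have total weight \<open>x + \<mu> + \<nu>\<close>, so
      \<open>z\<close> acts on them by the same scalar and the claim reduces to the relation
      itself.\<close>
    show "fscale (q \<mu> x) (?g (lact M x m \<otimes> n)) = ?g (m \<otimes> lact N x n)"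
      unfolding tensor_act_wspace[OF W lact_wspace[OF M *(3,1,2)] *(5)] tensor_act_wspace[OF W *(2) lact_wspace[OF N *(3-5)]]
        lin_scale[OF lin_proj[OF M N] a] lin_scale[OF lin_proj[OF M N] b]
        proj_balanced[OF M N *(2,3) wspace_carr[OF *(5)]]
      by (simp add: ac_simps)
  qed
  have act: "act (TM M N) z = desc M N ?g"
    by (simp add: tensorA_def Let_def desc_def)
  show "linear_on (TS M N) (act (TM M N) z)"
    unfolding act by (rule lin_desc[OF M N g bal])
  show "t \<in> tensor (carr M) (carr N) \<Longrightarrow> act (TM M N) z (proj M N t) = proj M N (tensor_act M N z t)"
    unfolding act by (rule desc_proj[OF M N g bal])
qed

lemma proj_wspace:
  assumes M: "wmod M" and N: "wmod N" and m: "m \<in> wspace M \<mu>" and n: "n \<in> wspace N \<nu>"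
  shows "proj M N (m \<otimes> n) \<in> wspace (TM M N) (\<mu> + \<nu>)"
proof -
  note t = tensorI[OF wspace_carr[OF m] wspace_carr[OF n]]
  show ?thesis
    using lin_scale[OF lin_proj[OF M N] t]
    by (simp add: wspace_def proj_mem[OF t] act_TM[OF M N t]
        tensor_act_wspace[OF wmod_wt[OF M] wmod_wt[OF N] m n])
qed

lemma
  fixes M N :: "('h, 'b) amod"
  assumes M: "wmod M" and N: "wmod N"
  shows lin_nu_TM: "linear_on (tensor (carr AA) (TS M N)) (nu (TM M N))"
    and nu_TM: "a \<in> carr AA \<Longrightarrow> m \<in> carr M \<Longrightarrow> n \<in> carr N \<Longrightarrow>
      nu (TM M N) (a \<otimes> proj M N (m \<otimes> n)) = proj M N (nu M (a \<otimes> m) \<otimes> n)"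
proof -
  let ?b = "\<lambda>a m n. proj M N (nu M (a \<otimes> m) \<otimes> n)"
  note p = lin_proj[OF M N]
  have num: "nu M (a \<otimes> m) \<in> carr M" if "a \<in> carr AA" "m \<in> carr M" for a m
    by (rule nu_mem[OF M tensorI[OF that]])
  have lin: "linear_on (carr AA) (\<lambda>a. ?b a m n)" if mn: "m \<in> carr M" "n \<in> carr N" for m n
    by (rule lin_compose[OF lin_otimes_left[OF lin_nu_left[OF M mn(1) lin_id(2)]] p
          tensorI[OF num[OF _ mn(1)] mn(2)]])
  have bil: "bilin (carr M) (carr N) (?b a)" if a: "a \<in> carr AA" for a
  proof (rule bilinI)
    show "linear_on (carr M) (\<lambda>m. ?b a m n)" if n: "n \<in> carr N" for n
      by (rule lin_compose[OF lin_otimes_left[OF lin_nu_right[OF M a lin_id(2)]] p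
          tensorI[OF num[OF a] n]])
    show "linear_on (carr N) (\<lambda>n. ?b a m n)" if m: "m \<in> carr M" for m
      by (rule lin_compose[OF lin_right p tensorI[OF num[OF a m]]])
  qed
  have "\<exists>h. bilin (carr AA) (TS M N) h \<and>
    (\<forall>a\<in>carr AA. \<forall>m\<in>carr M. \<forall>n\<in>carr N. h a (proj M N (m \<otimes> n)) = ?b a m n)"
  proof (rule TS_bilift[OF M N subspace_AA bil lin])
    fix a :: "('h, 'b) vec" and \<mu> m x \<nu> n assume a: "a \<in> carr AA" and *: "\<mu> \<in> L" "m \<in> wspace M \<mu>" "x \<in> l" "\<nu> \<in> L" "n \<in> wspace N \<nu>"
    note m = wspace_carr[OF *(2)] and n = wspace_carr[OF *(5)] and x = *(3)
    show "fscale (q \<mu> x) (?b a (lact M x m) n) = ?b a m (lact N x n)"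
    proof (rule AA_eq[OF lin_fscale[OF lin[OF lact_mem[OF M x m] n]] lin[OF m lact_mem[OF N x n]] _ a])
      fix y assume y: "y \<in> l"
      have t: "lact M (x + y) m \<otimes> n \<in> tensor (carr M) (carr N)"
        by (rule tensorI[OF lact_mem[OF M l_add[OF x y] m] n])
      \<comment> \<open>Left multiplication by \<open>ee y\<close> has to respect the right action
        of \<open>ee x\<close>. The two orders of multiplication give \<open>\<alpha> y x\<close>
        and \<open>q y x * \<alpha> x y\<close>, which agree by commutativity of the
        algebra.\<close>
      show "fscale (q \<mu> x) (?b (ee y) (lact M x m) n) = ?b (ee y) m (lact N x n)"
        unfolding proj_balanced[OF M N lact_wspace[OF M y *(1,2)] x n] lact_lact[OF M y x m] lact_lact[OF M x y m]
          otimes_scale_left add.commute[of y x] lin_scale[OF p t]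
        using alpha_swap[OF y x] by (simp add: q_add_left mult_ac)
    qed
  qed
  then obtain h where h: "bilin (carr AA) (TS M N) h"
    "\<And>a m n. a \<in> carr AA \<Longrightarrow> m \<in> carr M \<Longrightarrow> n \<in> carr N \<Longrightarrow> h a (proj M N (m \<otimes> n)) = ?b a m n" by blast
  let ?f = "tlift (carr AA) (TS M N) h"
  note f = lin_tlift[OF subspace_AA subspace_TS[OF M N] h(1)] tlift_otimes[OF subspace_AA subspace_TS[OF M N] h(1)]
  have f2: "?f (a \<otimes> proj M N (m \<otimes> n)) = ?b a m n" if "a \<in> carr AA" "m \<in> carr M" "n \<in> carr N" for a m n
    using f(2)[OF that(1) proj_memI[OF that(2,3)]] h(2)[OF that] by simp
  let ?P = "\<lambda>f. \<forall>a\<in>carr AA. \<forall>m\<in>carr M. \<forall>n\<in>carr N. f (a \<otimes> proj M N (m \<otimes> n)) = ?b a m n"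
  have nu: "nu (TM M N) = the_linear (tensor (carr AA) (TS M N)) ?P"
    by (simp add: tensorA_def Let_def)
  have E: "nu (TM M N) = restrict ?f (tensor (carr AA) (TS M N))"
    unfolding nu
  proof (rule the_linear_eq[where P = ?P, OF f(1) _ tensor_span[of "ee ` l", folded carr_AA,
          of "proj M N ` pure_tensors (wvecs M) (wvecs N)", folded TS_span[OF M N]]])
    show "?P (restrict ?f (tensor (carr AA) (TS M N)))"
      using f2 by (simp add: tensorI proj_memI)
    fix k s assume k: "?P k" and "s \<in> pure_tensors (ee ` l) (proj M N ` pure_tensors (wvecs M) (wvecs N))"
    then obtain x m n where *: "x \<in> l" "m \<in> carr M" "n \<in> carr N" "s = ee x \<otimes> proj M N (m \<otimes> n)"
      unfolding wvecs_def using wspace_carr by blast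
    show "k s = ?f s"
      unfolding *(4) f2[OF ee_in_AA[OF *(1)] *(2,3)] using k ee_in_AA[OF *(1)] *(2,3) by blast
  qed
  show "linear_on (tensor (carr AA) (TS M N)) (nu (TM M N))"
    unfolding E by (rule lin_restrict[OF f(1) subspace_tensor])
  show "nu (TM M N) (a \<otimes> proj M N (m \<otimes> n)) = ?b a m n" if "a \<in> carr AA" "m \<in> carr M" "n \<in> carr N"
    unfolding E using f2[OF that] that by (simp add: tensorI proj_memI)
qed

lemma lact_TM:
  assumes "wmod M" "wmod N" "x \<in> l" "m \<in> carr M" "n \<in> carr N"
  shows "lact (TM M N) x (proj M N (m \<otimes> n)) = proj M N (lact M x m \<otimes> n)"
  by (rule nu_TM[OF assms(1,2) ee_in_AA[OF assms(3)] assms(4,5)])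

text \<open>The algebra acts through the first factor, so associativity and unit are inherited from
  \<open>M\<close>, while weights of the two factors add up inside \<open>L\<close>.\<close>

lemma wmod_TM:
  assumes M: "wmod M" and N: "wmod N" shows "wmod (TM M N)"
proof (rule wmodI[of "TM M N", unfolded carr_TM, OF TS_span[OF M N] lin_act_TM[OF M N] lin_nu_TM[OF M N]])
  fix g assume "g \<in> proj M N ` pure_tensors (wvecs M) (wvecs N)"
  then obtain \<mu> m \<nu> n where *: "\<mu> \<in> L" "m \<in> wspace M \<mu>" "\<nu> \<in> L" "n \<in> wspace N \<nu>" "g = proj M N (m \<otimes> n)"
    unfolding wvecs_def by blast
  note m = wspace_carr[OF *(2)] and n = wspace_carr[OF *(4)]
  show "\<exists>\<mu>\<in>L. g \<in> wspace (TM M N) \<mu> \<and> (\<forall>x\<in>l. lact (TM M N) x g \<in> wspace (TM M N) (x + \<mu>))"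
  proof (intro bexI conjI ballI)
    show "g \<in> wspace (TM M N) (\<mu> + \<nu>)" unfolding *(5) by (rule proj_wspace[OF M N *(2,4)])
    show "lact (TM M N) x g \<in> wspace (TM M N) (x + (\<mu> + \<nu>))" if x: "x \<in> l" for x
      unfolding *(5) lact_TM[OF M N x m n] add.assoc[symmetric]
      by (rule proj_wspace[OF M N lact_wspace[OF M x *(1,2)] *(4)])
    show "\<mu> + \<nu> \<in> L" by (rule L_add[OF *(1,3)])
  qed
  show "lact (TM M N) x (lact (TM M N) y g) = fscale (\<alpha> x y) (lact (TM M N) (x + y) g)" if x: "x \<in> l" and y: "y \<in> l" for x y
    unfolding *(5) lact_TM[OF M N y m n] lact_TM[OF M N x lact_mem[OF M y m] n] lact_TM[OF M N l_add[OF x y] m n]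
      lact_lact[OF M x y m] otimes_scale_left
    by (rule lin_scale[OF lin_proj[OF M N] tensorI[OF lact_mem[OF M l_add[OF x y] m] n]])
  show "lact (TM M N) 0 g = g"
    unfolding *(5) lact_TM[OF M N l_zero m n] lact_zero[OF M m] ..
qed


subsection \<open>Structure maps of the category of local modules\<close>

abbreviation "LC \<equiv> local_cat sc form l \<alpha>"
abbreviation "lhom \<equiv> local_hom form l \<alpha>"

lemma LC_simps [simp]:
  "Obj LC = local_obj sc form l \<alpha>" "Hom LC = lhom" "TensO LC = TM" "UnitO LC = AA"
  "Id LC M = \<lparr>src = M, tgt = M, fn = restrict id (carr M)\<rparr>"
  "Comp LC g f = \<lparr>src = src f, tgt = tgt g, fn = compose (carr (src f)) (fn g) (fn f)\<rparr>"
  "src (TensA LC f g) = TM (src f) (src g)" "tgt (TensA LC f g) = TM (tgt f) (tgt g)"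
  "src (Assoc LC M N P) = TM (TM M N) P" "tgt (Assoc LC M N P) = TM M (TM N P)"
  "src (Lunit LC M) = TM AA M" "tgt (Lunit LC M) = M"
  "src (Runit LC M) = TM M AA" "tgt (Runit LC M) = M"
  "src (Braid LC M N) = TM M N" "tgt (Braid LC M N) = TM N M"
  by (simp_all add: local_cat_def)

lemma
  assumes "f \<in> lhom M N"
  shows lhom_src: "src f = M" and lhom_tgt: "tgt f = N"
    and lhom_lin: "linear_on (carr M) (fn f)" and lhom_mem: "m \<in> carr M \<Longrightarrow> fn f m \<in> carr N"
    and lhom_act: "m \<in> carr M \<Longrightarrow> fn f (act M z m) = act N z (fn f m)"
    and lhom_nu: "a \<in> carr AA \<Longrightarrow> m \<in> carr M \<Longrightarrow> fn f (nu M (a \<otimes> m)) = nu N (a \<otimes> fn f m)"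
  using assms unfolding local_hom_def by blast+

lemma lhom_wspace:
  assumes f: "f \<in> lhom M N" and m: "m \<in> wspace M \<mu>" shows "fn f m \<in> wspace N \<mu>"
proof -
  note m' = wspace_carr[OF m]
  have "act N z (fn f m) = fscale (form \<mu> z) (fn f m)" for z
    using lhom_act[OF f m', of z] lin_scale[OF lhom_lin[OF f] m'] by (simp add: wspace_act[OF m])
  then show ?thesis by (simp add: wspace_def lhom_mem[OF f m'])
qed

lemma lhom_lact: "f \<in> lhom M N \<Longrightarrow> x \<in> l \<Longrightarrow> m \<in> carr M \<Longrightarrow> fn f (lact M x m) = lact N x (fn f m)"
  by (rule lhom_nu[OF _ ee_in_AA])

text \<open>A common weight of a generator and its image is how h-linearity is verified: both
  actions are then by the same scalar.\<close>

lemma lhomI: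
  assumes M: "wmod M" and N: "wmod N" and sp: "carr M = fs.span G"
    and f: "src f = M" "tgt f = N" "fn f \<in> extensional (carr M)" "linear_on (carr M) (fn f)"
    and G: "\<And>g. g \<in> G \<Longrightarrow> \<exists>\<mu>. g \<in> wspace M \<mu> \<and> fn f g \<in> wspace N \<mu>"
    and nu: "\<And>g x. g \<in> G \<Longrightarrow> x \<in> l \<Longrightarrow> fn f (lact M x g) = lact N x (fn f g)"
  shows "f \<in> lhom M N"
proof -
  note WM = wmod_wt[OF M] and WN = wmod_wt[OF N]
  have mem: "fn f m \<in> carr N" if m: "m \<in> carr M" for m
    by (rule lin_memI[OF sp f(4) weighted_subspace[OF WN] _ m])
      (use G wspace_carr in blast)
  have act: "fn f (act M z m) = act N z (fn f m)" if m: "m \<in> carr M" for z m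
  proof (rule lin_eqI[OF sp lin_compose[OF weighted_act[OF WM] f(4) weighted_act_mem[OF WM]]
        lin_compose[OF f(4) weighted_act[OF WN] mem] _ m])
    fix g assume "g \<in> G"
    then obtain \<mu> where g: "g \<in> wspace M \<mu>" "fn f g \<in> wspace N \<mu>" using G by blast
    show "fn f (act M z g) = act N z (fn f g)"
      unfolding wspace_act[OF g(1)] wspace_act[OF g(2)] by (rule lin_scale[OF f(4) wspace_carr[OF g(1)]])
  qed
  have nuM: "nu M (a \<otimes> m) \<in> carr M" if "a \<in> carr AA" "m \<in> carr M" for a m
    by (rule nu_mem[OF M tensorI[OF that]])
  have b1: "bilin (carr AA) (carr M) (\<lambda>a m. fn f (nu M (a \<otimes> m)))"
  proof (rule bilinI)
    show "linear_on (carr AA) (\<lambda>a. fn f (nu M (a \<otimes> m)))" if "m \<in> carr M" for m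
      by (rule lin_compose[OF lin_nu_left[OF M that lin_id(2)] f(4) nuM[OF _ that]])
    show "linear_on (carr M) (\<lambda>m. fn f (nu M (a \<otimes> m)))" if "a \<in> carr AA" for a
      by (rule lin_compose[OF lin_nu_right[OF M that lin_id(2)] f(4) nuM[OF that]])
  qed
  have b2: "bilin (carr AA) (carr M) (\<lambda>a m. nu N (a \<otimes> fn f m))"
  proof (rule bilinI)
    show "linear_on (carr AA) (\<lambda>a. nu N (a \<otimes> fn f m))" if "m \<in> carr M" for m
      by (rule lin_nu_left[OF N mem[OF that] lin_id(2)])
    show "linear_on (carr M) (\<lambda>m. nu N (a \<otimes> fn f m))" if "a \<in> carr AA" for a
      by (rule lin_nu_right[OF N that f(4) mem])
  qed
  have "fn f (nu M (a \<otimes> m)) = nu N (a \<otimes> fn f m)" if "a \<in> carr AA" "m \<in> carr M" for a m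
    by (rule bilin_eqI[OF carr_AA sp b1 b2 _ that])
      (use nu in blast)
  then show ?thesis
    unfolding local_hom_def using f mem act by blast
qed

lemma
  fixes M M' N N' :: "('h, 'b) amod"
  assumes M: "wmod M" "wmod M'" and N: "wmod N" "wmod N'" and f: "f \<in> lhom M M'" and g: "g \<in> lhom N N'"
  shows lin_TensA: "linear_on (TS M N) (fn (TensA LC f g))"
    and TensA_proj: "m \<in> carr M \<Longrightarrow> n \<in> carr N \<Longrightarrow>
      fn (TensA LC f g) (proj M N (m \<otimes> n)) = proj M' N' (fn f m \<otimes> fn g n)"
proof -
  note S = weighted_subspace[OF wmod_wt[OF M(1)]] weighted_subspace[OF wmod_wt[OF N(1)]]
    lhom_lin[OF f] lhom_lin[OF g]
  let ?t = "tmap (carr M) (carr N) (fn f) (fn g)"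
  let ?k = "\<lambda>t. proj M' N' (?t t)"
  have mem: "?t t \<in> tensor (carr M') (carr N')" if "t \<in> tensor (carr M) (carr N)" for t
    by (rule lin_tensor_mem[OF lin_tmap[OF S] subspace_tensor _ that])
      (simp add: tmap_otimes[OF S] tensorI lhom_mem[OF f] lhom_mem[OF g])
  have k: "linear_on (tensor (carr M) (carr N)) ?k"
    by (rule lin_compose[OF lin_tmap[OF S] lin_proj[OF M(2) N(2)] mem])
  have bal: "balanced M N ?k"
  proof (rule balancedI)
    fix \<mu> m x \<nu> n assume *: "\<mu> \<in> L" "m \<in> wspace M \<mu>" "x \<in> l" "\<nu> \<in> L" "n \<in> wspace N \<nu>"
    note m = wspace_carr[OF *(2)] and n = wspace_carr[OF *(5)] and x = *(3)
    \<comment> \<open>Module maps commute with \<open>lact\<close> and preserve weights, hence the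
      scalar in the relation for the target is again \<open>q \<mu> x\<close>.\<close>
    show "fscale (q \<mu> x) (?k (lact M x m \<otimes> n)) = ?k (m \<otimes> lact N x n)"
      unfolding tmap_otimes[OF S lact_mem[OF M(1) x m] n] tmap_otimes[OF S m lact_mem[OF N(1) x n]]
        lhom_lact[OF f x m] lhom_lact[OF g x n]
        proj_balanced[OF M(2) N(2) lhom_wspace[OF f *(2)] x lhom_mem[OF g n]] ..
  qed
  let ?P = "\<lambda>h. \<forall>m\<in>carr M. \<forall>n\<in>carr N. h (proj M N (m \<otimes> n)) = proj M' N' (fn f m \<otimes> fn g n)"
  note k = M(1) N(1) k bal
  have d: "desc M N ?k (proj M N (m \<otimes> n)) = proj M' N' (fn f m \<otimes> fn g n)" if "m \<in> carr M" "n \<in> carr N" for m n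
    using desc_proj[OF k tensorI[OF that]] tmap_otimes[OF S that] by simp
  have "fn (TensA LC f g) = the_linear (TS M N) ?P"
    by (simp add: local_cat_def lhom_src[OF f] lhom_src[OF g] lhom_tgt[OF f] lhom_tgt[OF g])
  also have "\<dots> = restrict (desc M N ?k) (TS M N)"
  proof (rule the_linear_eq[where P = ?P, OF lin_desc[OF k] _ TS_span[OF M(1) N(1)]])
    show "?P (restrict (desc M N ?k) (TS M N))" using d by (simp add: proj_memI)
    fix j s assume j: "?P j" and "s \<in> proj M N ` pure_tensors (wvecs M) (wvecs N)"
    then obtain m n where *: "m \<in> carr M" "n \<in> carr N" "s = proj M N (m \<otimes> n)"
      unfolding wvecs_def using wspace_carr by blast
    show "j s = desc M N ?k s" unfolding *(3) d[OF *(1,2)] using j *(1,2) by blast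
  qed
  finally have E: "fn (TensA LC f g) = restrict (desc M N ?k) (TS M N)" .
  show "linear_on (TS M N) (fn (TensA LC f g))"
    unfolding E by (rule lin_restrict[OF lin_desc[OF k] subspace_TS[OF M(1) N(1)]])
  show "fn (TensA LC f g) (proj M N (m \<otimes> n)) = proj M' N' (fn f m \<otimes> fn g n)" if "m \<in> carr M" "n \<in> carr N"
    unfolding E using d[OF that] proj_memI[OF that] by simp
qed

lemma TensA_mem:
  assumes "wmod M" "wmod M'" and "wmod N" "wmod N'" and f: "f \<in> lhom M M'" and g: "g \<in> lhom N N'"
    and t: "t \<in> TS M N"
  shows "fn (TensA LC f g) t \<in> TS M' N'"
  by (rule TS_mem[OF assms(1,3) lin_TensA[OF assms(1-6)] subspace_TS[OF assms(2,4)] _ t])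
    (simp add: TensA_proj[OF assms(1-6)] wspace_carr proj_memI lhom_mem[OF f] lhom_mem[OF g])

lemma
  fixes M :: "('h, 'b) amod"
  assumes M: "wmod M"
  shows lin_Lunit: "linear_on (TS AA M) (fn (Lunit LC M))"
    and Lunit_ext: "fn (Lunit LC M) \<in> extensional (TS AA M)"
    and Lunit_proj: "t \<in> tensor (carr AA) (carr M) \<Longrightarrow> fn (Lunit LC M) (proj AA M t) = nu M t"
proof -
  have E: "fn (Lunit LC M) = desc AA M (nu M)"
    by (simp add: local_cat_def desc_def)
  have bal: "balanced AA M (nu M)"
  proof (rule balancedI_span[OF wmod_AA M wmod_nu[OF M] carr_AA weighted_carr[OF wmod_wt[OF M]]])
    fix x and a :: "('h, 'b) vec" and m assume x: "x \<in> l" and "a \<in> ee ` l" "m \<in> wvecs M"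
    then obtain y where y: "y \<in> l" "a = ee y" and m: "m \<in> carr M" unfolding wvecs_def using wspace_carr by blast
    \<comment> \<open>Here the action itself is balanced:
      \<open>q y x * \<alpha> x y = \<alpha> y x\<close>, once more the commutativity of the
      algebra.\<close>
    have "fscale (q y x) (nu M (lact AA x (ee y) \<otimes> m)) = nu M (ee y \<otimes> lact M x m)"
      unfolding nu_AA[OF x y(1)] lact_lact[OF M y(1) x m] otimes_scale_left add.commute[of y x]
        lin_scale[OF wmod_nu[OF M] tensorI[OF ee_in_AA[OF l_add[OF x y(1)]] m]]
      using alpha_swap[OF y(1) x] by simp
    then show "\<exists>\<mu>. a \<in> wspace AA \<mu> \<and> fscale (q \<mu> x) (nu M (lact AA x a \<otimes> m)) = nu M (a \<otimes> lact M x m)"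
      using ee_wspace[OF y(1)] y(2) by blast
  qed
  note * = wmod_AA M wmod_nu[OF M] bal
  show "linear_on (TS AA M) (fn (Lunit LC M))" unfolding E by (rule lin_desc[OF *])
  show "fn (Lunit LC M) \<in> extensional (TS AA M)" unfolding E by (rule desc_ext[OF *])
  show "t \<in> tensor (carr AA) (carr M) \<Longrightarrow> fn (Lunit LC M) (proj AA M t) = nu M t" unfolding E by (rule desc_proj[OF *])
qed

lemma
  fixes M :: "('h, 'b) amod"
  assumes M: "wmod M"
  shows lin_Runit: "linear_on (TS M AA) (fn (Runit LC M))"
    and Runit_ext: "fn (Runit LC M) \<in> extensional (TS M AA)"
    and Runit_proj: "t \<in> tensor (carr M) (carr AA) \<Longrightarrow> fn (Runit LC M) (proj M AA t) = ract M t"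
proof -
  have E: "fn (Runit LC M) = desc M AA (ract M)"
    by (simp add: local_cat_def desc_def)
  have bal: "balanced M AA (ract M)"
  proof (rule balancedI_span[OF M wmod_AA lin_ract[OF M] weighted_carr[OF wmod_wt[OF M]] carr_AA])
    fix x and a :: "('h, 'b) vec" and m assume x: "x \<in> l" and "m \<in> wvecs M" "a \<in> ee ` l"
    then obtain y \<mu> where y: "y \<in> l" "a = ee y" and m: "\<mu> \<in> L" "m \<in> wspace M \<mu>" unfolding wvecs_def by blast
    \<comment> \<open>This is the associativity of the right action. After expanding the factors
      \<open>q\<close>, what remains is \<open>q x y * \<alpha> y x = \<alpha> x y\<close>.\<close>
    have "fscale (q \<mu> x) (ract M (lact M x m \<otimes> ee y)) = ract M (m \<otimes> lact AA x (ee y))"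
      unfolding ract_wspace[OF M lact_wspace[OF M x m] y(1)] nu_AA[OF x y(1)] otimes_scale_right
        lin_scale[OF lin_ract[OF M] tensorI[OF wspace_carr[OF m(2)] ee_in_AA[OF l_add[OF x y(1)]]]]
        ract_wspace[OF M m(2) l_add[OF x y(1)]] lact_lact[OF M y(1) x wspace_carr[OF m(2)]] add.commute[of y x]
      using alpha_swap[OF x y(1)] by (simp add: q_add_left q_add_right mult_ac)
    then show "\<exists>\<mu>. m \<in> wspace M \<mu> \<and> fscale (q \<mu> x) (ract M (lact M x m \<otimes> a)) = ract M (m \<otimes> lact AA x a)"
      using m y(2) by blast
  qed
  note * = M wmod_AA lin_ract[OF M] bal
  show "linear_on (TS M AA) (fn (Runit LC M))" unfolding E by (rule lin_desc[OF *])
  show "fn (Runit LC M) \<in> extensional (TS M AA)" unfolding E by (rule desc_ext[OF *])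
  show "t \<in> tensor (carr M) (carr AA) \<Longrightarrow> fn (Runit LC M) (proj M AA t) = ract M t" unfolding E by (rule desc_proj[OF *])
qed

lemma
  fixes M N :: "('h, 'b) amod"
  assumes M: "wmod M" and N: "wmod N"
  shows lin_Braid: "linear_on (TS M N) (fn (Braid LC M N))"
    and Braid_proj: "m \<in> wspace M \<mu> \<Longrightarrow> n \<in> wspace N \<nu> \<Longrightarrow>
      fn (Braid LC M N) (proj M N (m \<otimes> n)) = fscale (q \<mu> \<nu>) (proj N M (n \<otimes> m))"
proof -
  note W = wmod_wt[OF M] wmod_wt[OF N]
  let ?k = "\<lambda>t. proj N M (braiding sc form M N t)"
  have E: "fn (Braid LC M N) = desc M N ?k"
    by (simp add: local_cat_def desc_def)
  have k: "linear_on (tensor (carr M) (carr N)) ?k"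
    by (rule lin_compose[OF lin_braiding[OF W] lin_proj[OF N M] braiding_mem[OF W]])
  have kw: "?k (m \<otimes> n) = fscale (q \<mu> \<nu>) (proj N M (n \<otimes> m))" if "m \<in> wspace M \<mu>" "n \<in> wspace N \<nu>" for m n \<mu> \<nu>
    unfolding braiding_wspace[OF W that]
    by (rule lin_scale[OF lin_proj[OF N M] tensorI[OF wspace_carr[OF that(2)] wspace_carr[OF that(1)]]])
  have bal: "balanced M N ?k"
  proof (rule balancedI)
    fix \<mu> m x \<nu> n assume *: "\<mu> \<in> L" "m \<in> wspace M \<mu>" "x \<in> l" "\<nu> \<in> L" "n \<in> wspace N \<nu>"
    \<comment> \<open>The braiding moves \<open>ee x\<close> past \<open>n\<close> and the relation
      on the other side moves it back. The resulting double braiding is trivial because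
      \<open>\<nu>\<close> lies in \<open>L\<close>; this is where locality makes the braiding
      descend.\<close>
    have "q x \<nu> * q x \<nu> = 1" by (rule q_sq[OF L_int(2)[OF *(4,3)]])
    then show "fscale (q \<mu> x) (?k (lact M x m \<otimes> n)) = ?k (m \<otimes> lact N x n)"
      unfolding kw[OF lact_wspace[OF M *(3,1,2)] *(5)] kw[OF *(2) lact_wspace[OF N *(3-5)]]
        proj_balanced[OF N M *(5,3) wspace_carr[OF *(2)]]
      by (simp add: q_add_left q_add_right q_sym[of \<nu> x] mult_ac)
  qed
  show "linear_on (TS M N) (fn (Braid LC M N))"
    unfolding E by (rule lin_desc[OF M N k bal])
  show "fn (Braid LC M N) (proj M N (m \<otimes> n)) = fscale (q \<mu> \<nu>) (proj N M (n \<otimes> m))"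
    if mn: "m \<in> wspace M \<mu>" "n \<in> wspace N \<nu>"
    unfolding E kw[OF mn, symmetric]
    by (rule desc_proj[OF M N k bal tensorI[OF wspace_carr[OF mn(1)] wspace_carr[OF mn(2)]]])
qed

lemma Braid_mem:
  assumes M: "wmod M" and N: "wmod N" and t: "t \<in> TS M N" shows "fn (Braid LC M N) t \<in> TS N M"
  by (rule TS_mem[OF M N lin_Braid[OF M N] subspace_TS[OF N M] _ t])
    (simp add: Braid_proj[OF M N] fs.subspace_scale[OF subspace_TS[OF N M]] proj_memI wspace_carr)

text \<open>The description prescribes values on twofold classes, so two descents are needed: one
  through the relations between \<open>M\<close> and \<open>N\<close> with \<open>p\<close> as a
  parameter, and one through those between their tensor product and \<open>P\<close>.\<close>

lemma
  fixes M N P :: "('h, 'b) amod"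
  assumes M: "wmod M" and N: "wmod N" and P: "wmod P"
  shows lin_Assoc: "linear_on (TS (TM M N) P) (fn (Assoc LC M N P))"
    and Assoc_proj: "m \<in> carr M \<Longrightarrow> n \<in> carr N \<Longrightarrow> p \<in> carr P \<Longrightarrow>
      fn (Assoc LC M N P) (proj (TM M N) P (proj M N (m \<otimes> n) \<otimes> p)) = proj M (TM N P) (m \<otimes> proj N P (n \<otimes> p))"
    and Assoc_mem: "t \<in> TS (TM M N) P \<Longrightarrow> fn (Assoc LC M N P) t \<in> TS M (TM N P)"
proof -
  note MN = wmod_TM[OF M N] and NP = wmod_TM[OF N P]
  note SP = weighted_subspace[OF wmod_wt[OF P]]
  note p1 = lin_proj[OF M NP, unfolded carr_TM] and p2 = lin_proj[OF N P]
  let ?b = "\<lambda>p m n. proj M (TM N P) (m \<otimes> proj N P (n \<otimes> p))"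
  have mem: "m \<otimes> proj N P (n \<otimes> p) \<in> tensor (carr M) (TS N P)" if "m \<in> carr M" "n \<in> carr N" "p \<in> carr P" for m n p
    by (rule tensorI[OF that(1) proj_memI[OF that(2,3)]])
  have "\<exists>h. bilin (carr P) (TS M N) h \<and>
    (\<forall>p\<in>carr P. \<forall>m\<in>carr M. \<forall>n\<in>carr N. h p (proj M N (m \<otimes> n)) = ?b p m n)"
  proof (rule TS_bilift[OF M N SP])
    show "bilin (carr M) (carr N) (?b p)" if p: "p \<in> carr P" for p
    proof (rule bilinI)
      show "linear_on (carr M) (\<lambda>m. ?b p m n)" if n: "n \<in> carr N" for n
        by (rule lin_compose[OF lin_left p1 mem[OF _ n p]])
      show "linear_on (carr N) (\<lambda>n. ?b p m n)" if m: "m \<in> carr M" for m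
        by (rule lin_compose[OF lin_otimes_right[OF lin_compose[OF lin_left p2
                tensorI[OF _ p]]] p1 mem[OF m _ p]])
    qed
    show "linear_on (carr P) (\<lambda>p. ?b p m n)" if mn: "m \<in> carr M" "n \<in> carr N" for m n
      by (rule lin_compose[OF lin_otimes_right[OF lin_compose[OF lin_right p2
              tensorI[OF mn(2)]]] p1 mem[OF mn]])
    fix p \<mu> m x \<nu> n assume p: "p \<in> carr P" and *: "\<mu> \<in> L" "m \<in> wspace M \<mu>" "x \<in> l" "\<nu> \<in> L" "n \<in> wspace N \<nu>"
    note n = wspace_carr[OF *(5)]
    show "fscale (q \<mu> x) (?b p (lact M x m) n) = ?b p m (lact N x n)"
      using proj_balanced[OF M NP *(2,3), of "proj N P (n \<otimes> p)"] proj_memI[OF n p]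
      by (simp add: lact_TM[OF N P *(3) n p])
  qed
  then obtain h where h: "bilin (carr P) (TS M N) h"
    "\<And>p m n. p \<in> carr P \<Longrightarrow> m \<in> carr M \<Longrightarrow> n \<in> carr N \<Longrightarrow> h p (proj M N (m \<otimes> n)) = ?b p m n" by blast
  have bil: "bilin (TS M N) (carr P) (\<lambda>t p. h p t)"
    using h(1) unfolding bilin_def by blast
  let ?g = "tlift (TS M N) (carr P) (\<lambda>t p. h p t)"
  note g = lin_tlift[OF subspace_TS[OF M N] SP bil] tlift_otimes[OF subspace_TS[OF M N] SP bil]
  have g2: "?g (proj M N (m \<otimes> n) \<otimes> p) = ?b p m n" if "m \<in> carr M" "n \<in> carr N" "p \<in> carr P" for m n p
    using g(2)[OF proj_memI[OF that(1,2)] that(3)] h(2)[OF that(3,1,2)] by simp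
  have g1: "linear_on (tensor (carr (TM M N)) (carr P)) ?g" using g(1) by simp
  have bal: "balanced (TM M N) P ?g"
  proof (rule balancedI_span[OF MN P g1 TS_span[OF M N, folded carr_TM[of M N]]
        weighted_carr[OF wmod_wt[OF P]]])
    fix x t p assume x: "x \<in> l" and "t \<in> proj M N ` pure_tensors (wvecs M) (wvecs N)" "p \<in> wvecs P"
    then obtain \<mu> m \<nu> n where *: "\<mu> \<in> L" "m \<in> wspace M \<mu>" "\<nu> \<in> L" "n \<in> wspace N \<nu>" "t = proj M N (m \<otimes> n)"
      and p: "p \<in> carr P" unfolding wvecs_def using wspace_carr by blast
    note m = wspace_carr[OF *(2)] and n = wspace_carr[OF *(4)]
    \<comment> \<open>A vector \<open>proj M N (m \<otimes> n)\<close> has weight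
      \<open>\<mu> + \<nu>\<close>, and \<open>q (\<mu> + \<nu>) x\<close> factors into the cost of
      carrying \<open>ee x\<close> past \<open>n\<close> and the cost of carrying it past
      \<open>m\<close>.\<close>
    have "fscale (q (\<mu> + \<nu>) x) (?g (lact (TM M N) x t \<otimes> p)) = ?g (t \<otimes> lact P x p)"
      unfolding *(5) lact_TM[OF M N x m n] g2[OF lact_mem[OF M x m] n p] g2[OF m n lact_mem[OF P x p]]
        proj_balanced[OF N P *(4) x p] otimes_scale_right
        lin_scale[OF p1 mem[OF m lact_mem[OF N x n] p]]
      using proj_balanced[OF M NP *(2) x, of "proj N P (n \<otimes> p)"] proj_memI[OF n p]
      by (simp add: lact_TM[OF N P x n p] q_add_left mult_ac)
    then show "\<exists>\<mu>. t \<in> wspace (TM M N) \<mu> \<and> fscale (q \<mu> x) (?g (lact (TM M N) x t \<otimes> p)) = ?g (t \<otimes> lact P x p)"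
      using proj_wspace[OF M N *(2,4)] *(5) by blast
  qed
  from proj_lift[OF MN P g1 bal] obtain k where k: "linear_on (TS (TM M N) P) k"
    "\<forall>t\<in>tensor (TS M N) (carr P). k (proj (TM M N) P t) = ?g t" unfolding carr_TM by blast
  have k2: "k (proj (TM M N) P (proj M N (m \<otimes> n) \<otimes> p)) = ?b p m n" if "m \<in> carr M" "n \<in> carr N" "p \<in> carr P" for m n p
    using k(2) tensorI[OF proj_memI[OF that(1,2)] that(3)] g2[OF that] by simp
  let ?P = "\<lambda>h. \<forall>m\<in>carr M. \<forall>n\<in>carr N. \<forall>p\<in>carr P.
     h (proj (TM M N) P (proj M N (m \<otimes> n) \<otimes> p)) = ?b p m n"
  let ?G = "pure_tensors (proj M N ` pure_tensors (wvecs M) (wvecs N)) (wvecs P)"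
  have G: "TS (TM M N) P = fs.span (proj (TM M N) P ` ?G)"
    by (rule TS_span_gen[OF MN P TS_span[OF M N, folded carr_TM] weighted_carr[OF wmod_wt[OF P]]])
  have mem3: "proj (TM M N) P (proj M N (m \<otimes> n) \<otimes> p) \<in> TS (TM M N) P" if "m \<in> carr M" "n \<in> carr N" "p \<in> carr P" for m n p
    by (rule proj_memI[of _ "TM M N", unfolded carr_TM, OF proj_memI[OF that(1,2)] that(3)])
  have "fn (Assoc LC M N P) = the_linear (TS (TM M N) P) ?P"
    by (simp add: local_cat_def)
  also have "\<dots> = restrict k (TS (TM M N) P)"
  proof (rule the_linear_eq[where P = ?P, OF k(1) _ G])
    show "?P (restrict k (TS (TM M N) P))" using k2 mem3 by simp
    fix j s assume j: "?P j" and "s \<in> proj (TM M N) P ` ?G"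
    then obtain m n p where *: "m \<in> carr M" "n \<in> carr N" "p \<in> carr P" "s = proj (TM M N) P (proj M N (m \<otimes> n) \<otimes> p)"
      unfolding wvecs_def using wspace_carr by blast
    show "j s = k s" unfolding *(4) k2[OF *(1-3)] using j *(1-3) by blast
  qed
  finally have E: "fn (Assoc LC M N P) = restrict k (TS (TM M N) P)" .
  show lin: "linear_on (TS (TM M N) P) (fn (Assoc LC M N P))"
    unfolding E by (rule lin_restrict[OF k(1) subspace_TS[OF MN P]])
  show pr: "fn (Assoc LC M N P) (proj (TM M N) P (proj M N (m \<otimes> n) \<otimes> p)) = ?b p m n"
    if "m \<in> carr M" "n \<in> carr N" "p \<in> carr P"
    for m n p
    unfolding E using k2[OF that] mem3[OF that] by simp
  show "fn (Assoc LC M N P) t \<in> TS M (TM N P)" if t: "t \<in> TS (TM M N) P"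
  proof (rule lin_memI[OF G lin subspace_TS[OF M NP] _ t])
    fix s assume "s \<in> proj (TM M N) P ` ?G"
    then obtain m n p where *: "m \<in> carr M" "n \<in> carr N" "p \<in> carr P" "s = proj (TM M N) P (proj M N (m \<otimes> n) \<otimes> p)"
      unfolding wvecs_def using wspace_carr by blast
    show "fn (Assoc LC M N P) s \<in> TS M (TM N P)"
      unfolding *(4) pr[OF *(1-3)]
      by (rule proj_memI[of _ M _ "TM N P", unfolded carr_TM, OF *(1) proj_memI[OF *(2,3)]])
  qed
qed

end


section \<open>Graded vector spaces\<close>

lemma
  assumes V: "V \<in> graded_obj H"
  shows graded_subspace: "fs.subspace (V h)"
    and graded_outside: "h \<notin> H \<Longrightarrow> V h = {0}"
    and graded_finite: "\<exists>S. finite S \<and> fs.span S = tot V"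
    and graded_direct: "finite S \<Longrightarrow> \<forall>h\<in>S. f h \<in> V h \<Longrightarrow> (\<Sum>h\<in>S. f h) = 0 \<Longrightarrow> h \<in> S \<Longrightarrow> f h = 0"
proof -
  note * = V[unfolded graded_obj_def mem_Collect_eq]
  show "fs.subspace (V h)" by (rule spec[OF conjunct1[OF *]])
  show "h \<notin> H \<Longrightarrow> V h = {0}" by (rule mp[OF spec[OF conjunct1[OF conjunct2[OF *]]]])
  show "\<exists>S. finite S \<and> fs.span S = tot V" by (rule conjunct2[OF conjunct2[OF conjunct2[OF *]]])
  have "\<forall>h\<in>S. f h = 0" if "finite S" "\<forall>h\<in>S. f h \<in> V h" "(\<Sum>h\<in>S. f h) = 0"
    by (rule mp[OF spec[OF spec[OF conjunct1[OF conjunct2[OF conjunct2[OF *]]], of S], of f]]) (intro conjI that)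
  then show "finite S \<Longrightarrow> \<forall>h\<in>S. f h \<in> V h \<Longrightarrow> (\<Sum>h\<in>S. f h) = 0 \<Longrightarrow> h \<in> S \<Longrightarrow> f h = 0"
    by (rule bspec)
qed

text \<open>Linear maps out of a graded space and out of tensor products are defined on such bases.\<close>

definition homogeneous_basis :: "'h set \<Rightarrow> ('h, 'b) graded \<Rightarrow> ('h, 'b) vec set \<Rightarrow> (('h, 'b) vec \<Rightarrow> 'h) \<Rightarrow> bool" where
  "homogeneous_basis H V B d \<longleftrightarrow> finite B \<and> fs.independent B \<and> d ` B \<subseteq> H \<and> (\<forall>h. V h = fs.span {b \<in> B. d b = h})"

lemma homogeneous_basis_tot:
  assumes "homogeneous_basis H V B d" shows "tot V = fs.span B"
proof -
  have V: "V h = fs.span {b \<in> B. d b = h}" for h using assms by (simp add: homogeneous_basis_def)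
  have "V h \<subseteq> fs.span B" for h unfolding V by (rule fs.span_mono) blast
  then have "fs.span (\<Union>h. V h) \<subseteq> fs.span B" by (intro fs.span_minimal UN_least) simp_all
  moreover have "B \<subseteq> (\<Union>h. V h)"
  proof
    fix b assume "b \<in> B"
    then have "b \<in> V (d b)" unfolding V by (intro fs.span_base) simp
    then show "b \<in> (\<Union>h. V h)" by blast
  qed
  then have "fs.span B \<subseteq> fs.span (\<Union>h. V h)" by (rule fs.span_mono)
  ultimately show ?thesis unfolding tot_def by blast
qed

lemma homogeneous_basis_graded_obj:
  assumes hb: "homogeneous_basis H V B d" shows "V \<in> graded_obj H"
proof -
  have B: "finite B" "fs.independent B" "d ` B \<subseteq> H" and V: "\<And>h. V h = fs.span {b \<in> B. d b = h}"
    using hb by (simp_all add: homogeneous_basis_def)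
  have "f h = 0" if S: "finite S" and f: "\<forall>h\<in>S. f h \<in> V h" and 0: "(\<Sum>h\<in>S. f h) = 0" and h: "h \<in> S" for S f h
  proof -
    have "\<forall>h\<in>S. \<exists>u. f h = (\<Sum>b\<in>{b \<in> B. d b = h}. fscale (u b) b)"
    proof
      fix h assume "h \<in> S"
      then have "f h \<in> fs.span {b \<in> B. d b = h}" using f V by blast
      then show "\<exists>u. f h = (\<Sum>b\<in>{b \<in> B. d b = h}. fscale (u b) b)"
        using B(1) by (subst (asm) fs.span_finite) auto
    qed
    from bchoice[OF this] obtain u where u: "\<And>h. h \<in> S \<Longrightarrow> f h = (\<Sum>b\<in>{b \<in> B. d b = h}. fscale (u h b) b)"
      by blast
    let ?T = "{b \<in> B. d b \<in> S}"
    \<comment> \<open>The homogeneous parts are expanded in their own basis vectors and reassembled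
      into one relation among all of \<open>B\<close>.\<close>
    have "(\<Sum>b\<in>?T. fscale (u (d b) b) b) = (\<Sum>h\<in>S. \<Sum>b\<in>{b \<in> ?T. d b = h}. fscale (u (d b) b) b)"
      by (rule sum.group[symmetric]) (use B(1) S in auto)
    also have "\<dots> = (\<Sum>h\<in>S. f h)"
      by (rule sum.cong[OF refl], subst u) (auto intro!: sum.cong)
    finally have z: "(\<Sum>b\<in>?T. fscale (u (d b) b) b) = 0" using 0 by simp
    have "u (d b) b = 0" if "b \<in> ?T" for b
      using independent_zeroD[of B ?T "\<lambda>b. u (d b) b" b] B(1,2) z that by auto
    with u[OF h] h show "f h = 0" by (auto intro!: sum.neutral)
  qed
  moreover have "V h = {0}" if "h \<notin> H" for h
  proof -
    have "{b \<in> B. d b = h} = {}" using B(3) that by blast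
    then show ?thesis unfolding V by (simp only: fs.span_empty)
  qed
  ultimately show ?thesis
    unfolding graded_obj_def using B(1) homogeneous_basis_tot[OF hb] V by auto
qed

text \<open>Bases of the components are disjoint, and their union is independent, because the sum of
  components is direct; a finite spanning set of the total space bounds its size. Degrees lie in
  \<open>H\<close> since components outside it contain no nonzero vector.\<close>

lemma homogeneous_basis_exists:
  assumes V: "V \<in> graded_obj H" obtains B d where "homogeneous_basis H V B d"
proof -
  have "\<forall>h. \<exists>B. fs.independent B \<and> fs.span B = V h"
  proof
    fix h
    obtain B where "fs.independent B" "fs.span B = V h" using graded_subspace[OF V] by (rule subspace_basis)
    then show "\<exists>B. fs.independent B \<and> fs.span B = V h" by blast
  qed
  from choice[OF this] obtain \<beta> where \<beta>: "\<And>h. fs.independent (\<beta> h)" "\<And>h. fs.span (\<beta> h) = V h" by blast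
  have nz: "b \<noteq> 0" if "b \<in> \<beta> h" for b h using \<beta>(1)[of h] fs.dependent_zero that by blast
  have \<beta>V: "b \<in> V h" if "b \<in> \<beta> h" for b h using \<beta>(2) that fs.span_base by blast
  have unique: "h = k" if b: "b \<in> \<beta> h" "b \<in> \<beta> k" for b h k
  proof (rule ccontr)
    assume "h \<noteq> k"
    \<comment> \<open>The family with \<open>b\<close> in degree \<open>h\<close> and
      \<open>- b\<close> in degree \<open>k\<close> sums to zero; the conditional is its value at
      \<open>h\<close>, kept in the form in which \<open>graded_direct\<close> produces it.\<close>
    then have "(if h = h then b else - b) = 0"
      by (intro graded_direct[OF V, of "{h, k}" "\<lambda>i. if i = h then b else - b" h])
        (use b \<beta>V fs.subspace_neg[OF graded_subspace[OF V]] in auto)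
    with nz[OF b(1)] show False by simp
  qed
  define B where "B = (\<Union>h. \<beta> h)"
  define d where "d b = (SOME h. b \<in> \<beta> h)" for b
  have d: "b \<in> \<beta> (d b)" if "b \<in> B" for b
    using that someI_ex[of "\<lambda>h. b \<in> \<beta> h"] by (auto simp: B_def d_def)
  have fib: "{b \<in> B. d b = h} = \<beta> h" for h
    using d unique by (auto simp: B_def)
  have ind: "fs.independent B"
    unfolding fs.independent_explicit_module
  proof (intro allI impI)
    fix t u v assume t: "finite t" "t \<subseteq> B" and 0: "(\<Sum>v\<in>t. fscale (u v) v) = 0" and v: "v \<in> t"
    define f where "f h = (\<Sum>x\<in>{x \<in> t. d x = h}. fscale (u x) x)" for h
    have "f h \<in> V h" for h
      unfolding f_def
    proof (rule fs.subspace_sum[OF graded_subspace[OF V]])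
      fix x assume "x \<in> {x \<in> t. d x = h}"
      then have "x \<in> V h" using d[of x] \<beta>V[of x h] t(2) by auto
      then show "fscale (u x) x \<in> V h" by (rule fs.subspace_scale[OF graded_subspace[OF V]])
    qed
    moreover have "(\<Sum>h\<in>d ` t. f h) = 0"
    proof -
      have "(\<Sum>h\<in>d ` t. f h) = (\<Sum>x\<in>t. fscale (u x) x)"
        unfolding f_def by (rule sum.group[OF t(1) finite_imageI[OF t(1)] subset_refl])
      then show ?thesis using 0 by simp
    qed
    ultimately have "f (d v) = 0"
      by (intro graded_direct[where f = f and h = "d v", OF V finite_imageI[OF t(1)]]) (use imageI[OF v, of d] in simp_all)
    then show "u v = 0"
      unfolding f_def
    proof (rule independent_zeroD[OF \<beta>(1)[of "d v"], rotated 2])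
      show "{x \<in> t. d x = d v} \<subseteq> \<beta> (d v)"
      proof
        fix x assume "x \<in> {x \<in> t. d x = d v}"
        then show "x \<in> \<beta> (d v)" using d[of x] t(2) by auto
      qed
    qed (use t v in auto)
  qed
  have hb: "tot V = fs.span B"
  proof -
    have "V h \<subseteq> fs.span B" for h
      unfolding \<beta>(2)[symmetric] by (rule fs.span_mono) (auto simp: B_def)
    then have "tot V \<subseteq> fs.span B" unfolding tot_def by (intro fs.span_minimal) auto
    moreover have "fs.span B \<subseteq> tot V"
      unfolding tot_def by (rule fs.span_mono) (use \<beta>V in \<open>auto simp: B_def\<close>)
    ultimately show ?thesis by blast
  qed
  obtain S where S: "finite S" "fs.span S = tot V" using graded_finite[OF V] by blast
  have "finite B"
    using fs.independent_span_bound[OF S(1) ind] S(2) hb fs.span_superset by blast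
  moreover have "d b \<in> H" if "b \<in> B" for b
    using graded_outside[OF V, of "d b"] \<beta>V[OF d[OF that]] nz[OF d[OF that]] by blast
  ultimately have "homogeneous_basis H V B d"
    unfolding homogeneous_basis_def using ind fib \<beta>(2) by auto
  then show thesis by (rule that)
qed

text \<open>Each vector of a homogeneous basis has a single degree, so the maps on the components
  never compete for a value.\<close>

lemma graded_lift_ex:
  assumes V: "V \<in> graded_obj H" and g: "\<And>h. linear_on (V h) (g h)"
  shows "\<exists>f. linear_on (tot V) f \<and> (\<forall>h. \<forall>v\<in>V h. f v = g h v)"
proof -
  obtain B d where hb: "homogeneous_basis H V B d" using homogeneous_basis_exists[OF V] .
  then have B: "fs.independent B" and VB: "\<And>h. V h = fs.span {b \<in> B. d b = h}"
    by (simp_all add: homogeneous_basis_def)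
  obtain f where f: "Vector_Spaces.linear fscale fscale f" "\<forall>b\<in>B. f b = g (d b) b"
    using linear_extend_basis[OF B, of "\<lambda>b. g (d b) b"] by blast
  have "f v = g h v" if v: "v \<in> V h" for h v
    by (rule lin_eqI[OF VB linear_imp_linear_on[OF f(1)] g _ v])
      (use f(2) in auto)
  with linear_imp_linear_on[OF f(1)] show ?thesis by blast
qed

lemma subspace_tot [simp]: "fs.subspace (tot V)"
  by (simp add: tot_def)

lemma totI: "v \<in> V h \<Longrightarrow> v \<in> tot V"
  unfolding tot_def by (rule fs.span_base) blast

lemma tot_span:
  assumes V: "V \<in> graded_obj H" shows "tot V = fs.span (\<Union>h\<in>H. V h)"
proof
  have "V h \<subseteq> fs.span (\<Union>h\<in>H. V h)" for h
  proof (cases "h \<in> H")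
    case True
    then have "V h \<subseteq> (\<Union>h\<in>H. V h)" by blast
    then show ?thesis using fs.span_superset by blast
  next
    case False
    then show ?thesis using graded_outside[OF V] fs.span_zero by auto
  qed
  then show "tot V \<subseteq> fs.span (\<Union>h\<in>H. V h)" unfolding tot_def by (intro fs.span_minimal) auto
  show "fs.span (\<Union>h\<in>H. V h) \<subseteq> tot V" unfolding tot_def by (rule fs.span_mono) blast
qed

text \<open>Products of homogeneous basis vectors are independent and each has a degree, the sum of
  the degrees of its factors. Directness and finiteness of the tensor grading then come from
  \<open>homogeneous_basis_graded_obj\<close>.\<close>

lemma homogeneous_basis_tensor:
  fixes V U :: "('h::ab_group_add, 'b) graded"
  assumes V: "homogeneous_basis H V B d" and U: "homogeneous_basis H U C e"
    and H: "\<And>x y. x \<in> H \<Longrightarrow> y \<in> H \<Longrightarrow> x + y \<in> H"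
  shows "\<exists>D. homogeneous_basis H (graded_tensor V U) ((\<lambda>(b, c). b \<otimes> c) ` (B \<times> C)) D"
proof -
  let ?i = "\<lambda>(b, c). b \<otimes> c :: ('h, 'b) vec"
  have B: "finite B" "fs.independent B" "d ` B \<subseteq> H" "\<And>h. V h = fs.span {b \<in> B. d b = h}"
    and C: "finite C" "fs.independent C" "e ` C \<subseteq> H" "\<And>h. U h = fs.span {c \<in> C. e c = h}"
    using V U by (simp_all add: homogeneous_basis_def)
  define D where "D x = (case the_inv_into (B \<times> C) ?i x of (b, c) \<Rightarrow> d b + e c)" for x
  have D: "D (b \<otimes> c) = d b + e c" if "b \<in> B" "c \<in> C" for b c
    using the_inv_into_f_f[OF inj_on_otimes[OF B(2) C(2)], of "(b, c)"] that by (simp add: D_def)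
  have "graded_tensor V U h = fs.span {x \<in> ?i ` (B \<times> C). D x = h}" for h
  proof
    show "graded_tensor V U h \<subseteq> fs.span {x \<in> ?i ` (B \<times> C). D x = h}"
      unfolding graded_tensor_def
    proof (rule fs.span_minimal)
      have "tensor (V f) (U g) \<subseteq> fs.span {x \<in> ?i ` (B \<times> C). D x = h}" if "f + g = h" for f g
        unfolding B(4) C(4) tensor_span
        by (rule fs.span_mono) (use D that in \<open>force\<close>)
      then show "\<Union> {tensor (V f) (U g) |f g. f + g = h} \<subseteq> fs.span {x \<in> ?i ` (B \<times> C). D x = h}" by blast
    qed simp
    show "fs.span {x \<in> ?i ` (B \<times> C). D x = h} \<subseteq> graded_tensor V U h"
      unfolding graded_tensor_def
    proof (rule fs.span_mono, rule subsetI)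
      fix x assume "x \<in> {x \<in> ?i ` (B \<times> C). D x = h}"
      then obtain b c where *: "b \<in> B" "c \<in> C" "x = b \<otimes> c" "d b + e c = h" using D by auto
      then have "x \<in> tensor (V (d b)) (U (e c))"
        by (auto simp: B(4) C(4) intro!: tensorI fs.span_base)
      with *(4) show "x \<in> \<Union> {tensor (V f) (U g) |f g. f + g = h}" by blast
    qed
  qed
  moreover have "d b + e c \<in> H" if "b \<in> B" "c \<in> C" for b c
    using H[of "d b" "e c"] B(3) C(3) that by blast
  then have "D ` ?i ` (B \<times> C) \<subseteq> H" using D by auto
  ultimately show ?thesis
    using B(1) C(1) independent_otimes[OF B(2) C(2)] by (auto simp: homogeneous_basis_def)
qed

lemma
  fixes V U :: "('h::ab_group_add, 'b) graded"
  assumes V: "V \<in> graded_obj H" and U: "U \<in> graded_obj H"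
    and H: "\<And>x y. x \<in> H \<Longrightarrow> y \<in> H \<Longrightarrow> x + y \<in> H"
  shows graded_tensor_obj: "graded_tensor V U \<in> graded_obj H"
    and tot_graded_tensor: "tot (graded_tensor V U) = tensor (tot V) (tot U)"
proof -
  obtain B d where hV: "homogeneous_basis H V B d" using homogeneous_basis_exists[OF V] .
  obtain C e where hU: "homogeneous_basis H U C e" using homogeneous_basis_exists[OF U] .
  obtain D where D: "homogeneous_basis H (graded_tensor V U) ((\<lambda>(b, c). b \<otimes> c) ` (B \<times> C)) D"
    using homogeneous_basis_tensor[OF hV hU H] by blast
  show "graded_tensor V U \<in> graded_obj H" by (rule homogeneous_basis_graded_obj[OF D])
  have "(\<lambda>(b, c). b \<otimes> c) ` (B \<times> C) = pure_tensors B C" by auto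
  then show "tot (graded_tensor V U) = tensor (tot V) (tot U)"
    unfolding homogeneous_basis_tot[OF D] homogeneous_basis_tot[OF hV] homogeneous_basis_tot[OF hU] tensor_span
    by simp
qed

lemma otimes_graded_tensor: "v \<in> V f \<Longrightarrow> u \<in> U g \<Longrightarrow> v \<otimes> u \<in> graded_tensor V U (f + g)"
  unfolding graded_tensor_def by (rule fs.span_base) (use tensorI in blast)

lemma
  fixes x :: "'h::ab_group_add"
  shows graded_line_same: "(graded_line x :: ('h, 'b) graded) x = fs.span {ee x}"
    and tot_graded_line: "tot (graded_line x :: ('h, 'b) graded) = fs.span {ee x}"
    and graded_line_obj: "x \<in> H \<Longrightarrow> (graded_line x :: ('h, 'b) graded) \<in> graded_obj H"
proof -
  let ?V = "graded_line x :: ('h, 'b) graded"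
  have line: "{u. \<forall>i. i \<noteq> Pt x \<longrightarrow> u i = 0} = fs.span {ee x :: ('h, 'b) vec}"
  proof -
    have "u \<in> range (\<lambda>k. fscale k (ee x))" if "\<forall>i. i \<noteq> Pt x \<longrightarrow> u i = 0" for u :: "('h, 'b) vec"
      by (rule image_eqI[of _ _ "u (Pt x)"]) (use that in \<open>auto intro!: vec_eqI simp: fscale_apply\<close>)
    then show ?thesis unfolding fs.span_singleton by (auto simp: fscale_apply ee_def)
  qed
  show same: "?V x = fs.span {ee x}" by (simp add: graded_line_def line)
  have hb: "homogeneous_basis H ?V {ee x} (\<lambda>_. x)" if "x \<in> H" for H
  proof -
    have "(ee x :: ('h, 'b) vec) \<noteq> 0" using ee_apply(1)[of x x] by (metis zero_fun_apply zero_neq_one)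
    then show ?thesis
      using that by (auto simp: homogeneous_basis_def graded_line_def line)
  qed
  show "tot ?V = fs.span {ee x}" using homogeneous_basis_tot[OF hb[of UNIV]] by simp
  show "?V \<in> graded_obj H" if "x \<in> H" using homogeneous_basis_graded_obj[OF hb[OF that]] .
qed

text \<open>With \<open>s h = form h z\<close> this is the action of \<open>z\<close> on a graded
  space whose degrees are read as weights.\<close>

definition gscale :: "('h, 'b) graded \<Rightarrow> ('h \<Rightarrow> complex) \<Rightarrow> ('h, 'b) vec \<Rightarrow> ('h, 'b) vec" where
  "gscale V s = the_linear (tot V) (\<lambda>f. \<forall>h. \<forall>v\<in>V h. f v = fscale (s h) v)"

lemma
  assumes V: "V \<in> graded_obj H"
  shows lin_gscale: "linear_on (tot V) (gscale V s)"
    and gscale_homogeneous: "v \<in> V h \<Longrightarrow> gscale V s v = fscale (s h) v"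
proof -
  obtain f where f: "linear_on (tot V) f" "\<forall>h. \<forall>v\<in>V h. f v = fscale (s h) v"
    using graded_lift_ex[OF V, of "\<lambda>h v. fscale (s h) v"] lin_fscale[OF lin_id(2)] by blast
  let ?P = "\<lambda>f. \<forall>h. \<forall>v\<in>V h. f v = fscale (s h) v"
  have E: "gscale V s = restrict f (tot V)"
    unfolding gscale_def
  proof (rule the_linear_eq[where P = ?P, OF f(1) _ tot_def])
    show "?P (restrict f (tot V))" using f(2) totI[of _ V] by simp
    show "k v = f v" if "?P k" "v \<in> (\<Union>h. V h)" for k v using that f(2) by auto
  qed
  show "linear_on (tot V) (gscale V s)" unfolding E by (rule lin_restrict[OF f(1)]) simp
  show "v \<in> V h \<Longrightarrow> gscale V s v = fscale (s h) v" unfolding E using f(2) totI[of _ V] by simp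
qed

lemma
  assumes "f \<in> graded_hom V W"
  shows graded_hom_src: "src f = V" and graded_hom_tgt: "tgt f = W"
    and graded_hom_lin: "linear_on (tot V) (fn f)" and graded_hom_deg: "v \<in> V h \<Longrightarrow> fn f v \<in> W h"
  using assms unfolding graded_hom_def by blast+

lemma graded_hom_tot:
  assumes f: "f \<in> graded_hom V W" and v: "v \<in> tot V" shows "fn f v \<in> tot W"
  by (rule lin_memI[OF tot_def graded_hom_lin[OF f] subspace_tot _ v])
    (use graded_hom_deg[OF f] totI[of _ W] in blast)

context lattice_setting
begin

subsection \<open>The free module functor\<close>

text \<open>The Leibniz rule is written out because \<open>V\<close> is a bare graded space and not
  a module record, to which \<open>tensor_act\<close> would apply.\<close>

definition Fo :: "('h, 'b) graded \<Rightarrow> ('h, 'b) amod" where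
  "Fo V = \<lparr>carr = tensor (carr AA) (tot V),
     act = (\<lambda>z t. tmap (carr AA) (tot V) (act AA z) id t + tmap (carr AA) (tot V) id (gscale V (\<lambda>h. form h z)) t),
     nu = (\<lambda>t. tmap (tensor (carr AA) (carr AA)) (tot V) (nu AA) id (unreassoc t))\<rparr>"

definition Fgen :: "('h, 'b) graded \<Rightarrow> ('h, 'b) vec set" where
  "Fgen V = {ee x \<otimes> v |x v. x \<in> l \<and> v \<in> (\<Union>h\<in>L. V h)}"

lemma carr_Fo: "carr (Fo V) = tensor (carr AA) (tot V)"
  by (simp add: Fo_def)

lemma Fo_memI: "x \<in> l \<Longrightarrow> v \<in> tot V \<Longrightarrow> ee x \<otimes> v \<in> carr (Fo V)"
  unfolding carr_Fo by (intro tensorI ee_in_AA)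

context
  fixes V :: "('h, 'b) graded" assumes V: "V \<in> graded_obj L"
begin

lemma carr_Fo_span: "carr (Fo V) = fs.span (Fgen V)"
proof -
  have "Fgen V = pure_tensors (ee ` l) (\<Union>h\<in>L. V h)" unfolding Fgen_def by blast
  then show ?thesis unfolding carr_Fo carr_AA tot_span[OF V] tensor_span by simp
qed

lemma lin_act_Fo: "linear_on (carr (Fo V)) (act (Fo V) z)"
  unfolding Fo_def amod.simps hmod.simps
  by (intro lin_plus lin_tmap lin_act_AA lin_gscale[OF V] lin_id subspace_AA subspace_tot)

lemma act_Fo:
  assumes x: "x \<in> l" and v: "v \<in> V h"
  shows "act (Fo V) z (ee x \<otimes> v) = fscale (form (x + h) z) (ee x \<otimes> v)"
  using tmap_otimes[OF subspace_AA subspace_tot lin_act_AA lin_id(1) ee_in_AA[OF x] totI[of v V, OF v], of z]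
    tmap_otimes[OF subspace_AA subspace_tot lin_id(1) lin_gscale[OF V] ee_in_AA[OF x] totI[of v V, OF v],
      of "\<lambda>h. form h z"]
  by (simp add: Fo_def act_AA[OF x] gscale_homogeneous[OF V v] otimes_simps form_add_left fs.scale_left_distrib)

lemma Fo_wspace: "x \<in> l \<Longrightarrow> v \<in> V h \<Longrightarrow> ee x \<otimes> v \<in> wspace (Fo V) (x + h)"
  by (simp add: wspace_def act_Fo Fo_memI totI[of v V])

lemma lin_nu_Fo: "linear_on (tensor (carr AA) (carr (Fo V))) (nu (Fo V))"
  unfolding Fo_def amod.simps hmod.simps
  by (rule lin_compose[OF lin_unreassoc lin_tmap[OF subspace_tensor subspace_tot lin_nu_AA lin_id(1)]
        unreassoc_mem])

lemma lact_Fo: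
  assumes x: "x \<in> l" and y: "y \<in> l" and v: "v \<in> tot V"
  shows "lact (Fo V) x (ee y \<otimes> v) = fscale (\<alpha> x y) (ee (x + y) \<otimes> v)"
  unfolding Fo_def amod.simps hmod.simps unreassoc_otimes
    tmap_otimes[OF subspace_tensor subspace_tot lin_nu_AA lin_id(1) tensorI[OF ee_in_AA[OF x] ee_in_AA[OF y]] v]
    nu_AA[OF x y] otimes_scale_left id_apply ..

lemma wmod_Fo: "wmod (Fo V)"
proof (rule wmodI[OF carr_Fo_span lin_act_Fo lin_nu_Fo])
  fix g assume "g \<in> Fgen V"
  then obtain y v h where y: "y \<in> l" "h \<in> L" "v \<in> V h" "g = ee y \<otimes> v" unfolding Fgen_def by blast
  note v = totI[of v V, OF y(3)]
  show L0: "lact (Fo V) 0 g = g"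
    unfolding y(4) lact_Fo[OF l_zero y(1) v] alpha_zero(2)[OF y(1)] by simp
  have W: "weighted (Fo V)"
  proof (rule weightedI[OF carr_Fo_span lin_act_Fo], rule subsetI)
    fix g assume "g \<in> Fgen V"
    then obtain y v h where y: "y \<in> l" "h \<in> L" "v \<in> V h" "g = ee y \<otimes> v" unfolding Fgen_def by blast
    then show "g \<in> wvecs (Fo V)" unfolding wvecs_def using Fo_wspace[OF y(1,3)] L_add[OF l_in_L[OF y(1)] y(2)] by blast
  qed
  show "\<exists>\<mu>\<in>L. g \<in> wspace (Fo V) \<mu> \<and> (\<forall>x\<in>l. lact (Fo V) x g \<in> wspace (Fo V) (x + \<mu>))"
  proof (intro bexI conjI ballI)
    show "y + h \<in> L" by (rule L_add[OF l_in_L[OF y(1)] y(2)])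
    show "g \<in> wspace (Fo V) (y + h)" unfolding y(4) by (rule Fo_wspace[OF y(1,3)])
    show "lact (Fo V) x g \<in> wspace (Fo V) (x + (y + h))" if x: "x \<in> l" for x
      unfolding y(4) lact_Fo[OF x y(1) v] add.assoc[symmetric]
      by (rule wspace_scale[OF W Fo_wspace[OF l_add[OF x y(1)] y(3)]])
  qed
  show "lact (Fo V) x (lact (Fo V) z g) = fscale (\<alpha> x z) (lact (Fo V) (x + z) g)" if x: "x \<in> l" and z: "z \<in> l" for x z
    unfolding y(4) lact_Fo[OF z y(1) v] lact_Fo[OF l_add[OF x z] y(1) v] otimes_scale_right
      lin_scale[OF lin_nu_Fo tensorI[OF ee_in_AA[OF x] Fo_memI[OF l_add[OF z y(1)] v]]]
      lact_Fo[OF x l_add[OF z y(1)] v]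
    using alpha_cocycle[OF x z y(1)] by (simp add: add.assoc)
qed

text \<open>The braiding costs \<open>q (x + h) y\<close> and left multiplication gives
  \<open>\<alpha> y x\<close>; the factor \<open>q x y\<close> turns the latter into
  \<open>\<alpha> x y\<close>, and only the degree of \<open>v\<close> remains visible.\<close>

lemma ract_Fo:
  assumes x: "x \<in> l" and y: "y \<in> l" and v: "v \<in> V h"
  shows "ract (Fo V) ((ee x \<otimes> v) \<otimes> ee y) = fscale (q h y * \<alpha> x y) (ee (x + y) \<otimes> v)"
  unfolding ract_wspace[OF wmod_Fo Fo_wspace[OF x v] y] lact_Fo[OF y x totI[of v V, OF v]] add.commute[of y x]
  using alpha_swap[OF x y] by (simp add: q_add_left mult_ac)

end

definition Fa :: "(('h, 'b) graded, ('h, 'b) vec \<Rightarrow> ('h, 'b) vec) arrow \<Rightarrow>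
    (('h, 'b) amod, ('h, 'b) vec \<Rightarrow> ('h, 'b) vec) arrow" where
  "Fa f = \<lparr>src = Fo (src f), tgt = Fo (tgt f), fn = tmap (carr AA) (tot (src f)) id (fn f)\<rparr>"

lemma Fa_simps [simp]: "src (Fa f) = Fo (src f)" "tgt (Fa f) = Fo (tgt f)"
  by (simp_all add: Fa_def)

lemma
  assumes f: "linear_on (tot (src f)) (fn f)"
  shows lin_Fa: "linear_on (carr (Fo (src f))) (fn (Fa f))"
    and Fa_ext: "fn (Fa f) \<in> extensional (carr (Fo (src f)))"
    and Fa_otimes: "a \<in> carr AA \<Longrightarrow> v \<in> tot (src f) \<Longrightarrow> fn (Fa f) (a \<otimes> v) = a \<otimes> fn f v"
proof -
  note * = subspace_AA subspace_tot lin_id(1) f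
  show "linear_on (carr (Fo (src f))) (fn (Fa f))" "fn (Fa f) \<in> extensional (carr (Fo (src f)))"
    unfolding Fa_def arrow.simps carr_Fo using lin_tmap[OF *] extensional_tmap[OF *] by blast+
  show "fn (Fa f) (a \<otimes> v) = a \<otimes> fn f v" if "a \<in> carr AA" "v \<in> tot (src f)"
    unfolding Fa_def arrow.simps tmap_otimes[OF * that] by simp
qed

lemma Fa_lhom:
  assumes V: "V \<in> graded_obj L" and W: "W \<in> graded_obj L" and f: "f \<in> graded_hom V W"
  shows "Fa f \<in> lhom (Fo V) (Fo W)"
proof (rule lhomI[OF wmod_Fo[OF V] wmod_Fo[OF W] carr_Fo_span[OF V]])
  note lin = graded_hom_lin[OF f, folded graded_hom_src[OF f]]
  note F = Fa_otimes[OF lin, unfolded graded_hom_src[OF f]]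
  show "src (Fa f) = Fo V" "tgt (Fa f) = Fo W" by (simp_all add: graded_hom_src[OF f] graded_hom_tgt[OF f])
  show "fn (Fa f) \<in> extensional (carr (Fo V))" "linear_on (carr (Fo V)) (fn (Fa f))"
    using Fa_ext[OF lin] lin_Fa[OF lin] by (simp_all add: graded_hom_src[OF f])
  fix g assume "g \<in> Fgen V"
  then obtain y v h where y: "y \<in> l" "h \<in> L" "v \<in> V h" "g = ee y \<otimes> v" unfolding Fgen_def by blast
  note v = totI[of v V, OF y(3)]
  have Fg: "fn (Fa f) g = ee y \<otimes> fn f v" unfolding y(4) by (rule F[OF ee_in_AA[OF y(1)] v])
  show "\<exists>\<mu>. g \<in> wspace (Fo V) \<mu> \<and> fn (Fa f) g \<in> wspace (Fo W) \<mu>"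
    unfolding Fg unfolding y(4) using Fo_wspace[OF V y(1,3)] Fo_wspace[OF W y(1) graded_hom_deg[OF f y(3)]] by blast
  show "fn (Fa f) (lact (Fo V) x g) = lact (Fo W) x (fn (Fa f) g)" if x: "x \<in> l" for x
    unfolding Fg unfolding y(4) lact_Fo[OF V x y(1) v] lact_Fo[OF W x y(1) graded_hom_tot[OF f v]]
    using F[OF ee_in_AA[OF l_add[OF x y(1)]] v]
      lin_scale[OF lin_Fa[OF lin, unfolded graded_hom_src[OF f]] Fo_memI[OF l_add[OF x y(1)] v]]
    by simp
qed

lemma arrow_eqI: "src f = src g \<Longrightarrow> tgt f = tgt g \<Longrightarrow> fn f = fn g \<Longrightarrow> f = g"
  for f g :: "('o, 'f) arrow"
  by simp

text \<open>A linear inverse suffices: its compatibility with both actions is inherited from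
  \<open>f\<close>. Restricting it to the carrier meets the extensionality demanded of
  morphisms.\<close>

lemma LC_isoI:
  assumes M: "wmod M" and f: "f \<in> lhom M N"
    and lin: "fs.subspace (carr N)" "linear_on (carr N) g" and mem: "\<And>t. t \<in> carr N \<Longrightarrow> g t \<in> carr M"
    and gf: "\<And>t. t \<in> carr M \<Longrightarrow> g (fn f t) = t" and fg: "\<And>t. t \<in> carr N \<Longrightarrow> fn f (g t) = t"
  shows "is_iso LC M N f"
proof -
  define k where "k = \<lparr>src = N, tgt = M, fn = restrict g (carr N)\<rparr>"
  have eq: "fn k (fn f t) = t" if "t \<in> carr M" for t by (simp add: k_def lhom_mem[OF f that] gf[OF that])
  have act: "fn k (act N z n) = act M z (fn k n)" if n: "n \<in> carr N" for z n
    using eq[OF weighted_act_mem[OF wmod_wt[OF M] mem[OF n]], of z] lhom_act[OF f mem[OF n], of z] fg[OF n] n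
    by (simp add: k_def)
  have nu: "fn k (nu N (a \<otimes> n)) = nu M (a \<otimes> fn k n)" if a: "a \<in> carr AA" and n: "n \<in> carr N" for a n
    using eq[OF nu_mem[OF M tensorI[OF a mem[OF n]]]] lhom_nu[OF f a mem[OF n]] fg[OF n] n
    by (simp add: k_def)
  have k: "k \<in> lhom N M"
    unfolding local_hom_def using act nu mem lin_restrict[OF lin(2,1)] by (auto simp: k_def)
  have "compose (carr M) (fn k) (fn f) = restrict id (carr M)"
    by (rule ext) (simp add: compose_def eq restrict_def)
  moreover have "compose (carr N) (fn f) (fn k) = restrict id (carr N)"
    by (rule ext) (simp add: compose_def fg restrict_def k_def)
  ultimately show ?thesis
    unfolding is_iso_def using f k
    by (auto simp: lhom_src[OF f] lhom_tgt[OF f] lhom_src[OF k] lhom_tgt[OF k] intro!: bexI[of _ k])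
qed

section \<open>The monoidal constraint of the free module functor\<close>

definition phi_map :: "('h, 'b) graded \<Rightarrow> ('h, 'b) graded \<Rightarrow> ('h, 'b) vec \<Rightarrow> ('h, 'b) vec" where
  "phi_map V U t = reassoc (tmap (tensor (carr (Fo V)) (carr AA)) (tot U) (ract (Fo V)) id (unreassoc t))"

definition phi :: "('h, 'b) graded \<Rightarrow> ('h, 'b) graded \<Rightarrow>
    (('h, 'b) amod, ('h, 'b) vec \<Rightarrow> ('h, 'b) vec) arrow" where
  "phi V U = \<lparr>src = TM (Fo V) (Fo U), tgt = Fo (graded_tensor V U),
     fn = desc (Fo V) (Fo U) (phi_map V U)\<rparr>"

text \<open>The inverse of \<open>phi\<close> inserts the unit of \<open>A\<close>.\<close>

definition psi :: "('h, 'b) graded \<Rightarrow> ('h, 'b) graded \<Rightarrow> ('h, 'b) vec \<Rightarrow> ('h, 'b) vec" where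
  "psi V U t = proj (Fo V) (Fo U) (tmap (carr (Fo V)) (tot U) id (\<lambda>u. ee 0 \<otimes> u) (unreassoc t))"

lemma phi_simps [simp]: "src (phi V U) = TM (Fo V) (Fo U)" "tgt (phi V U) = Fo (graded_tensor V U)"
  by (simp_all add: phi_def)

context
  fixes V U :: "('h, 'b) graded"
  assumes V: "V \<in> graded_obj L" and U: "U \<in> graded_obj L"
begin

private lemma FV: "wmod (Fo V)" and FU: "wmod (Fo U)"
  by (rule wmod_Fo[OF V], rule wmod_Fo[OF U])

lemma gtensor_L: "graded_tensor V U \<in> graded_obj L" and tot_gtensor: "tot (graded_tensor V U) = tensor (tot V) (tot U)"
  by (rule graded_tensor_obj[OF V U L_add] tot_graded_tensor[OF V U L_add], assumption+)+

lemma carr_gtensor: "carr (Fo (graded_tensor V U)) = tensor (carr AA) (tensor (tot V) (tot U))"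
  unfolding carr_Fo tot_gtensor ..

lemma carr_gtensor_span: "carr (Fo (graded_tensor V U)) =
    fs.span {ee x \<otimes> (v \<otimes> u) |x v u. x \<in> l \<and> v \<in> (\<Union>h\<in>L. V h) \<and> u \<in> (\<Union>h\<in>L. U h)}"
proof -
  have "{ee x \<otimes> (v \<otimes> u) |x v u. x \<in> l \<and> v \<in> (\<Union>h\<in>L. V h) \<and> u \<in> (\<Union>h\<in>L. U h)}
    = pure_tensors (ee ` l) (pure_tensors (\<Union>h\<in>L. V h) (\<Union>h\<in>L. U h))" by blast
  then show ?thesis unfolding carr_gtensor carr_AA tot_span[OF V] tot_span[OF U] tensor_span by simp
qed

lemma TS_Fo_span: "TS (Fo V) (Fo U) = fs.span (proj (Fo V) (Fo U) ` pure_tensors (Fgen V) (Fgen U))"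
  by (rule TS_span_gen[OF FV FU carr_Fo_span[OF V] carr_Fo_span[OF U]])

private lemma R: "fs.subspace (tensor (carr (Fo V)) (carr AA))" "fs.subspace (tot U)"
    "linear_on (tensor (carr (Fo V)) (carr AA)) (ract (Fo V))" "linear_on (tot U) id"
  using lin_ract[OF FV] by simp_all

lemma lin_phi_map: "linear_on (tensor (carr (Fo V)) (carr (Fo U))) (phi_map V U)"
  unfolding phi_map_def carr_Fo[of U]
  by (rule lin_compose[OF lin_compose[OF lin_unreassoc lin_tmap[OF R] unreassoc_mem] lin_reassoc UNIV_I])

lemma phi_map_otimes:
  assumes x: "x \<in> l" and y: "y \<in> l" and v: "v \<in> V h" and u: "u \<in> tot U"
  shows "phi_map V U ((ee x \<otimes> v) \<otimes> (ee y \<otimes> u)) = fscale (q h y * \<alpha> x y) (ee (x + y) \<otimes> (v \<otimes> u))"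
  unfolding phi_map_def unreassoc_otimes
    tmap_otimes[OF R tensorI[OF Fo_memI[OF x totI[of v V, OF v]] ee_in_AA[OF y]] u]
    ract_Fo[OF V x y v] otimes_scale_left lin_scale[OF lin_reassoc UNIV_I] id_apply reassoc_otimes ..

lemma balanced_phi_map: "balanced (Fo V) (Fo U) (phi_map V U)"
proof (rule balancedI_span[OF FV FU lin_phi_map carr_Fo_span[OF V] carr_Fo_span[OF U]])
  fix z m n assume z: "z \<in> l" and "m \<in> Fgen V" "n \<in> Fgen U"
  then obtain x h v y g u where *: "x \<in> l" "h \<in> L" "v \<in> V h" "m = ee x \<otimes> v" "y \<in> l" "u \<in> U g" "n = ee y \<otimes> u"
    unfolding Fgen_def by blast
  note v = totI[of v V, OF *(3)] and u = totI[of u U, OF *(6)]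
  note x = *(1) and y = *(5)
  have a: "(ee (z + x) \<otimes> v) \<otimes> (ee y \<otimes> u) \<in> tensor (carr (Fo V)) (carr (Fo U))"
    and b: "(ee x \<otimes> v) \<otimes> (ee (z + y) \<otimes> u) \<in> tensor (carr (Fo V)) (carr (Fo U))"
    by (intro tensorI Fo_memI l_add z x y u v)+
  \<comment> \<open>The factor \<open>q x z\<close> contained in \<open>q (x + h) z\<close> turns
    \<open>\<alpha> z x\<close> into \<open>\<alpha> x z\<close>; the rest is the cocycle identity
    for \<open>x\<close>, \<open>z\<close>, \<open>y\<close>, expressing that acting from the right
    by \<open>ee z\<close> and by \<open>ee y\<close> is associative.\<close>
  have "q (x + h) z * (\<alpha> z x * (q h y * \<alpha> (z + x) y)) = q h z * q h y * (\<alpha> x z * \<alpha> (x + z) y)"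
    using alpha_swap[OF x z] by (simp add: q_add_left add.commute mult_ac)
  also have "\<dots> = \<alpha> z y * (q h (z + y) * \<alpha> x (z + y))"
    unfolding alpha_cocycle[OF x z y] by (simp add: q_add_right mult_ac)
  finally have e: "q (x + h) z * (\<alpha> z x * (q h y * \<alpha> (z + x) y)) = \<alpha> z y * (q h (z + y) * \<alpha> x (z + y))" .
  have s: "z + x + y = x + (z + y)" by (simp add: ac_simps)
  have "fscale (q (x + h) z) (phi_map V U (lact (Fo V) z m \<otimes> n)) = phi_map V U (m \<otimes> lact (Fo U) z n)"
    unfolding *(4,7) lact_Fo[OF V z x v] lact_Fo[OF U z y u] otimes_scale_left otimes_scale_right
      lin_scale[OF lin_phi_map a] lin_scale[OF lin_phi_map b]
      phi_map_otimes[OF l_add[OF z x] y *(3) u] phi_map_otimes[OF x l_add[OF z y] *(3) u] fs.scale_scale e s ..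
  then show "\<exists>\<mu>. m \<in> wspace (Fo V) \<mu> \<and>
      fscale (q \<mu> z) (phi_map V U (lact (Fo V) z m \<otimes> n)) = phi_map V U (m \<otimes> lact (Fo U) z n)"
    using Fo_wspace[OF V x *(3)] *(4) by blast
qed

lemma lin_phi: "linear_on (TS (Fo V) (Fo U)) (fn (phi V U))"
  and phi_ext: "fn (phi V U) \<in> extensional (TS (Fo V) (Fo U))"
  and phi_proj: "t \<in> tensor (carr (Fo V)) (carr (Fo U)) \<Longrightarrow> fn (phi V U) (proj (Fo V) (Fo U) t) = phi_map V U t"
proof -
  note * = FV FU lin_phi_map balanced_phi_map
  show "linear_on (TS (Fo V) (Fo U)) (fn (phi V U))" unfolding phi_def arrow.simps by (rule lin_desc[OF *])
  show "fn (phi V U) \<in> extensional (TS (Fo V) (Fo U))" unfolding phi_def arrow.simps by (rule desc_ext[OF *])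
  show "t \<in> tensor (carr (Fo V)) (carr (Fo U)) \<Longrightarrow> fn (phi V U) (proj (Fo V) (Fo U) t) = phi_map V U t" unfolding phi_def arrow.simps by (rule desc_proj[OF *])
qed

lemma phi_otimes:
  assumes x: "x \<in> l" and y: "y \<in> l" and v: "v \<in> V h" and u: "u \<in> tot U"
  shows "fn (phi V U) (proj (Fo V) (Fo U) ((ee x \<otimes> v) \<otimes> (ee y \<otimes> u)))
    = fscale (q h y * \<alpha> x y) (ee (x + y) \<otimes> (v \<otimes> u))"
  unfolding phi_map_otimes[OF assms, symmetric]
  by (intro phi_proj tensorI Fo_memI x y u totI[of v V, OF v])

lemma gtensor_wspace:
  assumes "x \<in> l" "v \<in> V h" "u \<in> U g"
  shows "ee x \<otimes> (v \<otimes> u) \<in> wspace (Fo (graded_tensor V U)) (x + (h + g))"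
  by (rule Fo_wspace[OF gtensor_L assms(1) otimes_graded_tensor[of v V h u U g, OF assms(2,3)]])

lemma phi_lhom: "phi V U \<in> lhom (TM (Fo V) (Fo U)) (Fo (graded_tensor V U))"
proof (rule lhomI[OF wmod_TM[OF FV FU] wmod_Fo[OF gtensor_L], unfolded carr_TM, OF TS_Fo_span _ _ phi_ext lin_phi])
  fix t assume "t \<in> proj (Fo V) (Fo U) ` pure_tensors (Fgen V) (Fgen U)"
  then obtain x h v y g u where *: "x \<in> l" "v \<in> V h" "y \<in> l" "u \<in> U g"
    "t = proj (Fo V) (Fo U) ((ee x \<otimes> v) \<otimes> (ee y \<otimes> u))"
    unfolding Fgen_def by blast
  note v = totI[of v V, OF *(2)] and u = totI[of u U, OF *(4)]
  note x = *(1) and y = *(3)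
  have s: "(x + h) + (y + g) = x + y + (h + g)" by (simp add: ac_simps)
  have "fn (phi V U) t \<in> wspace (Fo (graded_tensor V U)) ((x + h) + (y + g))"
    unfolding s *(5) phi_otimes[OF x y *(2) u]
    by (rule wspace_scale[OF wmod_wt[OF wmod_Fo[OF gtensor_L]] gtensor_wspace[OF l_add[OF x y] *(2,4)]])
  then show "\<exists>\<mu>. t \<in> wspace (TM (Fo V) (Fo U)) \<mu> \<and> fn (phi V U) t \<in> wspace (Fo (graded_tensor V U)) \<mu>"
    using proj_wspace[OF FV FU Fo_wspace[OF V x *(2)] Fo_wspace[OF U y *(4)]] *(5) by blast
  fix z assume z: "z \<in> l"
  have vu: "v \<otimes> u \<in> tot (graded_tensor V U)" unfolding tot_gtensor by (rule tensorI[OF v u])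
  have a: "(ee (z + x) \<otimes> v) \<otimes> (ee y \<otimes> u) \<in> tensor (carr (Fo V)) (carr (Fo U))"
    by (intro tensorI Fo_memI l_add z x y u v)
  have b: "ee z \<otimes> (ee (x + y) \<otimes> (v \<otimes> u)) \<in> tensor (carr AA) (carr (Fo (graded_tensor V U)))"
    by (intro tensorI Fo_memI l_add z x y vu ee_in_AA)
  \<comment> \<open>Left multiplication by \<open>ee z\<close> commutes with the right action of
    \<open>ee y\<close>: the cocycle identity for \<open>z\<close>, \<open>x\<close>,
    \<open>y\<close>, with \<open>q h y\<close> as a bystander.\<close>
  have "q h y * (\<alpha> z x * \<alpha> (z + x) y) = q h y * (\<alpha> x y * \<alpha> z (x + y))"
    unfolding alpha_cocycle[OF z x y] ..
  then have e: "\<alpha> z x * (q h y * \<alpha> (z + x) y) = q h y * \<alpha> x y * \<alpha> z (x + y)" by (simp add: mult_ac)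
  show "fn (phi V U) (lact (TM (Fo V) (Fo U)) z t) = lact (Fo (graded_tensor V U)) z (fn (phi V U) t)"
    unfolding *(5) lact_TM[OF FV FU z Fo_memI[OF x v] Fo_memI[OF y u]]
      lact_Fo[OF V z x v] otimes_scale_left otimes_scale_right lin_scale[OF lin_proj[OF FV FU] a]
      lin_scale[OF lin_phi proj_mem[OF a]] phi_otimes[OF x y *(2) u] phi_otimes[OF l_add[OF z x] y *(2) u]
      lin_scale[OF wmod_nu[OF wmod_Fo[OF gtensor_L]] b] lact_Fo[OF gtensor_L z l_add[OF x y] vu] fs.scale_scale e add.assoc[of z x y] ..
qed simp_all

private lemma S0: "fs.subspace (carr (Fo V))" "fs.subspace (tot U)"
    "linear_on (carr (Fo V)) id" "linear_on (tot U) (\<lambda>u. ee 0 \<otimes> u)"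
  using weighted_subspace[OF wmod_wt[OF FV]] lin_right by simp_all

lemma lin_psi: "linear_on (carr (Fo (graded_tensor V U))) (psi V U)"
  and psi_mem: "t \<in> carr (Fo (graded_tensor V U)) \<Longrightarrow> psi V U t \<in> TS (Fo V) (Fo U)"
  and psi_otimes: "a \<in> carr AA \<Longrightarrow> v \<in> tot V \<Longrightarrow> u \<in> tot U \<Longrightarrow>
    psi V U (a \<otimes> (v \<otimes> u)) = proj (Fo V) (Fo U) ((a \<otimes> v) \<otimes> (ee 0 \<otimes> u))"
proof -
  let ?t = "tmap (carr (Fo V)) (tot U) id (\<lambda>u. ee 0 \<otimes> u)"
  have un: "unreassoc t \<in> tensor (carr (Fo V)) (tot U)" if "t \<in> carr (Fo (graded_tensor V U))" for t
    using unreassoc_mem[OF that[unfolded carr_gtensor]] unfolding carr_Fo[of V] .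
  have mem: "?t s \<in> tensor (carr (Fo V)) (carr (Fo U))" if "s \<in> tensor (carr (Fo V)) (tot U)" for s
    by (rule lin_tensor_mem[OF lin_tmap[OF S0] subspace_tensor _ that])
      (simp add: tmap_otimes[OF S0] tensorI Fo_memI)
  show "linear_on (carr (Fo (graded_tensor V U))) (psi V U)"
    unfolding psi_def
    by (rule lin_compose[OF lin_compose[OF lin_unreassoc lin_tmap[OF S0] un] lin_proj[OF FV FU] mem[OF un]])
  show "psi V U t \<in> TS (Fo V) (Fo U)" if "t \<in> carr (Fo (graded_tensor V U))"
    unfolding psi_def by (rule proj_mem[OF mem[OF un[OF that]]])
  show "psi V U (a \<otimes> (v \<otimes> u)) = proj (Fo V) (Fo U) ((a \<otimes> v) \<otimes> (ee 0 \<otimes> u))"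
    if *: "a \<in> carr AA" "v \<in> tot V" "u \<in> tot U"
    unfolding psi_def unreassoc_otimes
    using tmap_otimes[OF S0 _ *(3), of "a \<otimes> v"] tensorI[OF *(1,2)] by (simp add: carr_Fo)
qed

lemma phi_iso: "is_iso LC (TM (Fo V) (Fo U)) (Fo (graded_tensor V U)) (phi V U)"
proof (rule LC_isoI[OF wmod_TM[OF FV FU] phi_lhom _ lin_psi])
  show "fs.subspace (carr (Fo (graded_tensor V U)))" by (simp add: carr_Fo)
  show "psi V U t \<in> carr (TM (Fo V) (Fo U))" if "t \<in> carr (Fo (graded_tensor V U))" for t
    using psi_mem[OF that] by simp
next
  fix t assume t: "t \<in> carr (TM (Fo V) (Fo U))"
  then have t: "t \<in> TS (Fo V) (Fo U)" by simp
  have mem: "fn (phi V U) t \<in> carr (Fo (graded_tensor V U))" if "t \<in> TS (Fo V) (Fo U)" for t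
    using lhom_mem[OF phi_lhom] that by simp
  show "psi V U (fn (phi V U) t) = t"
  proof (rule lin_eqI[OF TS_Fo_span lin_compose[OF lin_phi lin_psi mem] lin_id(2) _ t])
    fix t assume "t \<in> proj (Fo V) (Fo U) ` pure_tensors (Fgen V) (Fgen U)"
    then obtain x h v y g u where *: "x \<in> l" "v \<in> V h" "y \<in> l" "u \<in> U g"
      "t = proj (Fo V) (Fo U) ((ee x \<otimes> v) \<otimes> (ee y \<otimes> u))"
      unfolding Fgen_def by blast
    note v = totI[of v V, OF *(2)] and u = totI[of u U, OF *(4)]
    note x = *(1) and y = *(3)
    have vu: "v \<otimes> u \<in> tot (graded_tensor V U)" unfolding tot_gtensor by (rule tensorI[OF v u])
    have a: "(ee (x + y) \<otimes> v) \<otimes> (ee 0 \<otimes> u) \<in> tensor (carr (Fo V)) (carr (Fo U))"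
      by (intro tensorI Fo_memI l_add y x l_zero u v)
    \<comment> \<open>Written as \<open>ee y\<close> acting on \<open>ee 0 \<otimes> u\<close>, the
      second factor can release \<open>ee y\<close> across the tensor product. So every class has a
      representative with \<open>ee 0\<close> there, which is the form produced by
      \<open>psi\<close>.\<close>
    have "(ee y :: ('h, 'b) vec) \<otimes> u = lact (Fo U) y (ee 0 \<otimes> u)"
      unfolding lact_Fo[OF U y l_zero u] alpha_zero(1)[OF y] by simp
    then have "t = fscale (q (x + h) y * \<alpha> y x) (proj (Fo V) (Fo U) ((ee (x + y) \<otimes> v) \<otimes> (ee 0 \<otimes> u)))"
      unfolding *(5) using proj_balanced[OF FV FU Fo_wspace[OF V x *(2)] y Fo_memI[OF l_zero u]]
        lin_scale[OF lin_proj[OF FV FU] a]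
      by (simp add: lact_Fo[OF V y x v] otimes_scale_left add.commute)
    \<comment> \<open>The scalar obtained from carrying \<open>ee y\<close> across is the one in
      \<open>phi_otimes\<close>.\<close>
    moreover have "q (x + h) y * \<alpha> y x = q h y * \<alpha> x y"
      using alpha_swap[OF x y] by (simp add: q_add_left mult_ac)
    ultimately show "psi V U (fn (phi V U) t) = t"
      using phi_otimes[OF x y *(2) u] lin_scale[OF lin_psi Fo_memI[OF l_add[OF x y] vu]]
        psi_otimes[OF ee_in_AA[OF l_add[OF x y]] v u]
      by (simp add: *(5))
  qed
next
  fix t assume t: "t \<in> carr (Fo (graded_tensor V U))"
  show "fn (phi V U) (psi V U t) = t"
  proof (rule lin_eqI[OF carr_gtensor_span lin_compose[OF lin_psi lin_phi psi_mem] lin_id(2) _ t])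
    fix t assume "t \<in> {ee x \<otimes> (v \<otimes> u) |x v u. x \<in> l \<and> v \<in> (\<Union>h\<in>L. V h) \<and> u \<in> (\<Union>h\<in>L. U h)}"
    then obtain x h v g u where *: "x \<in> l" "v \<in> V h" "u \<in> U g" "t = ee x \<otimes> (v \<otimes> u)" by blast
    note v = totI[of v V, OF *(2)] and u = totI[of u U, OF *(3)]
    show "fn (phi V U) (psi V U t) = t"
      unfolding *(4) psi_otimes[OF ee_in_AA[OF *(1)] v u] phi_otimes[OF *(1) l_zero *(2) u]
      by (simp add: alpha_zero *(1))
  qed
qed

end

section \<open>The unit constraint\<close>

definition phi0 :: "(('h, 'b) amod, ('h, 'b) vec \<Rightarrow> ('h, 'b) vec) arrow" where
  "phi0 = \<lparr>src = AA, tgt = Fo (graded_line 0), fn = restrict (\<lambda>a. a \<otimes> ee 0) (carr AA)\<rparr>"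

lemma line0_L: "(graded_line 0 :: ('h, 'b) graded) \<in> graded_obj L"
  by (rule graded_line_obj[OF l_in_L[OF l_zero]])

lemma ee0_line: "(ee 0 :: ('h, 'b) vec) \<in> graded_line 0 0"
  unfolding graded_line_same by (simp add: fs.span_base)

lemma ee0_tot: "(ee 0 :: ('h, 'b) vec) \<in> tot (graded_line 0)"
  by (rule totI[of _ "graded_line 0", OF ee0_line])

lemma phi0_simps [simp]: "src phi0 = AA" "tgt phi0 = Fo (graded_line 0)"
  by (simp_all add: phi0_def)

lemma phi0_apply: "a \<in> carr AA \<Longrightarrow> fn phi0 a = a \<otimes> ee 0"
  by (simp add: phi0_def)

lemma lin_phi0: "linear_on (carr (AA :: ('h, 'b) amod)) (fn phi0)"
  unfolding phi0_def arrow.simps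
  by (rule lin_restrict[OF lin_left subspace_AA])

lemma carr_Fo_line0: "carr (Fo (graded_line 0 :: ('h, 'b) graded)) = fs.span {ee x \<otimes> ee 0 |x. x \<in> l}"
proof -
  have "{s \<otimes> t |s t. s \<in> ee ` l \<and> t \<in> {ee 0}} = {ee x \<otimes> ee 0 :: ('h, 'b) vec |x. x \<in> l}" by blast
  then show ?thesis unfolding carr_Fo tot_graded_line carr_AA tensor_span by simp
qed

lemma phi0_lhom: "(phi0 :: (('h, 'b) amod, _) arrow) \<in> lhom AA (Fo (graded_line 0))"
proof (rule lhomI[OF wmod_AA wmod_Fo[OF line0_L] carr_AA _ _ _ lin_phi0])
  show "fn (phi0 :: (('h, 'b) amod, _) arrow) \<in> extensional (carr AA)" by (simp add: phi0_def)
  fix a :: "('h, 'b) vec" assume "a \<in> ee ` l"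
  then obtain x where x: "x \<in> l" "a = ee x" by blast
  have "fn phi0 a \<in> wspace (Fo (graded_line 0)) (x + 0)"
    unfolding x(2) phi0_apply[OF ee_in_AA[OF x(1)]] by (rule Fo_wspace[OF line0_L x(1) ee0_line])
  then show "\<exists>\<mu>. a \<in> wspace AA \<mu> \<and> fn phi0 a \<in> wspace (Fo (graded_line 0)) \<mu>"
    using ee_wspace[OF x(1)] x(2) by auto
  show "fn phi0 (lact AA z a) = lact (Fo (graded_line 0)) z (fn phi0 a)" if z: "z \<in> l" for z
    unfolding x(2) phi0_apply[OF ee_in_AA[OF x(1)]] nu_AA[OF z x(1)] lact_Fo[OF line0_L z x(1) ee0_tot]
      lin_scale[OF lin_phi0 ee_in_AA[OF l_add[OF z x(1)]]] phi0_apply[OF ee_in_AA[OF l_add[OF z x(1)]]] ..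
qed simp_all

lemma phi0_iso: "is_iso LC AA (Fo (graded_line 0)) (phi0 :: (('h, 'b) amod, _) arrow)"
proof -
  \<comment> \<open>The inverse reads the scalar of the second factor at \<open>Pt 0\<close>, the
    convention by which the unit line is identified with scalars.\<close>
  let ?b = "\<lambda>a k :: ('h, 'b) vec. fscale (k (Pt 0)) a"
  let ?k = "tlift (carr AA) (tot (graded_line 0)) ?b"
  have b: "bilin (carr AA) (tot (graded_line 0)) ?b"
    by (intro bilinI linear_onI) (auto simp: fun_eq_iff pointwise algebra_simps)
  note k = lin_tlift[OF subspace_AA subspace_tot b, folded carr_Fo]
  have k0: "?k (a \<otimes> ee 0) = a" if "a \<in> carr AA" for a
    using tlift_otimes[OF subspace_AA subspace_tot b that ee0_tot] by simp
  have mem: "?k t \<in> carr AA" if "t \<in> carr (Fo (graded_line 0))" for t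
    by (rule lin_memI[OF carr_Fo_line0 k subspace_AA _ that]) (auto simp: k0 ee_in_AA)
  show ?thesis
  proof (rule LC_isoI[OF wmod_AA phi0_lhom _ k mem])
    show "fs.subspace (carr (Fo (graded_line 0 :: ('h, 'b) graded)))" by (simp add: carr_Fo)
    show "?k (fn phi0 a) = a" if "a \<in> carr AA" for a
      by (simp add: phi0_apply k0 that)
    show "fn phi0 (?k t) = t" if t: "t \<in> carr (Fo (graded_line 0))" for t
      by (rule lin_eqI[OF carr_Fo_line0 lin_compose[OF k lin_phi0 mem] lin_id(2) _ t])
        (auto simp: k0 ee_in_AA phi0_apply)
  qed
qed

end

lemma extensional_span_eq:
  assumes "f \<in> extensional V" "g \<in> extensional V" and sp: "V = fs.span G"
    and "linear_on V f" "linear_on V g" "\<And>x. x \<in> G \<Longrightarrow> f x = g x"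
  shows "f = g"
  by (rule extensionalityI[OF assms(1,2)])
    (rule lin_eqI[OF sp assms(4,5,6)])

lemma lin_compose_ext:
  assumes "linear_on V f" "linear_on W g" "\<And>v. v \<in> V \<Longrightarrow> f v \<in> W" "fs.subspace V"
  shows "linear_on V (compose V g f)"
  unfolding compose_def
  by (rule lin_restrict[OF lin_compose[OF assms(1,2,3)] assms(4)])

context lattice_setting
begin

subsection \<open>Compatibility with the braided monoidal structures\<close>

abbreviation "GC \<equiv> graded_cat L q"

lemma GC_simps [simp]:
  "Obj GC = graded_obj L" "Hom GC = graded_hom" "TensO GC = graded_tensor" "UnitO GC = graded_line 0"
  "Id GC V = \<lparr>src = V, tgt = V, fn = restrict id (tot V)\<rparr>"
  "Comp GC g f = \<lparr>src = src f, tgt = tgt g, fn = compose (tot (src f)) (fn g) (fn f)\<rparr>"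
  "src (TensA GC f g) = graded_tensor (src f) (src g)" "tgt (TensA GC f g) = graded_tensor (tgt f) (tgt g)"
  "fn (TensA GC f g) = tmap (tot (src f)) (tot (src g)) (fn f) (fn g)"
  "src (Assoc GC V U W) = graded_tensor (graded_tensor V U) W"
  "tgt (Assoc GC V U W) = graded_tensor V (graded_tensor U W)"
  "fn (Assoc GC V U W) = restrict reassoc (tot (graded_tensor (graded_tensor V U) W))"
  "src (Lunit GC V) = graded_tensor (graded_line 0) V" "tgt (Lunit GC V) = V"
  "fn (Lunit GC V) = tlift (tot (graded_line 0)) (tot V) (\<lambda>k v. fscale (k (Pt 0)) v)"
  "src (Runit GC V) = graded_tensor V (graded_line 0)" "tgt (Runit GC V) = V"
  "fn (Runit GC V) = tlift (tot V) (tot (graded_line 0)) (\<lambda>v k. fscale (k (Pt 0)) v)"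
  "src (Braid GC V U) = graded_tensor V U" "tgt (Braid GC V U) = graded_tensor U V"
  by (simp_all add: graded_cat_def)

text \<open>The description asks for one map with a different scalar on every pair of components. It
  is built on products of homogeneous basis vectors and extended bilinearly within each
  pair.\<close>

lemma
  assumes V: "V \<in> graded_obj L" and U: "U \<in> graded_obj L"
  shows lin_GC_Braid: "linear_on (tot (graded_tensor V U)) (fn (Braid GC V U))"
    and GC_Braid: "v \<in> V h \<Longrightarrow> u \<in> U g \<Longrightarrow> fn (Braid GC V U) (v \<otimes> u) = fscale (q h g) (u \<otimes> v)"
proof -
  obtain B d where hB: "homogeneous_basis L V B d" using homogeneous_basis_exists[OF V] .
  obtain C e where hC: "homogeneous_basis L U C e" using homogeneous_basis_exists[OF U] .
  have B: "fs.independent B" "\<And>h. V h = fs.span {b \<in> B. d b = h}"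
    and C: "fs.independent C" "\<And>h. U h = fs.span {c \<in> C. e c = h}"
    using hB hC by (simp_all add: homogeneous_basis_def)
  obtain f where f: "Vector_Spaces.linear fscale fscale f" "\<forall>b\<in>B. \<forall>c\<in>C. f (b \<otimes> c) = fscale (q (d b) (e c)) (c \<otimes> b)"
    using tensor_basis_ex[OF B(1) C(1), of "\<lambda>b c. fscale (q (d b) (e c)) (c \<otimes> b)"] by blast
  have fvu: "f (v \<otimes> u) = fscale (q h g) (u \<otimes> v)" if v: "v \<in> V h" and u: "u \<in> U g" for v h u g
  proof (rule bilin_eqI[OF B(2) C(2) _ _ _ v u])
    show "bilin (V h) (U g) (\<lambda>v u. f (v \<otimes> u))"
      by (intro bilinI) (use f(1) in \<open>auto intro!: linear_onI simp: otimes_simps Vector_Spaces.linear_iff\<close>)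
    show "bilin (V h) (U g) (\<lambda>v u. fscale (q h g) (u \<otimes> v))"
      by (intro bilinI lin_fscale lin_otimes_left lin_otimes_right lin_id)
    show "f (b \<otimes> c) = fscale (q h g) (c \<otimes> b)" if "b \<in> {b \<in> B. d b = h}" "c \<in> {c \<in> C. e c = g}" for b c
      using f(2) that by auto
  qed
  let ?T = "tot (graded_tensor V U)"
  let ?P = "\<lambda>t. \<forall>f g. \<forall>v\<in>V f. \<forall>u\<in>U g. t (v \<otimes> u) = fscale (q f g) (u \<otimes> v)"
  have T: "?T = fs.span (pure_tensors (\<Union>h\<in>L. V h) (\<Union>h\<in>L. U h))"
    unfolding tot_gtensor[OF V U] tot_span[OF V] tot_span[OF U] by (rule tensor_span)
  have mem: "v \<otimes> u \<in> ?T" if "v \<in> V h" "u \<in> U g" for v u h g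
    unfolding tot_gtensor[OF V U] by (rule tensorI[OF totI[of v V, OF that(1)] totI[of u U, OF that(2)]])
  have "fn (Braid GC V U) = the_linear ?T ?P" by (simp add: graded_cat_def)
  also have "\<dots> = restrict f ?T"
  proof (rule the_linear_eq[where P = ?P, OF linear_imp_linear_on[OF f(1)] _ T])
    show "?P (restrict f ?T)"
    proof (intro allI ballI)
      fix h g v u assume "v \<in> V h" "u \<in> U g"
      then show "restrict f ?T (v \<otimes> u) = fscale (q h g) (u \<otimes> v)" using fvu[of v h u g] mem[of v h u g] by simp
    qed
    fix k s assume k: "?P k" and "s \<in> pure_tensors (\<Union>h\<in>L. V h) (\<Union>h\<in>L. U h)"
    then obtain v u h g where *: "v \<in> V h" "u \<in> U g" "s = v \<otimes> u" by blast
    show "k s = f s" unfolding *(3) fvu[OF *(1,2)] using k *(1,2) by blast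
  qed
  finally have E: "fn (Braid GC V U) = restrict f ?T" .
  show "linear_on ?T (fn (Braid GC V U))"
    unfolding E by (rule lin_restrict[OF linear_imp_linear_on[OF f(1)] subspace_tot])
  show "fn (Braid GC V U) (v \<otimes> u) = fscale (q h g) (u \<otimes> v)" if "v \<in> V h" "u \<in> U g"
    unfolding E using fvu[OF that] mem[OF that] by simp
qed

lemma Id_lhom: "wmod M \<Longrightarrow> Id LC M \<in> lhom M M"
  unfolding local_hom_def LC_simps
  using weighted_act_mem[OF wmod_wt[of M]] nu_mem[of M] lin_restrict[OF lin_id(1) weighted_subspace[OF wmod_wt[of M]]]
  by (auto simp: tensorI)

lemma Fa_Id:
  assumes V: "V \<in> graded_obj L" shows "Fa (Id GC V) = Id LC (Fo V)"
proof (rule arrow_eqI)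
  have lin: "linear_on (tot V) (restrict id (tot V))" by (rule lin_restrict[OF lin_id(1) subspace_tot])
  note F = Fa_otimes[of "Id GC V"] and F' = lin_Fa[of "Id GC V"] Fa_ext[of "Id GC V"]
  show "fn (Fa (Id GC V)) = fn (Id LC (Fo V))"
  proof (rule extensional_span_eq[OF _ _ carr_Fo_span[OF V]])
    show "fn (Fa (Id GC V)) \<in> extensional (carr (Fo V))" "linear_on (carr (Fo V)) (fn (Fa (Id GC V)))"
      using F' lin by simp_all
    show "fn (Id LC (Fo V)) \<in> extensional (carr (Fo V))" by simp
    show "linear_on (carr (Fo V)) (fn (Id LC (Fo V)))"
      using lin_restrict[OF lin_id(1) weighted_subspace[OF wmod_wt[OF wmod_Fo[OF V]]]] by simp
    fix t assume "t \<in> Fgen V"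
    then obtain x v h where *: "x \<in> l" "v \<in> V h" "t = ee x \<otimes> v" unfolding Fgen_def by blast
    note v = totI[of v V, OF *(2)]
    show "fn (Fa (Id GC V)) t = fn (Id LC (Fo V)) t"
      using F[of "ee x" v] lin v ee_in_AA[OF *(1)] Fo_memI[OF *(1) v] by (simp add: *(3))
  qed
qed simp_all

lemma Fa_Comp:
  assumes X: "X \<in> graded_obj L" and Y: "Y \<in> graded_obj L" and Z: "Z \<in> graded_obj L"
    and f: "f \<in> graded_hom X Y" and g: "g \<in> graded_hom Y Z"
  shows "Fa (Comp GC g f) = Comp LC (Fa g) (Fa f)"
proof (rule arrow_eqI)
  note s = graded_hom_src[OF f] graded_hom_src[OF g] graded_hom_tgt[OF f] graded_hom_tgt[OF g]
  note linf = graded_hom_lin[OF f] and ling = graded_hom_lin[OF g]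
  have lin: "linear_on (tot X) (compose (tot X) (fn g) (fn f))"
    by (rule lin_compose_ext[OF linf ling graded_hom_tot[OF f] subspace_tot])
  note Ff = Fa_lhom[OF X Y f] and Fg = Fa_lhom[OF Y Z g]
  have sX: "fs.subspace (carr (Fo X))" by (simp add: carr_Fo)
  show "fn (Fa (Comp GC g f)) = fn (Comp LC (Fa g) (Fa f))"
  proof (rule extensional_span_eq[OF _ _ carr_Fo_span[OF X]])
    show "fn (Fa (Comp GC g f)) \<in> extensional (carr (Fo X))" "linear_on (carr (Fo X)) (fn (Fa (Comp GC g f)))"
      using Fa_ext[of "Comp GC g f"] lin_Fa[of "Comp GC g f"] lin by (simp_all add: s)
    show "fn (Comp LC (Fa g) (Fa f)) \<in> extensional (carr (Fo X))" by (simp add: s)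
    show "linear_on (carr (Fo X)) (fn (Comp LC (Fa g) (Fa f)))"
      using lin_compose_ext[OF lhom_lin[OF Ff] lhom_lin[OF Fg] lhom_mem[OF Ff] sX] by (simp add: s)
    fix t assume "t \<in> Fgen X"
    then obtain x v h where *: "x \<in> l" "v \<in> X h" "t = ee x \<otimes> v" unfolding Fgen_def by blast
    note v = totI[of v X, OF *(2)]
    show "fn (Fa (Comp GC g f)) t = fn (Comp LC (Fa g) (Fa f)) t"
      using Fa_otimes[of "Comp GC g f", of "ee x" v] Fa_otimes[of f "ee x" v] Fa_otimes[of g "ee x" "fn f v"]
        linf ling lin v Fo_memI[OF *(1) v] graded_hom_tot[OF f v]
      by (simp add: s *(3) compose_eq ee_in_AA[OF *(1)])
  qed
qed (simp_all add: graded_hom_src[OF f] graded_hom_tgt[OF g])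

text \<open>The constraint depends on the left vector only through its degree \<open>h\<close>, and
  graded maps preserve degrees, so the same scalar occurs before and after.\<close>

lemma phi_natural:
  assumes X: "X \<in> graded_obj L" and X': "X' \<in> graded_obj L" and Y: "Y \<in> graded_obj L" and Y': "Y' \<in> graded_obj L"
    and f: "f \<in> graded_hom X X'" and g: "g \<in> graded_hom Y Y'"
  shows "Comp LC (Fa (TensA GC f g)) (phi X Y) = Comp LC (phi X' Y') (TensA LC (Fa f) (Fa g))"
proof (rule arrow_eqI)
  note s = graded_hom_src[OF f] graded_hom_src[OF g] graded_hom_tgt[OF f] graded_hom_tgt[OF g]
  show "src (Comp LC (Fa (TensA GC f g)) (phi X Y)) = src (Comp LC (phi X' Y') (TensA LC (Fa f) (Fa g)))"
    "tgt (Comp LC (Fa (TensA GC f g)) (phi X Y)) = tgt (Comp LC (phi X' Y') (TensA LC (Fa f) (Fa g)))"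
    by (simp_all add: s)
  let ?S = "TS (Fo X) (Fo Y)"
  note W = wmod_Fo[OF X] wmod_Fo[OF X'] wmod_Fo[OF Y] wmod_Fo[OF Y'] Fa_lhom[OF X X' f] Fa_lhom[OF Y Y' g]
  note tm = lin_tmap[OF subspace_tot subspace_tot graded_hom_lin[OF f] graded_hom_lin[OF g]]
    tmap_otimes[OF subspace_tot subspace_tot graded_hom_lin[OF f] graded_hom_lin[OF g]]
  have lin: "linear_on (tot (src (TensA GC f g))) (fn (TensA GC f g))"
    using tm(1) by (simp add: s tot_gtensor[OF X Y])
  note F = Fa_otimes[OF lin] and linF = lin_Fa[OF lin, simplified, unfolded s]
  have "fn (Fa (TensA GC f g)) (fn (phi X Y) t) = fn (phi X' Y') (fn (TensA LC (Fa f) (Fa g)) t)" if t: "t \<in> ?S" for t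
  proof (rule lin_eqI[OF TS_Fo_span[OF X Y] _ _ _ t])
    show "linear_on ?S (\<lambda>t. fn (Fa (TensA GC f g)) (fn (phi X Y) t))"
      by (rule lin_compose[OF lin_phi[OF X Y] linF lhom_mem[OF phi_lhom[OF X Y], unfolded carr_TM]])
    show "linear_on ?S (\<lambda>t. fn (phi X' Y') (fn (TensA LC (Fa f) (Fa g)) t))"
      by (rule lin_compose[OF lin_TensA[OF W] lin_phi[OF X' Y'] TensA_mem[OF W]])
    fix t assume "t \<in> proj (Fo X) (Fo Y) ` pure_tensors (Fgen X) (Fgen Y)"
    then obtain x h v y k u where *: "x \<in> l" "v \<in> X h" "y \<in> l" "u \<in> Y k"
      "t = proj (Fo X) (Fo Y) ((ee x \<otimes> v) \<otimes> (ee y \<otimes> u))"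
      unfolding Fgen_def by blast
    note v = totI[of v X, OF *(2)] and u = totI[of u Y, OF *(4)]
    note x = *(1) and y = *(3)
    have vu: "v \<otimes> u \<in> tot (graded_tensor X Y)" unfolding tot_gtensor[OF X Y] by (rule tensorI[OF v u])
    have Ft: "fn (Fa f) (ee x \<otimes> v) = ee x \<otimes> fn f v" "fn (Fa g) (ee y \<otimes> u) = ee y \<otimes> fn g u"
      using Fa_otimes[of f "ee x" v] Fa_otimes[of g "ee y" u] graded_hom_lin[OF f] graded_hom_lin[OF g] v u
        ee_in_AA[OF x] ee_in_AA[OF y] by (simp_all add: s)
    have "fn (Fa (TensA GC f g)) (ee (x + y) \<otimes> (v \<otimes> u)) = ee (x + y) \<otimes> (fn f v \<otimes> fn g u)"
      using F[of "ee (x + y)" "v \<otimes> u"] ee_in_AA[OF l_add[OF x y]] vu tm(2)[OF v u] by (simp add: s)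
    then show "fn (Fa (TensA GC f g)) (fn (phi X Y) t) = fn (phi X' Y') (fn (TensA LC (Fa f) (Fa g)) t)"
      unfolding *(5) phi_otimes[OF X Y x y *(2) u] TensA_proj[OF W Fo_memI[OF x v] Fo_memI[OF y u]] Ft
        phi_otimes[OF X' Y' x y graded_hom_deg[OF f *(2)] graded_hom_tot[OF g u]]
        lin_scale[OF linF Fo_memI[OF l_add[OF x y] vu]]
      by simp
  qed
  then show "fn (Comp LC (Fa (TensA GC f g)) (phi X Y)) = fn (Comp LC (phi X' Y') (TensA LC (Fa f) (Fa g)))"
    by (auto simp: s compose_def fun_eq_iff)
qed

lemma phi_assoc:
  assumes X: "X \<in> graded_obj L" and Y: "Y \<in> graded_obj L" and Z: "Z \<in> graded_obj L"
  shows "Comp LC (Fa (Assoc GC X Y Z)) (Comp LC (phi (graded_tensor X Y) Z) (TensA LC (phi X Y) (Id LC (Fo Z)))) =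
    Comp LC (phi X (graded_tensor Y Z)) (Comp LC (TensA LC (Id LC (Fo X)) (phi Y Z)) (Assoc LC (Fo X) (Fo Y) (Fo Z)))"
    (is "?lhs = ?rhs")
proof (rule arrow_eqI)
  show "src ?lhs = src ?rhs" "tgt ?lhs = tgt ?rhs" by simp_all
  note XY = gtensor_L[OF X Y] and YZ = gtensor_L[OF Y Z]
  note FX = wmod_Fo[OF X] and FY = wmod_Fo[OF Y] and FZ = wmod_Fo[OF Z] and FXY = wmod_Fo[OF XY] and FYZ = wmod_Fo[OF YZ]
  let ?S = "TS (TM (Fo X) (Fo Y)) (Fo Z)"
  note T1 = wmod_TM[OF FX FY] FXY FZ FZ phi_lhom[OF X Y] Id_lhom[OF FZ]
  note T2 = FX FX wmod_TM[OF FY FZ] FYZ Id_lhom[OF FX] phi_lhom[OF Y Z]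
  let ?G = "pure_tensors (proj (Fo X) (Fo Y) ` pure_tensors (Fgen X) (Fgen Y)) (Fgen Z)"
  have sp: "?S = fs.span (proj (TM (Fo X) (Fo Y)) (Fo Z) ` ?G)"
    by (rule TS_span_gen[OF wmod_TM[OF FX FY] FZ TS_Fo_span[OF X Y, folded carr_TM] carr_Fo_span[OF Z]])
  have linA: "linear_on (tot (src (Assoc GC X Y Z))) (fn (Assoc GC X Y Z))"
    using lin_restrict[OF lin_reassoc subspace_tot] by simp
  note linF = lin_Fa[OF linA, simplified]
  let ?f = "\<lambda>t. fn (Fa (Assoc GC X Y Z)) (fn (phi (graded_tensor X Y) Z) (fn (TensA LC (phi X Y) (Id LC (Fo Z))) t))"
  let ?g = "\<lambda>t. fn (phi X (graded_tensor Y Z)) (fn (TensA LC (Id LC (Fo X)) (phi Y Z)) (fn (Assoc LC (Fo X) (Fo Y) (Fo Z)) t))"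
  have eq: "?f t = ?g t" if t: "t \<in> ?S" for t
  proof (rule lin_eqI[OF sp _ _ _ t])
    show "linear_on ?S ?f"
      by (rule lin_compose[OF lin_compose[OF lin_TensA[OF T1] lin_phi[OF XY Z] TensA_mem[OF T1]] linF
            lhom_mem[OF phi_lhom[OF XY Z], unfolded carr_TM, OF TensA_mem[OF T1]]])
    show "linear_on ?S ?g"
      by (rule lin_compose[OF lin_compose[OF lin_Assoc[OF FX FY FZ] lin_TensA[OF T2] Assoc_mem[OF FX FY FZ]]
            lin_phi[OF X YZ] TensA_mem[OF T2 Assoc_mem[OF FX FY FZ]]])
    fix t assume "t \<in> proj (TM (Fo X) (Fo Y)) (Fo Z) ` ?G"
    then obtain x h v y k u z j w where *: "x \<in> l" "v \<in> X h" "y \<in> l" "u \<in> Y k" "z \<in> l" "w \<in> Z j"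
      "t = proj (TM (Fo X) (Fo Y)) (Fo Z) (proj (Fo X) (Fo Y) ((ee x \<otimes> v) \<otimes> (ee y \<otimes> u)) \<otimes> (ee z \<otimes> w))"
      unfolding Fgen_def by blast
    note x = *(1) and y = *(3) and z = *(5)
    note v = totI[of v X, OF *(2)] and u = totI[of u Y, OF *(4)] and w = totI[of w Z, OF *(6)]
    note mx = Fo_memI[OF x v] and my = Fo_memI[OF y u] and mz = Fo_memI[OF z w]
    have vu: "v \<otimes> u \<in> tot (graded_tensor X Y)" unfolding tot_gtensor[OF X Y] by (rule tensorI[OF v u])
    have uw: "u \<otimes> w \<in> tot (graded_tensor Y Z)" unfolding tot_gtensor[OF Y Z] by (rule tensorI[OF u w])
    have vuw: "(v \<otimes> u) \<otimes> w \<in> tot (graded_tensor (graded_tensor X Y) Z)"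
      unfolding tot_gtensor[OF XY Z] by (rule tensorI[OF vu w])
    have a: "(ee (x + y) \<otimes> (v \<otimes> u)) \<otimes> (ee z \<otimes> w) \<in> tensor (carr (Fo (graded_tensor X Y))) (carr (Fo Z))"
      by (rule tensorI[OF Fo_memI[OF l_add[OF x y] vu] mz])
    have b: "(ee x \<otimes> v) \<otimes> (ee (y + z) \<otimes> (u \<otimes> w)) \<in> tensor (carr (Fo X)) (carr (Fo (graded_tensor Y Z)))"
      by (rule tensorI[OF mx Fo_memI[OF l_add[OF y z] uw]])
    have i: "fn (Id LC (Fo Z)) (ee z \<otimes> w) = ee z \<otimes> w" "fn (Id LC (Fo X)) (ee x \<otimes> v) = ee x \<otimes> v"
      using mx mz by simp_all
    have c: "fn (Fa (Assoc GC X Y Z)) (ee (x + y + z) \<otimes> ((v \<otimes> u) \<otimes> w)) = ee (x + (y + z)) \<otimes> (v \<otimes> (u \<otimes> w))"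
      using Fa_otimes[OF linA, of "ee (x + y + z)" "(v \<otimes> u) \<otimes> w"] ee_in_AA[OF l_add[OF l_add[OF x y] z]] vuw
      by (simp add: reassoc_otimes add.assoc)
    have "?f t = fscale (q h y * \<alpha> x y * (q (h + k) z * \<alpha> (x + y) z)) (ee (x + (y + z)) \<otimes> (v \<otimes> (u \<otimes> w)))"
      unfolding *(7) TensA_proj[OF T1 proj_memI[OF mx my, folded carr_TM] mz] phi_otimes[OF X Y x y *(2) u] i otimes_scale_left
        lin_scale[OF lin_proj[OF FXY FZ] a] lin_scale[OF lin_phi[OF XY Z] proj_mem[OF a]]
        phi_otimes[OF XY Z l_add[OF x y] z otimes_graded_tensor[of v X h u Y k, OF *(2,4)] w] fs.scale_scale
        lin_scale[OF linF Fo_memI[OF l_add[OF l_add[OF x y] z] vuw]] c ..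
    moreover have "?g t = fscale (q k z * \<alpha> y z * (q h (y + z) * \<alpha> x (y + z))) (ee (x + (y + z)) \<otimes> (v \<otimes> (u \<otimes> w)))"
      unfolding *(7) Assoc_proj[OF FX FY FZ mx my mz] TensA_proj[OF T2 mx proj_memI[OF my mz, folded carr_TM]] i
        phi_otimes[OF Y Z y z *(4) w] otimes_scale_right
        lin_scale[OF lin_proj[OF FX FYZ] b] lin_scale[OF lin_phi[OF X YZ] proj_mem[OF b]]
        phi_otimes[OF X YZ x l_add[OF y z] *(2) uw] fs.scale_scale ..
    \<comment> \<open>Both composites collect \<open>q h y\<close>, \<open>q h z\<close> and
      \<open>q k z\<close>: one splits the degree \<open>h + k\<close> of
      \<open>v \<otimes> u\<close>, the other the lattice element \<open>y + z\<close>. What is left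
      is the cocycle identity.\<close>
    moreover have "q h y * \<alpha> x y * (q (h + k) z * \<alpha> (x + y) z) = q h y * q h z * q k z * (\<alpha> x y * \<alpha> (x + y) z)"
      by (simp add: q_add_left mult_ac)
    moreover have "q k z * \<alpha> y z * (q h (y + z) * \<alpha> x (y + z)) = q h y * q h z * q k z * (\<alpha> y z * \<alpha> x (y + z))"
      by (simp add: q_add_right mult_ac)
    ultimately show "?f t = ?g t" using alpha_cocycle[OF x y z] by simp
  qed
  show "fn ?lhs = fn ?rhs"
  proof
    fix t show "fn ?lhs t = fn ?rhs t"
      using eq[of t] by (cases "t \<in> ?S") (simp_all add: compose_def)
  qed
qed

lemma
  assumes X: "X \<in> graded_obj L"
  shows line0_left: "linear_on (tot (graded_tensor (graded_line 0) X)) (fn (Lunit GC X))"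
      "v \<in> tot X \<Longrightarrow> fn (Lunit GC X) (ee 0 \<otimes> v) = v"
    and line0_right: "linear_on (tot (graded_tensor X (graded_line 0))) (fn (Runit GC X))"
      "v \<in> tot X \<Longrightarrow> fn (Runit GC X) (v \<otimes> ee 0) = v"
proof -
  have 1: "bilin (tot (graded_line 0)) (tot X) (\<lambda>k v. fscale (k (Pt 0)) v)"
    and 2: "bilin (tot X) (tot (graded_line 0)) (\<lambda>v k. fscale (k (Pt 0)) v)"
    by (intro bilinI linear_onI; auto simp: fun_eq_iff pointwise algebra_simps)+
  show "linear_on (tot (graded_tensor (graded_line 0) X)) (fn (Lunit GC X))"
    "linear_on (tot (graded_tensor X (graded_line 0))) (fn (Runit GC X))"
    using lin_tlift[OF subspace_tot subspace_tot 1] lin_tlift[OF subspace_tot subspace_tot 2]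
    by (simp_all add: tot_gtensor[OF line0_L X] tot_gtensor[OF X line0_L])
  show "fn (Lunit GC X) (ee 0 \<otimes> v) = v" "fn (Runit GC X) (v \<otimes> ee 0) = v" if "v \<in> tot X"
    using tlift_otimes[OF subspace_tot subspace_tot 1 ee0_tot that] tlift_otimes[OF subspace_tot subspace_tot 2 that ee0_tot]
    by simp_all
qed

lemma phi_lunit:
  assumes X: "X \<in> graded_obj L"
  shows "Comp LC (Fa (Lunit GC X)) (Comp LC (phi (graded_line 0) X) (TensA LC phi0 (Id LC (Fo X)))) = Lunit LC (Fo X)"
    (is "?lhs = ?rhs")
proof (rule arrow_eqI)
  show "src ?lhs = src ?rhs" "tgt ?lhs = tgt ?rhs" by simp_all
  note FX = wmod_Fo[OF X] and F1 = wmod_Fo[OF line0_L]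
  let ?S = "TS AA (Fo X)"
  note T1 = wmod_AA F1 FX FX phi0_lhom Id_lhom[OF FX]
  have sp: "?S = fs.span (proj AA (Fo X) ` pure_tensors (ee ` l) (Fgen X))"
    by (rule TS_span_gen[OF wmod_AA FX carr_AA carr_Fo_span[OF X]])
  have linA: "linear_on (tot (src (Lunit GC X))) (fn (Lunit GC X))" using line0_left(1)[OF X] by simp
  note linF = lin_Fa[OF linA, unfolded GC_simps(13)]
  let ?f = "\<lambda>t. fn (Fa (Lunit GC X)) (fn (phi (graded_line 0) X) (fn (TensA LC phi0 (Id LC (Fo X))) t))"
  have eq: "?f t = fn (Lunit LC (Fo X)) t" if t: "t \<in> ?S" for t
  proof (rule lin_eqI[OF sp _ _ _ t])
    show "linear_on ?S ?f"
      by (rule lin_compose[OF lin_compose[OF lin_TensA[OF T1] lin_phi[OF line0_L X] TensA_mem[OF T1]] linF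
            lhom_mem[OF phi_lhom[OF line0_L X], unfolded carr_TM, OF TensA_mem[OF T1]]])
    show "linear_on ?S (fn (Lunit LC (Fo X)))" by (rule lin_Lunit[OF FX])
    fix t assume "t \<in> proj AA (Fo X) ` pure_tensors (ee ` l) (Fgen X)"
    then obtain x y v h where *: "x \<in> l" "y \<in> l" "v \<in> X h" "t = proj AA (Fo X) (ee x \<otimes> (ee y \<otimes> v))"
      unfolding Fgen_def by blast
    note x = *(1) and y = *(2) and v = totI[of v X, OF *(3)]
    note my = Fo_memI[OF y v]
    have ev: "ee 0 \<otimes> v \<in> tot (graded_tensor (graded_line 0) X)"
      unfolding tot_gtensor[OF line0_L X] by (rule tensorI[OF ee0_tot v])
    have i: "fn (Id LC (Fo X)) (ee y \<otimes> v) = ee y \<otimes> v" using my by simp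
    have c: "fn (Fa (Lunit GC X)) (ee (x + y) \<otimes> (ee 0 \<otimes> v)) = ee (x + y) \<otimes> v"
      using Fa_otimes[OF linA, unfolded GC_simps(13), OF ee_in_AA[OF l_add[OF x y]] ev] line0_left(2)[OF X v] by simp
    \<comment> \<open>The unit line sits in degree 0, so its braiding factor \<open>q 0 y\<close> is
      1 and both sides carry only \<open>\<alpha> x y\<close>.\<close>
    show "?f t = fn (Lunit LC (Fo X)) t"
      unfolding *(4) Lunit_proj[OF FX tensorI[OF ee_in_AA[OF x] my]] lact_Fo[OF X x y v]
        TensA_proj[OF T1 ee_in_AA[OF x] my] i phi0_apply[OF ee_in_AA[OF x]] phi_otimes[OF line0_L X x y ee0_line v]
        lin_scale[OF linF Fo_memI[OF l_add[OF x y] ev]] c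
      by simp
  qed
  show "fn ?lhs = fn ?rhs"
  proof
    fix t show "fn ?lhs t = fn ?rhs t"
      using eq[of t] extensional_arb[OF Lunit_ext[OF FX], of t]
      by (cases "t \<in> ?S") (simp_all add: compose_def)
  qed
qed

lemma phi_runit:
  assumes X: "X \<in> graded_obj L"
  shows "Comp LC (Fa (Runit GC X)) (Comp LC (phi X (graded_line 0)) (TensA LC (Id LC (Fo X)) phi0)) = Runit LC (Fo X)"
    (is "?lhs = ?rhs")
proof (rule arrow_eqI)
  show "src ?lhs = src ?rhs" "tgt ?lhs = tgt ?rhs" by simp_all
  note FX = wmod_Fo[OF X] and F1 = wmod_Fo[OF line0_L]
  let ?S = "TS (Fo X) AA"
  note T1 = FX FX wmod_AA F1 Id_lhom[OF FX] phi0_lhom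
  have sp: "?S = fs.span (proj (Fo X) AA ` pure_tensors (Fgen X) (ee ` l))"
    by (rule TS_span_gen[OF FX wmod_AA carr_Fo_span[OF X] carr_AA])
  have linA: "linear_on (tot (src (Runit GC X))) (fn (Runit GC X))" using line0_right(1)[OF X] by simp
  note linF = lin_Fa[OF linA, unfolded GC_simps(16)]
  let ?f = "\<lambda>t. fn (Fa (Runit GC X)) (fn (phi X (graded_line 0)) (fn (TensA LC (Id LC (Fo X)) phi0) t))"
  have eq: "?f t = fn (Runit LC (Fo X)) t" if t: "t \<in> ?S" for t
  proof (rule lin_eqI[OF sp _ _ _ t])
    show "linear_on ?S ?f"
      by (rule lin_compose[OF lin_compose[OF lin_TensA[OF T1] lin_phi[OF X line0_L] TensA_mem[OF T1]] linF
            lhom_mem[OF phi_lhom[OF X line0_L], unfolded carr_TM, OF TensA_mem[OF T1]]])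
    show "linear_on ?S (fn (Runit LC (Fo X)))" by (rule lin_Runit[OF FX])
    fix t assume "t \<in> proj (Fo X) AA ` pure_tensors (Fgen X) (ee ` l)"
    then obtain x y v h where *: "x \<in> l" "y \<in> l" "v \<in> X h" "t = proj (Fo X) AA ((ee x \<otimes> v) \<otimes> ee y)"
      unfolding Fgen_def by blast
    note x = *(1) and y = *(2) and v = totI[of v X, OF *(3)]
    note mx = Fo_memI[OF x v]
    have ev: "v \<otimes> ee 0 \<in> tot (graded_tensor X (graded_line 0))"
      unfolding tot_gtensor[OF X line0_L] by (rule tensorI[OF v ee0_tot])
    have i: "fn (Id LC (Fo X)) (ee x \<otimes> v) = ee x \<otimes> v" using mx by simp
    have c: "fn (Fa (Runit GC X)) (ee (x + y) \<otimes> (v \<otimes> ee 0)) = ee (x + y) \<otimes> v"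
      using Fa_otimes[OF linA, unfolded GC_simps(16), OF ee_in_AA[OF l_add[OF x y]] ev] line0_right(2)[OF X v] by simp
    \<comment> \<open>The right unitor is induced by the right action, whose scalar on a free module
      is the very one in \<open>phi_otimes\<close>; no identity between scalars is left to
      prove.\<close>
    show "?f t = fn (Runit LC (Fo X)) t"
      unfolding *(4) Runit_proj[OF FX tensorI[OF mx ee_in_AA[OF y]]] ract_Fo[OF X x y *(3)]
        TensA_proj[OF T1 mx ee_in_AA[OF y]] i phi0_apply[OF ee_in_AA[OF y]] phi_otimes[OF X line0_L x y *(3) ee0_tot]
        lin_scale[OF linF Fo_memI[OF l_add[OF x y] ev]] c ..
  qed
  show "fn ?lhs = fn ?rhs"
  proof
    fix t show "fn ?lhs t = fn ?rhs t"
      using eq[of t] extensional_arb[OF Runit_ext[OF FX], of t]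
      by (cases "t \<in> ?S") (simp_all add: compose_def)
  qed
qed

lemma phi_braid:
  assumes X: "X \<in> graded_obj L" and Y: "Y \<in> graded_obj L"
  shows "Comp LC (Fa (Braid GC X Y)) (phi X Y) = Comp LC (phi Y X) (Braid LC (Fo X) (Fo Y))" (is "?lhs = ?rhs")
proof (rule arrow_eqI)
  show "src ?lhs = src ?rhs" "tgt ?lhs = tgt ?rhs" by simp_all
  note FX = wmod_Fo[OF X] and FY = wmod_Fo[OF Y]
  let ?S = "TS (Fo X) (Fo Y)"
  have linA: "linear_on (tot (src (Braid GC X Y))) (fn (Braid GC X Y))" using lin_GC_Braid[OF X Y] by simp
  note linF = lin_Fa[OF linA, simplified]
  let ?f = "\<lambda>t. fn (Fa (Braid GC X Y)) (fn (phi X Y) t)"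
  let ?g = "\<lambda>t. fn (phi Y X) (fn (Braid LC (Fo X) (Fo Y)) t)"
  have eq: "?f t = ?g t" if t: "t \<in> ?S" for t
  proof (rule lin_eqI[OF TS_Fo_span[OF X Y] _ _ _ t])
    show "linear_on ?S ?f"
      by (rule lin_compose[OF lin_phi[OF X Y] linF lhom_mem[OF phi_lhom[OF X Y], unfolded carr_TM]])
    show "linear_on ?S ?g"
      by (rule lin_compose[OF lin_Braid[OF FX FY] lin_phi[OF Y X] Braid_mem[OF FX FY]])
    fix t assume "t \<in> proj (Fo X) (Fo Y) ` pure_tensors (Fgen X) (Fgen Y)"
    then obtain x h v y k u where *: "x \<in> l" "h \<in> L" "v \<in> X h" "y \<in> l" "k \<in> L" "u \<in> Y k"
      "t = proj (Fo X) (Fo Y) ((ee x \<otimes> v) \<otimes> (ee y \<otimes> u))"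
      unfolding Fgen_def by blast
    note x = *(1) and y = *(4)
    note v = totI[of v X, OF *(3)] and u = totI[of u Y, OF *(6)]
    have vu: "v \<otimes> u \<in> tot (graded_tensor X Y)" unfolding tot_gtensor[OF X Y] by (rule tensorI[OF v u])
    have b: "proj (Fo Y) (Fo X) ((ee y \<otimes> u) \<otimes> (ee x \<otimes> v)) \<in> TS (Fo Y) (Fo X)"
      by (rule proj_memI[OF Fo_memI[OF y u] Fo_memI[OF x v]])
    have c: "fn (Fa (Braid GC X Y)) (ee (x + y) \<otimes> (v \<otimes> u)) = fscale (q h k) (ee (x + y) \<otimes> (u \<otimes> v))"
      using Fa_otimes[OF linA, of "ee (x + y)" "v \<otimes> u"] ee_in_AA[OF l_add[OF x y]] vu GC_Braid[OF X Y *(3,6)]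
      by (simp add: otimes_scale_right)
    \<comment> \<open>Expanding \<open>q (x + h) (y + k)\<close> gives four factors:
      \<open>q x k\<close> cancels against the \<open>q k x\<close> of \<open>phi Y X\<close>,
      \<open>q x y\<close> swaps the cocycle, \<open>q h y\<close> belongs to
      \<open>phi X Y\<close>, and \<open>q h k\<close> is the braiding of the graded spaces.\<close>
    have "q k x * q k x = 1" by (rule q_sq[OF L_int(1)[OF *(5) x]])
    then have "q (x + h) (y + k) * (q k x * \<alpha> y x) = q h y * (q x y * \<alpha> y x) * q h k"
      by (simp add: q_add_left q_add_right q_sym[of x k] mult_ac)
    then have e: "q h y * \<alpha> x y * q h k = q (x + h) (y + k) * (q k x * \<alpha> y x)"
      unfolding alpha_swap[OF x y] by (rule sym)
    show "?f t = ?g t"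
      unfolding *(7) phi_otimes[OF X Y x y *(3) u] lin_scale[OF linF Fo_memI[OF l_add[OF x y] vu]] c
        Braid_proj[OF FX FY Fo_wspace[OF X x *(3)] Fo_wspace[OF Y y *(6)]] lin_scale[OF lin_phi[OF Y X] b]
        phi_otimes[OF Y X y x *(6) v] fs.scale_scale e add.commute[of y x] ..
  qed
  show "fn ?lhs = fn ?rhs"
  proof
    fix t show "fn ?lhs t = fn ?rhs t"
      using eq[of t] by (cases "t \<in> ?S") (simp_all add: compose_def)
  qed
qed

lemma braided_monoidal_functor_Fo:
  "braided_monoidal_functor GC (LC :: (('h, 'b) amod, _) braided_cat) Fo Fa phi phi0"
  unfolding braided_monoidal_functor_def GC_simps(1-4) LC_simps(1-4)
  by (intro conjI ballI; (rule wmod_local_obj[OF wmod_Fo] Fa_lhom Fa_Id Fa_Comp phi_iso phi_natural phi0_iso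
      phi_assoc phi_lunit phi_runit phi_braid; assumption))

section \<open>Supports of the modules attached to lines\<close>

text \<open>A nonzero weight vector has a nonzero component along some \<open>?e y\<close>, and
  projecting to that line commutes with the action, so its character is that of \<open>?e y\<close>.
  Different \<open>y\<close> may share a character; only the set of characters is claimed.\<close>

lemma weight_support_line:
  assumes x: "x \<in> L"
  shows "weight_support l (Fo (graded_line x) :: ('h, 'b) amod) = (\<lambda>y. restrict (form (x + y)) l) ` l"
proof -
  let ?V = "graded_line x :: ('h, 'b) graded"
  let ?e = "\<lambda>y. ee y \<otimes> ee x :: ('h, 'b) vec"
  have V: "?V \<in> graded_obj L" by (rule graded_line_obj[OF x])
  have ex: "ee x \<in> ?V x" unfolding graded_line_same by (simp add: fs.span_base)
  have carr: "carr (Fo ?V) = fs.span {?e y |y. y \<in> l}"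
  proof -
    have "{s \<otimes> t |s t. s \<in> ee ` l \<and> t \<in> {ee x}} = {?e y |y. y \<in> l}" by blast
    then show ?thesis unfolding carr_Fo tot_graded_line carr_AA tensor_span by simp
  qed
  have act: "act (Fo ?V) z (?e y) = fscale (form (x + y) z) (?e y)" if "y \<in> l" for y z
    using act_Fo[OF V that ex] by (simp add: add.commute)
  have nz: "?e y \<noteq> 0" for y
  proof
    assume "?e y = 0"
    from fun_cong[OF this, of "Node (Pt y) (Pt x)"] show False by (simp add: zero_fun_apply)
  qed
  show ?thesis
  proof (intro set_eqI iffI)
    fix \<chi> assume "\<chi> \<in> weight_support l (Fo ?V)"
    then have \<chi>: "\<chi> \<in> l \<rightarrow>\<^sub>E \<int>" and "weight_space l (Fo ?V) \<chi> \<noteq> {0}"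
      by (simp_all add: weight_support_def characters_def)
    \<comment> \<open>Excludes the empty set, so that differing from \<open>{0}\<close> provides a
      nonzero vector.\<close>
    moreover have "0 \<in> weight_space l (Fo ?V) \<chi>"
      using lin_zero[OF lin_act_Fo[OF V]] by (simp add: weight_space_def carr fs.span_zero)
    ultimately obtain m where m: "m \<in> carr (Fo ?V)" "\<And>z. z \<in> l \<Longrightarrow> act (Fo ?V) z m = fscale (\<chi> z) m" "m \<noteq> 0"
      unfolding weight_space_def by blast
    \<comment> \<open>Projection to the line through \<open>?e y\<close>, given by a single
      coordinate and therefore linear on all functions.\<close>
    define \<pi> where "\<pi> y t = fscale (t (Node (Pt y) (Pt x))) (?e y)" for y and t :: "('h, 'b) vec"
    have \<pi>: "linear_on W (\<pi> y)" for y W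
      by (intro linear_onI) (simp_all add: \<pi>_def plus_fun_apply fscale_apply fs.scale_left_distrib)
    have \<pi>e: "\<pi> y (?e y') = (if y = y' then ?e y else 0)" for y y' by (simp add: \<pi>_def)
    have "\<exists>y\<in>l. \<pi> y m \<noteq> 0"
    proof (rule ccontr)
      assume neg: "\<not> (\<exists>y\<in>l. \<pi> y m \<noteq> 0)"
      \<comment> \<open>Every element of the module vanishes at all indices other than
        \<open>Node (Pt y) (Pt x)\<close> with \<open>y\<close> in the lattice, so vanishing of all
        projections leaves nothing of \<open>m\<close>.\<close>
      have "m i = 0" for i
      proof (cases "\<exists>y\<in>l. i = Node (Pt y) (Pt x)")
        case True
        then obtain y where y: "y \<in> l" "i = Node (Pt y) (Pt x)" by blast
        from neg y(1) have "\<pi> y m = 0" by blast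
        then show ?thesis using nz[of y] by (simp add: \<pi>_def y(2))
      next
        case False
        have "fs.span {?e y |y. y \<in> l} \<subseteq> {t. t i = 0}"
        proof (rule fs.span_minimal)
          show "{?e y |y. y \<in> l} \<subseteq> {t. t i = 0}"
            using False by (auto simp: otimes_def ee_def split: idx.split)
          show "fs.subspace {t :: ('h, 'b) vec. t i = 0}"
            by (rule fs.subspaceI) (auto simp: pointwise)
        qed
        with m(1) carr show ?thesis by blast
      qed
      then show False using m(3) by (auto simp: fun_eq_iff zero_fun_apply)
    qed
    then obtain y where y: "y \<in> l" "\<pi> y m \<noteq> 0" by blast
    have "\<chi> z = form (x + y) z" if z: "z \<in> l" for z
    proof -
      have "\<pi> y (act (Fo ?V) z t) = fscale (form (x + y) z) (\<pi> y t)" if t: "t \<in> carr (Fo ?V)" for t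
      proof (rule lin_eqI[OF carr lin_compose[OF lin_act_Fo[OF V] \<pi> UNIV_I] lin_fscale[OF \<pi>] _ t])
        fix t assume "t \<in> {?e y |y. y \<in> l}"
        then obtain y' where y': "y' \<in> l" "t = ?e y'" by blast
        show "\<pi> y (act (Fo ?V) z t) = fscale (form (x + y) z) (\<pi> y t)"
          unfolding y'(2) act[OF y'(1)] lin_scale[OF \<pi>[of UNIV] UNIV_I] \<pi>e by simp
      qed
      from this[OF m(1)] have "fscale (\<chi> z) (\<pi> y m) = fscale (form (x + y) z) (\<pi> y m)"
        unfolding m(2)[OF z] lin_scale[OF \<pi>[of UNIV] UNIV_I] .
      with y(2) show ?thesis by simp
    qed
    then have "\<chi> = restrict (form (x + y)) l"
      using \<chi> by (intro extensionalityI[of _ l]) (auto simp: PiE_def)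
    with y(1) show "\<chi> \<in> (\<lambda>y. restrict (form (x + y)) l) ` l" by blast
  next
    fix \<chi> assume "\<chi> \<in> (\<lambda>y. restrict (form (x + y)) l) ` l"
    then obtain y where y: "y \<in> l" "\<chi> = restrict (form (x + y)) l" by blast
    have "x + y \<in> L" by (rule L_add[OF x l_in_L[OF y(1)]])
    then have "\<chi> \<in> characters l"
      unfolding characters_def y(2) by (auto simp: L_int l_add form_add_right)
    moreover have "?e y \<in> weight_space l (Fo ?V) \<chi>"
      using act[OF y(1)] y Fo_memI[OF y(1) totI[of _ ?V, OF ex]]
      by (simp add: weight_space_def)
    ultimately show "\<chi> \<in> weight_support l (Fo ?V)"
      unfolding weight_support_def using nz[of y] by blast
  qed
qed

text \<open>The element \<open>x\<close> represents its own coset, and the support computed for the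
  line is the one attached to this representative.\<close>

lemma Fo_line_component:
  assumes x: "x \<in> L"
  shows "(Fo (graded_line x) :: ('h, 'b) amod) \<in> local_component sc form l \<alpha> (lattice_coset form l x)"
proof -
  have "x \<in> lattice_coset form l x"
    unfolding lattice_coset_def by (rule CollectI, rule exI[of _ 0], rule exI[of _ 0]) (simp add: perp_def)
  then show ?thesis
    unfolding local_component_def
    using wmod_local_obj[OF wmod_Fo[OF graded_line_obj[OF x]]] weight_support_line[OF x] by blast
qed

end

theorem proposition5p6:
  fixes sc :: "complex \<Rightarrow> 'h::ab_group_add \<Rightarrow> 'h"
    and form :: "'h \<Rightarrow> 'h \<Rightarrow> complex"
    and l :: "'h set"
    and \<alpha> :: "'h \<Rightarrow> 'h \<Rightarrow> complex"
  assumes "vector_space sc"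
    and "\<exists>S. finite S \<and> module.span sc S = UNIV"
    and "symmetric_bilinear sc form"
    and "nondegenerate form"
    and "subgroup_of l"
    and "\<And>x y. x \<in> l \<Longrightarrow> y \<in> l \<Longrightarrow> form x y \<in> \<int>"
    and "\<And>x. x \<in> l \<Longrightarrow> \<exists>k::int. form x x = of_int (2 * k)"
    and "normalised_cocycle l \<alpha>"
    and "\<And>x y. x \<in> l \<Longrightarrow> y \<in> l \<Longrightarrow> \<alpha> x y * inverse (\<alpha> y x) = exp (pi * \<i> * form x y)"
  shows "\<exists>(Fo :: ('h, 'b) graded \<Rightarrow> ('h, 'b) amod) Fa \<phi> \<phi>0.
           braided_monoidal_functor
             (graded_cat (dual_lattice form l) (\<lambda>x y. exp (pi * \<i> * form x y)))
             (local_cat sc form l \<alpha>) Fo Fa \<phi> \<phi>0 \<and>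
           (\<forall>x \<in> dual_lattice form l.
              Fo (graded_line x) \<in> local_component sc form l \<alpha> (lattice_coset form l x))"
proof -
  interpret lattice_setting sc form l \<alpha>
    by (rule lattice_setting.intro) (fact assms)+
  have q: "(\<lambda>x y. exp (pi * \<i> * form x y)) = q" by (simp add: q_def fun_eq_iff)
  show ?thesis
    unfolding q using braided_monoidal_functor_Fo Fo_line_component by blast
qed

end
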